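(* Let $\mathcal{W}_h\subset\mathcal{V}_h$ be a linear subspace such that $\Omega\cdot\overline{\Omega\mathcal{W}_h}\subset\mathcal{W}_h$, and take the inflow boundary data $\alpha=0$. For each $\varepsilon>0$ let $\psi_h=\psi_h^{\varepsilon}=(\psi_{h,1},\dots,\psi_{h,n_\Omega})\in\mathcal{W}_h$ be the unique solution of $$B(\psi_h,v)=Q_0(v)\qquad\forall v\in\mathcal{W}_h ,$$ and let $J_h=J_h^{\varepsilon}=\frac1\varepsilon\sum_{j=1}^{n_\Omega}w_j\Omega_j\psi_{h,j}\in\overline{\Omega\mathcal{W}_h}$. Then, as $\varepsilon\to0$, $\psi_h$ and $J_h$ converge to limits $\psi_h^{(0)}=\overline{\psi}_h^{(0)}\in\mathcal{C}_{h,\mathrm{zero}}\cap\mathcal{W}_h$ and $J_h^{(0)}\in\overline{\Omega\mathcal{W}_h}$, respectively, and the pair $(\psi_h^{(0)},J_h^{(0)})$ is the unique solution in $(\mathcal{C}_{h,\mathrm{zero}}\cap\mathcal{W}_h)\times\overline{\Omega\mathcal{W}_h}$ of the mixed problem $$\sum_{K\in\mathcal{T}_h}\int_K\left(-J_h^{(0)}\cdot\nabla\varphi+\sigma_{\mathrm a}\psi_h^{(0)}\varphi\right)dx=\int_D q\,\varphi\,dx,$$ $$\sum_{K\in\mathcal{T}_h}\int_K\left(\tfrac13\nabla\psi_h^{(0)}+\sigma_{\mathrm s}J_h^{(0)}\right)\cdot\zeta\,dx=0,$$ for all $\varphi\in\mathcal{C}_{h,\mathrm{zero}}\cap\mathcal{W}_h$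 and all $\zeta\in\overline{\Omega\mathcal{W}_h}$.
   Context: Data. $D\subset\mathbb{R}^d$ ($d=1,2,3$) is an open bounded Lipschitz domain; $\sigma_{\mathrm s},\sigma_{\mathrm a}$ are bounded measurable functions on $D$ with $\inf_D\sigma_{\mathrm s}=\delta_{\mathrm s}>0$, $\inf_D\sigma_{\mathrm a}=\delta_{\mathrm a}>0$; $q\in L^2(D)$ is a function of $x$ only. All of these are independent of the parameter $\varepsilon>0$. Angular quadrature. $S$ is the projection of the unit sphere of $\mathbb{R}^3$ into $\mathbb{R}^d$. Points $\Omega_1,\dots,\Omega_{n_\Omega}\in S\subset\mathbb{R}^d$ and weights $w_j>0$ satisfy $\sum_jw_j=1$, $\sum_jw_j\Omega_j=0$, $\sum_jw_j\,\Omega_j\otimes\Omega_j=\frac13\mathrm{Id}$. For $v=(v_1,\dots,v_{n_\Omega})$ put $\overline v=\sum_jw_jv_j$. Mesh and spaces. $\mathcal{T}_h=\{K\}$ is a finite partition of $D$ (the closures of the cells $K$ cover $D$) into simplices (intervals, triangles, tetrahedra) or into Cartesian cells. $Z_1(K)=P^1(K)$ (linear polynomials) for simplicial meshes and $Z_1(K)=Q^1(K)$ (multilinear polynomials) for Cartesian meshes. $V_h=\{v: v|_K\in Z_1(K)\ \forall K\in\mathcal{T}_h\}$ (discontinuous across cells) and $\mathcal{V}_h=\prod_{j=1}^{n_\Omega}V_h$. The isotropic subspace is $\overline{\mathcal{V}}_h=\{v\in\mathcal{V}_h: v_j=\overline v\ \forall j\}$, identified with $V_h$; thus an isotropic element is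 also regarded as a scalar function of $x$. $\mathcal{C}_{h,\mathrm{zero}}$ is the set of elements of $\overline{\mathcal{V}}_h$ that are continuous and vanish on $\partial D$. $\overline{\mathcal{V}}_h^d$ is the space of $\mathbb{R}^d$-valued functions with components in $V_h$. For $\mathcal{W}_h\subset\mathcal{V}_h$, $$\overline{\Omega\mathcal{W}_h}=\Big\{\sum_{j}w_j\Omega_jv_j: v\in\mathcal{W}_h\Big\}\subset\overline{\mathcal{V}}_h^d,\qquad \Omega\cdot\overline{\Omega\mathcal{W}_h}=\{(\Omega_1\cdot\zeta,\dots,\Omega_{n_\Omega}\cdot\zeta):\zeta\in\overline{\Omega\mathcal{W}_h}\}\subset\mathcal{V}_h .$$ Bilinear and linear forms. $\nu_K$ is the outward unit normal on $\partial K$, $v^{\mathrm{int}}$ is the trace on $\partial K$ from inside $K$, and $\widehat u_j(x)=\lim_{\delta\to0^-}u_j(x+\delta\Omega_j)$ is the upwind trace at $x\in\partial K$, taken to be $0$ when the limit is taken from outside $D$. Then $$B(u,v)=\sum_{K}\sum_{j}w_j\Big[-\int_Ku_j\,\Omega_j\cdot\nabla v_j\,dx+\int_{\partial K}\widehat u_j\,(\Omega_j\cdot\nu_K)\,v_j^{\mathrm{int}}\,dx+\int_K\Big(\frac{\sigma_{\mathrm s}}{\varepsilon}+\varepsilon\sigma_{\mathrm a}\Big)u_jv_j\,dx-\int_K\frac{\sigma_{\mathrm s}}{\varepsilon}\overline u\,v_j\,dx\Big],$$ $$Q_0(v)=\sum_K\sum_jw_j\int_K\varepsilon q\,v_j\,dx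 .$$ For every $\varepsilon>0$ and every linear subspace $\mathcal{W}_h\subset\mathcal{V}_h$, the problem $B(\psi_h,v)=Q_0(v)$ for all $v\in\mathcal{W}_h$ has a unique solution $\psi_h\in\mathcal{W}_h$. Convergence is in the finite-dimensional spaces $\mathcal{V}_h$ and $\overline{\mathcal{V}}_h^d$ (any norm), with the mesh fixed. *)

theory Defs
  imports "HOL-Analysis.Analysis"
begin

section \<open>Domain and angular quadrature\<close>

text \<open>Near every boundary point the domain is, up to a rigid motion, the strict epigraph of a
  Lipschitz function. The rigid motion is encoded by the unit vector \<open>n\<close> giving the vertical
  direction: \<open>y \<bullet> n\<close> is the height of \<open>y\<close> and \<open>y - (y \<bullet> n) *\<^sub>R n\<close> its horizontal part.\<close>

definition lipschitz_domain :: "(real^'d) set \<Rightarrow> bool" where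
  "lipschitz_domain D \<longleftrightarrow>
     open D \<and> connected D \<and> D \<noteq> {} \<and>
     (\<forall>x\<in>frontier D. \<exists>r>0. \<exists>n. norm n = 1 \<and>
        (\<exists>\<gamma> :: real^'d \<Rightarrow> real. \<exists>L. L-lipschitz_on UNIV \<gamma> \<and>
           D \<inter> ball x r = {y \<in> ball x r. \<gamma> (y - (y \<bullet> n) *\<^sub>R n) < y \<bullet> n}))"

text \<open>Image of the unit sphere of \<open>\<real>\<^sup>3\<close> under the coordinate projections onto \<open>\<real>\<^sup>d\<close>, \<open>d \<le> 3\<close>
  (the sphere itself if \<open>d = 3\<close>, the closed unit ball if \<open>d < 3\<close>). The image does not depend on
  which \<open>d\<close> coordinates are kept.\<close>

definition projected_sphere :: "(real^'d) set" where
  "projected_sphere =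
     {(\<chi> i. y $ f i) | (y :: real^3) (f :: 'd \<Rightarrow> 3). norm y = 1 \<and> inj f}"

definition angular_quadrature :: "('m::finite \<Rightarrow> real) \<Rightarrow> ('m \<Rightarrow> real^'d) \<Rightarrow> bool" where
  "angular_quadrature w \<Omega> \<longleftrightarrow>
     (\<forall>j. \<Omega> j \<in> projected_sphere) \<and> (\<forall>j. w j > 0) \<and>
     (\<Sum>j\<in>UNIV. w j) = 1 \<and>
     (\<Sum>j\<in>UNIV. w j *\<^sub>R \<Omega> j) = 0 \<and>
     (\<Sum>j\<in>UNIV. w j *\<^sub>R (\<chi> a b. \<Omega> j $ a * \<Omega> j $ b)) = ((1/3) *\<^sub>R mat 1 :: real^'d^'d)"

definition avg :: "('m::finite \<Rightarrow> real) \<Rightarrow> ('m \<Rightarrow> real^'d \<Rightarrow> real) \<Rightarrow> real^'d \<Rightarrow> real" where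
  "avg w v = (\<lambda>x. \<Sum>j\<in>UNIV. w j * v j x)"

definition flux :: "('m::finite \<Rightarrow> real) \<Rightarrow> ('m \<Rightarrow> real^'d) \<Rightarrow> ('m \<Rightarrow> real^'d \<Rightarrow> real)
    \<Rightarrow> real^'d \<Rightarrow> real^'d" where
  "flux w \<Omega> v = (\<lambda>x. \<Sum>j\<in>UNIV. (w j * v j x) *\<^sub>R \<Omega> j)"

section \<open>Meshes and discrete spaces\<close>

datatype mesh_type = Simplicial | Cartesian

text \<open>Cells are open sets.\<close>

definition is_cell :: "mesh_type \<Rightarrow> (real^'d) set \<Rightarrow> bool" where
  "is_cell mt K \<longleftrightarrow>
     (case mt of
        Simplicial \<Rightarrow> \<exists>S. int CARD('d) simplex S \<and> K = interior S
      | Cartesian \<Rightarrow> \<exists>a b. K = box a b \<and> box a b \<noteq> {})"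

text \<open>Hanging nodes are allowed.\<close>

definition is_mesh :: "mesh_type \<Rightarrow> (real^'d) set \<Rightarrow> (real^'d) set set \<Rightarrow> bool" where
  "is_mesh mt D T \<longleftrightarrow>
     finite T \<and> (\<forall>K\<in>T. is_cell mt K \<and> K \<subseteq> D) \<and> pairwise disjnt T \<and> D \<subseteq> (\<Union>K\<in>T. closure K)"

definition Z1 :: "mesh_type \<Rightarrow> (real^'d \<Rightarrow> real) set" where
  "Z1 mt =
     (case mt of
        Simplicial \<Rightarrow> {p. \<exists>a b. \<forall>x. p x = a + b \<bullet> x}
      | Cartesian \<Rightarrow> {p. \<exists>c :: 'd set \<Rightarrow> real. \<forall>x. p x = (\<Sum>I\<in>UNIV. c I * (\<Prod>i\<in>I. x $ i))})"

text \<open>A discontinuous piecewise polynomial has no canonical value on the (Lebesgue null) mesh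
  skeleton. To have exactly one function per element of the finite element space, the value is
  fixed to be \<open>0\<close> off the union of the open cells; values on cell boundaries enter only through
  the traces below.\<close>

definition V_h :: "mesh_type \<Rightarrow> (real^'d) set set \<Rightarrow> (real^'d \<Rightarrow> real) set" where
  "V_h mt T = {v. (\<forall>K\<in>T. \<exists>p\<in>Z1 mt. \<forall>x\<in>K. v x = p x) \<and> (\<forall>x. x \<notin> \<Union>T \<longrightarrow> v x = 0)}"

definition VV_h :: "mesh_type \<Rightarrow> (real^'d) set set \<Rightarrow> ('m \<Rightarrow> real^'d \<Rightarrow> real) set" where
  "VV_h mt T = {v. \<forall>j. v j \<in> V_h mt T}"

definition isotropic :: "mesh_type \<Rightarrow> (real^'d) set set \<Rightarrow> ('m::finite \<Rightarrow> real)
    \<Rightarrow> ('m \<Rightarrow> real^'d \<Rightarrow> real) set" where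
  "isotropic mt T w = {v \<in> VV_h mt T. \<forall>j. v j = avg w v}"

text \<open>In view of the convention on the skeleton, ``continuous and zero on the boundary'' is
  expressed by the existence of a continuous representative on \<open>closure D\<close>.\<close>

definition C_h_zero :: "mesh_type \<Rightarrow> (real^'d) set \<Rightarrow> (real^'d) set set \<Rightarrow> ('m::finite \<Rightarrow> real)
    \<Rightarrow> ('m \<Rightarrow> real^'d \<Rightarrow> real) set" where
  "C_h_zero mt D T w =
     {v \<in> isotropic mt T w.
        \<exists>g. continuous_on (closure D) g \<and> (\<forall>x\<in>\<Union>T. avg w v x = g x) \<and> (\<forall>x\<in>frontier D. g x = 0)}"

definition linear_subspace_of ::
    "('m \<Rightarrow> real^'d \<Rightarrow> real) set \<Rightarrow> ('m \<Rightarrow> real^'d \<Rightarrow> real) set \<Rightarrow> bool" where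
  "linear_subspace_of V W \<longleftrightarrow>
     W \<subseteq> V \<and> (\<lambda>j x. 0) \<in> W \<and>
     (\<forall>u\<in>W. \<forall>v\<in>W. (\<lambda>j x. u j x + v j x) \<in> W) \<and>
     (\<forall>c. \<forall>v\<in>W. (\<lambda>j x. c * v j x) \<in> W)"

definition flux_space :: "('m::finite \<Rightarrow> real) \<Rightarrow> ('m \<Rightarrow> real^'d)
    \<Rightarrow> ('m \<Rightarrow> real^'d \<Rightarrow> real) set \<Rightarrow> (real^'d \<Rightarrow> real^'d) set" where
  "flux_space w \<Omega> W = flux w \<Omega> ` W"

definition dot_flux_space :: "('m::finite \<Rightarrow> real) \<Rightarrow> ('m \<Rightarrow> real^'d)
    \<Rightarrow> ('m \<Rightarrow> real^'d \<Rightarrow> real) set \<Rightarrow> ('m \<Rightarrow> real^'d \<Rightarrow> real) set" where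
  "dot_flux_space w \<Omega> W = {(\<lambda>j x. \<Omega> j \<bullet> \<zeta> x) | \<zeta>. \<zeta> \<in> flux_space w \<Omega> W}"

section \<open>Traces and boundary integrals\<close>

definition grad :: "(real^'d \<Rightarrow> real) \<Rightarrow> real^'d \<Rightarrow> real^'d" where
  "grad f x = (\<chi> i. frechet_derivative f (at x) (axis i 1))"

definition interior_trace :: "(real^'d) set \<Rightarrow> (real^'d \<Rightarrow> real) \<Rightarrow> real^'d \<Rightarrow> real" where
  "interior_trace K v x = Lim (at x within K) v"

definition upwind_trace ::
    "(real^'d) set \<Rightarrow> real^'d \<Rightarrow> (real^'d \<Rightarrow> real) \<Rightarrow> real^'d \<Rightarrow> real" where
  "upwind_trace D \<omega> u x =
     Lim (at_left 0) (\<lambda>\<delta>. if x + \<delta> *\<^sub>R \<omega> \<in> D then u (x + \<delta> *\<^sub>R \<omega>) else 0)"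

definition outer_normal :: "(real^'d) set \<Rightarrow> (real^'d) set \<Rightarrow> real^'d" where
  "outer_normal K F = (THE n. norm n = 1 \<and> (\<forall>x\<in>K. \<forall>y\<in>F. n \<bullet> x \<le> n \<bullet> y))"

text \<open>Integral with respect to the \<open>(d-1)\<close>-dimensional Lebesgue measure on a set \<open>F\<close> lying in a
  hyperplane with unit normal \<open>n\<close>. That measure is the image of the \<open>d\<close>-dimensional Lebesgue
  measure on the right prism of height \<open>1\<close> over \<open>F\<close> under the orthogonal projection onto the
  hyperplane; it is the counting measure of a point if \<open>d = 1\<close>.\<close>

definition facet_integral ::
    "real^'d \<Rightarrow> (real^'d) set \<Rightarrow> (real^'d \<Rightarrow> real) \<Rightarrow> real" where
  "facet_integral n F f =
     (LINT z|lebesgue_on {y + t *\<^sub>R n | y t. y \<in> F \<and> 0 \<le> t \<and> t \<le> 1}.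
        f (closest_point (affine hull F) z))"

text \<open>The integrand receives the outward unit normal and the boundary point.\<close>

definition boundary_integral ::
    "(real^'d) set \<Rightarrow> (real^'d \<Rightarrow> real^'d \<Rightarrow> real) \<Rightarrow> real" where
  "boundary_integral K f =
     (\<Sum>F | F facet_of closure K. facet_integral (outer_normal K F) F (f (outer_normal K F)))"

section \<open>The transport problem and the mixed problem\<close>

definition B_form :: "(real^'d) set \<Rightarrow> (real^'d) set set \<Rightarrow> ('m::finite \<Rightarrow> real) \<Rightarrow> ('m \<Rightarrow> real^'d)
    \<Rightarrow> (real^'d \<Rightarrow> real) \<Rightarrow> (real^'d \<Rightarrow> real) \<Rightarrow> real
    \<Rightarrow> ('m \<Rightarrow> real^'d \<Rightarrow> real) \<Rightarrow> ('m \<Rightarrow> real^'d \<Rightarrow> real) \<Rightarrow> real" where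
  "B_form D T w \<Omega> \<sigma>s \<sigma>a \<epsilon> u v =
     (\<Sum>K\<in>T. \<Sum>j\<in>UNIV. w j *
        (- (LINT x|lebesgue_on K. u j x * (\<Omega> j \<bullet> grad (v j) x))
         + boundary_integral K (\<lambda>\<nu> x. upwind_trace D (\<Omega> j) (u j) x * (\<Omega> j \<bullet> \<nu>)
                                        * interior_trace K (v j) x)
         + (LINT x|lebesgue_on K. (\<sigma>s x / \<epsilon> + \<epsilon> * \<sigma>a x) * u j x * v j x)
         - (LINT x|lebesgue_on K. \<sigma>s x / \<epsilon> * avg w u x * v j x)))"

definition Q_form :: "(real^'d) set set \<Rightarrow> ('m::finite \<Rightarrow> real) \<Rightarrow> (real^'d \<Rightarrow> real) \<Rightarrow> real
    \<Rightarrow> ('m \<Rightarrow> real^'d \<Rightarrow> real) \<Rightarrow> real" where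
  "Q_form T w q \<epsilon> v = (\<Sum>K\<in>T. \<Sum>j\<in>UNIV. w j * (LINT x|lebesgue_on K. \<epsilon> * q x * v j x))"

text \<open>\<open>C\<close> and \<open>Z\<close> are the spaces of the primal variable (isotropic, read as a scalar function
  through \<open>avg w\<close>) and of the flux variable.\<close>

definition mixed_solution :: "(real^'d) set \<Rightarrow> (real^'d) set set \<Rightarrow> ('m::finite \<Rightarrow> real)
    \<Rightarrow> (real^'d \<Rightarrow> real) \<Rightarrow> (real^'d \<Rightarrow> real) \<Rightarrow> (real^'d \<Rightarrow> real)
    \<Rightarrow> ('m \<Rightarrow> real^'d \<Rightarrow> real) set \<Rightarrow> (real^'d \<Rightarrow> real^'d) set
    \<Rightarrow> ('m \<Rightarrow> real^'d \<Rightarrow> real) \<Rightarrow> (real^'d \<Rightarrow> real^'d) \<Rightarrow> bool" where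
  "mixed_solution D T w \<sigma>s \<sigma>a q C Z \<psi> J \<longleftrightarrow>
     \<psi> \<in> C \<and> J \<in> Z \<and>
     (\<forall>\<phi>\<in>C. (\<Sum>K\<in>T. LINT x|lebesgue_on K.
                 - (J x \<bullet> grad (avg w \<phi>) x) + \<sigma>a x * avg w \<psi> x * avg w \<phi> x)
             = (LINT x|lebesgue_on D. q x * avg w \<phi> x)) \<and>
     (\<forall>\<zeta>\<in>Z. (\<Sum>K\<in>T. LINT x|lebesgue_on K.
                 ((1/3) *\<^sub>R grad (avg w \<psi>) x + \<sigma>s x *\<^sub>R J x) \<bullet> \<zeta> x) = 0)"

end

theory Submission
  imports Defs "HOL-Library.Function_Algebras"
begin

text \<open>The cell integrals and the upwind boundary integrals of the transport form add up to a one-sided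
  difference quotient on the whole space: for piecewise smooth \<open>u\<close>, \<open>v\<close> extended by zero,
  \<open>\<Sum>\<^sub>K (- \<integral>\<^sub>K u \<omega> \<bullet> \<nabla>v + \<integral>\<^sub>\<partial>\<^sub>K \<hat>u (\<omega> \<bullet> \<nu>) v) = lim (1/t) \<integral> u(x) (v(x) - v(x + t \<omega>)) dx\<close> as \<open>t \<down> 0\<close>.
  The boundary terms arise from the layers that leave or enter a cell under the translation. For
  \<open>v = u\<close> the right-hand side is \<open>lim 1/(2t) \<parallel>u(\<cdot> + t \<omega>) - u\<parallel>\<^sup>2\<close>, so the form is nonnegative; if it
  vanishes for directions that span the space, then \<open>u\<close> is Lipschitz, hence continuous and zero on the
  boundary. If \<open>u\<close> or \<open>v\<close> is continuous, the limit follows by dominated convergence, and this replaces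
  integration by parts.

  Testing with the solution bounds \<open>\<psi>\<close> and \<open>(\<psi> - avg \<psi>) / \<epsilon>\<close> in \<open>L\<^sup>2\<close>, so \<open>\<psi>\<close> and \<open>J\<close> have cluster points in the
  finite-dimensional space \<open>W\<close>. Testing with isotropic continuous functions and with \<open>\<Omega> \<cdot> \<zeta>\<close> shows that
  every cluster point solves the mixed problem, whose solution is unique.\<close>

text \<open>Facets of neighbouring cells need not match, so jumps cannot be paired face by face.
  Comparing the zero extension of \<open>u\<close> with its translate never asks which cells touch:
  a jump across a surface transverse to \<omega> contributes order \<open>t\<close> to the integral
  of the squared difference, the smooth part only order \<open>t^2\<close>. Zero energy therefore
  excludes jumps, and the passage from \<open>o(t)\<close> for one short shift to a Lipschitz bound
  uses that a long shift is a sum of short ones. The space \<open>W\<close> is closed under \<Omega>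
  times \<open>flux\<close>, but need not contain the averages of its elements, so \<psi> cannot be
  split inside \<open>W\<close> into an average and a deviation. The deviation is therefore
  estimated pointwise, the flux is carried by the element \<Omega> times \<open>J\<close> of
  \<open>W\<close>, and a cluster point must be shown to be isotropic before it can serve as an
  isotropic test function. The factors 3 and \<open>1/3\<close> come from the second moment of the
  quadrature.\<close>

text \<open>The change of variables theorem for linear maps is only available in the library when the
  index type carries a well-order, hence this ordered copy of a finite type.\<close>

typedef 'a ordered_copy = "UNIV :: 'a set" ..

instantiation ordered_copy :: (finite) "{finite, wellorder}"
begin

definition less_eq_ordered_copy :: "'a ordered_copy \<Rightarrow> 'a ordered_copy \<Rightarrow> bool" where
  "x \<le> y \<longleftrightarrow> to_nat (Rep_ordered_copy x) \<le> to_nat (Rep_ordered_copy y)"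

definition less_ordered_copy :: "'a ordered_copy \<Rightarrow> 'a ordered_copy \<Rightarrow> bool" where
  "x < y \<longleftrightarrow> to_nat (Rep_ordered_copy x) < to_nat (Rep_ordered_copy y)"

instance
proof
  have "inj (Rep_ordered_copy :: 'a ordered_copy \<Rightarrow> 'a)"
    by (simp add: inj_on_def Rep_ordered_copy_inject)
  then show "finite (UNIV :: 'a ordered_copy set)"
    by (rule finite_imageD[rotated]) simp
  show "P a" if "\<And>x. (\<And>y. y < x \<Longrightarrow> P y) \<Longrightarrow> P x" for P and a :: "'a ordered_copy"
    by (induction a rule: measure_induct_rule[of "\<lambda>x. to_nat (Rep_ordered_copy x)"])
      (use that in \<open>auto simp: less_ordered_copy_def\<close>)
qed (auto simp: less_eq_ordered_copy_def less_ordered_copy_def Rep_ordered_copy_inject)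

end

section \<open>Lebesgue measure under rank-one perturbations of the identity\<close>

definition reindex :: "real^'d \<Rightarrow> real^('d ordered_copy)" where
  "reindex x = (\<chi> i. x $ Rep_ordered_copy i)"

definition unreindex :: "real^('d ordered_copy) \<Rightarrow> real^'d" where
  "unreindex x = (\<chi> i. x $ Abs_ordered_copy i)"

lemma unreindex_reindex [simp]: "unreindex (reindex x) = x"
  and reindex_unreindex [simp]: "reindex (unreindex y) = y"
  by (simp_all add: reindex_def unreindex_def vec_eq_iff Rep_ordered_copy_inverse Abs_ordered_copy_inverse)

lemma linear_reindex: "linear reindex" and linear_unreindex: "linear unreindex"
  by (auto intro!: linearI simp: reindex_def unreindex_def vec_eq_iff)

lemma bij_Abs_ordered_copy: "bij Abs_ordered_copy" and bij_Rep_ordered_copy: "bij Rep_ordered_copy"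
  by (rule o_bij[of Rep_ordered_copy], auto simp: fun_eq_iff Rep_ordered_copy_inverse Abs_ordered_copy_inverse)
    (rule o_bij[of Abs_ordered_copy], auto simp: fun_eq_iff Rep_ordered_copy_inverse Abs_ordered_copy_inverse)

lemma inner_reindex: "reindex x \<bullet> reindex y = x \<bullet> y"
  using sum.reindex_bij_betw[OF bij_Rep_ordered_copy, of "\<lambda>i. x $ i * y $ i"]
  by (simp add: inner_vec_def reindex_def)

lemma borel_measurable_linear:
  fixes f :: "'a::euclidean_space \<Rightarrow> 'b::euclidean_space"
  shows "linear f \<Longrightarrow> f \<in> borel_measurable borel"
  by (simp add: borel_measurable_continuous_onI linear_continuous_on linear_conv_bounded_linear)

lemma emeasure_lborel_box_cart:
  fixes l u :: "real^'d"
  assumes "\<And>i. l $ i \<le> u $ i"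
  shows "emeasure lborel (box l u) = (\<Prod>i\<in>UNIV. u $ i - l $ i)"
proof -
  have "(\<Prod>b\<in>Basis. (u - l) \<bullet> b) = (\<Prod>i\<in>UNIV. u $ i - l $ i)"
    unfolding Basis_vec_def
    by (simp add: UNION_singleton_eq_range prod.reindex inj_on_def axis_eq_axis cart_eq_inner_axis[symmetric])
  then show ?thesis
    using assms by (subst emeasure_lborel_box) (auto simp: Basis_vec_def cart_eq_inner_axis[symmetric])
qed

text \<open>Lebesgue measure is determined by its values on boxes, and the preimage of a box is a
  box with the same side lengths in another order.\<close>

lemma distr_reindex: "distr lborel borel reindex = (lborel :: (real^('d::finite ordered_copy)) measure)"
proof (rule lborel_eqI[symmetric])
  fix l u :: "real^('d ordered_copy)"
  assume "\<And>b. b \<in> Basis \<Longrightarrow> l \<bullet> b \<le> u \<bullet> b"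
  then have le: "l $ i \<le> u $ i" for i
    by (simp add: Basis_vec_def cart_eq_inner_axis) metis
  have "reindex -` box l u = box (unreindex l) (unreindex u)"
    by (auto simp: mem_box_cart reindex_def unreindex_def)
      (metis Abs_ordered_copy_inverse Rep_ordered_copy_inverse UNIV_I)+
  then have "emeasure (distr lborel borel reindex) (box l u) = emeasure lborel (box (unreindex l) (unreindex u))"
    by (subst emeasure_distr) (auto simp: borel_measurable_linear linear_reindex)
  also have "\<dots> = (\<Prod>i\<in>UNIV. u $ Abs_ordered_copy i - l $ Abs_ordered_copy i)"
    using le by (subst emeasure_lborel_box_cart) (auto simp: unreindex_def)
  also have "\<dots> = (\<Prod>i\<in>UNIV. u $ i - l $ i)"
    using prod.reindex_bij_betw[OF bij_Abs_ordered_copy, of "\<lambda>i. u $ i - l $ i"] by simp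
  also have "\<dots> = (\<Prod>b\<in>Basis. (u - l) \<bullet> b)"
    unfolding Basis_vec_def
    by (simp add: UNION_singleton_eq_range prod.reindex inj_on_def axis_eq_axis cart_eq_inner_axis[symmetric])
  finally show "emeasure (distr lborel borel reindex) (box l u) = (\<Prod>b\<in>Basis. (u - l) \<bullet> b)" .
qed simp

lemma distr_unreindex: "distr lborel borel unreindex = (lborel :: (real^'d) measure)"
proof -
  have "distr lborel borel unreindex = distr (distr lborel borel reindex) borel (unreindex :: _ \<Rightarrow> real^'d)"
    by (simp add: distr_reindex)
  also have "\<dots> = distr lborel borel (unreindex \<circ> reindex)"
    by (intro distr_distr) (auto simp: borel_measurable_linear linear_reindex linear_unreindex)
  also have "unreindex \<circ> reindex = (\<lambda>x::real^'d. x)"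
    by auto
  also have "distr lborel borel (\<lambda>x. x) = (lborel :: (real^'d) measure)"
    by (simp add: distr_id2)
  finally show ?thesis .
qed

text \<open>An orthogonal map taking \<open>n\<close> to a multiple of \<open>axis k\<close>
  conjugates the map to one whose matrix differs from the identity in column \<open>k\<close> only;
  for such a matrix Cramer's rule gives the determinant.\<close>

lemma det_rank_one_update:
  fixes n a :: "real^'d"
  shows "det (matrix (\<lambda>z. z + (n \<bullet> z) *\<^sub>R a)) = 1 + n \<bullet> a"
proof -
  \<comment> \<open>Any coordinate will do as target of the orthogonal map.\<close>
  obtain k :: 'd where True by blast
  obtain f where f: "orthogonal_transformation f" "f n = axis k (norm n)"
    by (rule orthogonal_transformation_exists[of n "axis k (norm n)"]) (simp_all add: norm_eq_sqrt_inner inner_axis_axis)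
  define L where "L = (\<lambda>z. z + (n \<bullet> z) *\<^sub>R a)"
  define M where "M = (\<lambda>z. z + (axis k (norm n) \<bullet> z) *\<^sub>R f a)"
  have lin: "linear L" "linear M" "linear f"
    unfolding L_def M_def using f(1)
    by (auto intro!: linearI simp: algebra_simps inner_simps orthogonal_transformation_linear)
  have "f \<circ> L = M \<circ> f"
    using f lin(3) by (auto simp: L_def M_def fun_eq_iff linear_add linear_cmul orthogonal_transformation_def f(2)[symmetric])
  then have "matrix f ** matrix L = matrix M ** matrix f"
    using lin by (metis matrix_compose)
  then have "det (matrix f) * det (matrix L) = det (matrix M) * det (matrix f)"
    by (metis det_mul)
  moreover have "det (matrix f) \<noteq> 0"
    using f(1) by (metis abs_zero orthogonal_transformation_det zero_neq_one)
  ultimately have "det (matrix L) = det (matrix M)"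
    by simp
  also have "matrix M = (\<chi> i j. if j = k then (mat 1 *v (axis k 1 + norm n *\<^sub>R f a)) $ i else mat 1 $ i $ j)"
    unfolding matrix_vector_mul_lid
    by (simp add: M_def matrix_def vec_eq_iff mat_def axis_def inner_axis_axis[unfolded axis_def])
  also have "det \<dots> = (axis k 1 + norm n *\<^sub>R f a) $ k * det (mat 1 :: real^'d^'d)"
    by (rule cramer_lemma)
  also have "\<dots> = 1 + axis k (norm n) \<bullet> f a"
    by (simp add: inner_axis' flip: axis_def)
  also have "\<dots> = 1 + n \<bullet> a"
    using f by (simp add: orthogonal_transformation_def flip: f(2))
  finally show ?thesis by (simp add: L_def)
qed

text \<open>The preimage of a box under \<open>f\<close> is its image under the inverse map, so the
  formula for the volume of a linear image determines the pushforward measure on boxes.\<close>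

lemma distr_linear_wellorder:
  fixes f :: "real^'n::{finite,wellorder} \<Rightarrow> real^'n::_"
  assumes "linear f" "det (matrix f) \<noteq> 0"
  shows "density (distr lborel borel f) (\<lambda>_. ennreal \<bar>det (matrix f)\<bar>) = lborel"
proof (rule lborel_eqI[symmetric])
  fix l u :: "real^'n::{finite,wellorder}"
  assume le: "\<And>b. b \<in> Basis \<Longrightarrow> l \<bullet> b \<le> u \<bullet> b"
  obtain g where g: "linear g" "\<And>x. g (f x) = x" "\<And>x. f (g x) = x"
    using assms det_nz_iff_inj linear_injective_isomorphism by metis
  have vim: "f -` box l u = g ` box l u"
  proof (intro set_eqI iffI)
    show "x \<in> g ` box l u" if "x \<in> f -` box l u" for x
      using that by (intro image_eqI[of _ _ "f x"]) (auto simp: g)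
  qed (auto simp: g)
  have f[measurable]: "f \<in> borel_measurable borel"
    by (simp add: borel_measurable_linear assms)
  have m: "g ` box l u \<in> lmeasurable"
    by (intro measurable_linear_image g) auto
  have borel: "g ` box l u \<in> sets borel"
    unfolding vim[symmetric] using measurable_sets[OF f, of "box l u"] by simp
  have "f ` g ` box l u = box l u"
    by (simp add: image_comp o_def g)
  then have "measure lebesgue (box l u) = \<bar>det (matrix f)\<bar> * measure lebesgue (g ` box l u)"
    using measure_linear_image[OF assms(1) m] by simp
  then have "\<bar>det (matrix f)\<bar> * measure lborel (g ` box l u) = (\<Prod>b\<in>Basis. (u - l) \<bullet> b)"
    using le borel by (simp add: measure_completion)
  moreover have "emeasure lborel (g ` box l u) = ennreal (measure lborel (g ` box l u))"
    using emeasure_eq_measure2[OF m] borel by (simp add: emeasure_completion measure_completion)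
  ultimately show "emeasure (density (distr lborel borel f) (\<lambda>_. ennreal \<bar>det (matrix f)\<bar>)) (box l u)
      = (\<Prod>b\<in>Basis. (u - l) \<bullet> b)"
    by (simp add: emeasure_density nn_integral_cmult_indicator emeasure_distr vim ennreal_mult[symmetric])
qed simp

text \<open>Conjugation by \<open>reindex\<close> gives a map of the same shape on the ordered index
  type and preserves \<open>n \<bullet> a\<close>.\<close>

lemma lborel_rank_one_update:
  fixes n a :: "real^'d"
  assumes "1 + n \<bullet> a \<noteq> 0"
  shows "density (distr lborel borel (\<lambda>z. z + (n \<bullet> z) *\<^sub>R a)) (\<lambda>_. ennreal \<bar>1 + n \<bullet> a\<bar>) = lborel"
proof -
  define L where "L = (\<lambda>z. z + (n \<bullet> z) *\<^sub>R a)"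
  define L' where "L' = (\<lambda>z. z + (reindex n \<bullet> z) *\<^sub>R reindex a)"
  have L': "linear L'" and L: "linear L"
    unfolding L_def L'_def by (auto intro!: linearI simp: algebra_simps inner_simps)
  have det: "det (matrix L') = 1 + n \<bullet> a"
    unfolding L'_def by (simp add: det_rank_one_update inner_reindex)
  have meas: "L \<in> borel_measurable borel" "L' \<in> borel_measurable borel"
      "(unreindex :: _ \<Rightarrow> real^'d) \<in> borel_measurable borel" "(reindex :: real^'d \<Rightarrow> _) \<in> borel_measurable borel"
    using L L' by (auto simp: borel_measurable_linear linear_reindex linear_unreindex)
  have eq: "L = unreindex \<circ> L' \<circ> reindex"
    by (simp add: fun_eq_iff L_def L'_def inner_reindex linear_add[OF linear_unreindex] linear_cmul[OF linear_unreindex])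
  have "lborel = distr (lborel :: (real^'d ordered_copy) measure) borel unreindex"
    by (simp add: distr_unreindex)
  also have "lborel = density (distr lborel borel L') (\<lambda>_. ennreal \<bar>1 + n \<bullet> a\<bar>)"
    using distr_linear_wellorder[OF L'] det assms by simp
  also have "distr \<dots> borel unreindex
      = density (distr (distr lborel borel L') borel unreindex) (\<lambda>_. ennreal \<bar>1 + n \<bullet> a\<bar>)"
    using meas by (intro density_distr[symmetric]) auto
  also have "distr (distr lborel borel L') borel unreindex
      = distr (distr (distr lborel borel reindex) borel L') borel (unreindex :: _ \<Rightarrow> real^'d)"
    by (simp add: distr_reindex)
  also have "\<dots> = distr lborel borel (unreindex \<circ> L' \<circ> reindex)"
    using meas by (simp add: distr_distr o_assoc)
  finally show ?thesis
    by (simp add: L_def flip: eq)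
qed

text \<open>This is the change of variables for thin layers at a facet: up to a translation, such a
  map takes a fixed prism to the layer, and the Jacobian factor is the thickness of the
  layer.\<close>

lemma integral_rank_one_update:
  fixes n a :: "real^'d" and f :: "real^'d \<Rightarrow> real"
  assumes "1 + n \<bullet> a \<noteq> 0" and [measurable]: "f \<in> borel_measurable borel"
  shows "integral\<^sup>L lborel f = \<bar>1 + n \<bullet> a\<bar> * (LINT z|lborel. f (z + (n \<bullet> z) *\<^sub>R a))"
proof -
  have [measurable]: "(\<lambda>z. z + (n \<bullet> z) *\<^sub>R a) \<in> borel_measurable borel"
    by measurable
  have "integral\<^sup>L lborel f
      = integral\<^sup>L (density (distr lborel borel (\<lambda>z. z + (n \<bullet> z) *\<^sub>R a)) (\<lambda>_. ennreal \<bar>1 + n \<bullet> a\<bar>)) f"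
    using lborel_rank_one_update[OF assms(1)] by simp
  also have "\<dots> = \<bar>1 + n \<bullet> a\<bar> * (LINT z|lborel. f (z + (n \<bullet> z) *\<^sub>R a))"
    by (simp add: integral_density integral_distr)
  finally show ?thesis .
qed

section \<open>Facets of a full-dimensional polytope\<close>

text \<open>The orthogonal projection is closest because
  \<open>\<bar>n \<bullet> (z - y)\<bar>\<close> is a lower bound for the distance from
  \<open>z\<close> to any \<open>y\<close> and is the same for all \<open>y\<close> in the
  hyperplane.\<close>

lemma closest_point_hyperplane:
  fixes n :: "'a::euclidean_space"
  assumes "norm n = 1"
  shows "closest_point {x. n \<bullet> x = b} z = z - (n \<bullet> z - b) *\<^sub>R n"
proof (rule closest_point_unique[symmetric])
  have nn: "n \<bullet> n = 1"
    using assms by (simp add: norm_eq_1)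
  show "z - (n \<bullet> z - b) *\<^sub>R n \<in> {x. n \<bullet> x = b}"
    by (simp add: inner_simps nn)
  show "\<forall>y\<in>{x. n \<bullet> x = b}. dist z (z - (n \<bullet> z - b) *\<^sub>R n) \<le> dist z y"
  proof safe
    fix y
    have "\<bar>n \<bullet> (z - y)\<bar> \<le> norm n * norm (z - y)"
      by (rule Cauchy_Schwarz_ineq2)
    then show "dist z (z - (n \<bullet> z - n \<bullet> y) *\<^sub>R n) \<le> dist z y"
      using assms by (simp add: dist_norm inner_simps)
  qed
qed (auto simp: closed_hyperplane convex_hyperplane)

text \<open>The component of \<open>n\<close> orthogonal to \<open>a\<close> can be added to a point
  of the first hyperplane without leaving it. Within the second hyperplane this makes the component
  orthogonal to \<open>n\<close>, hence to itself.\<close>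

lemma hyperplane_subset_imp_parallel:
  fixes a n :: "'a::real_inner"
  assumes "a \<noteq> 0" "{x. a \<bullet> x = b} \<subseteq> {x. n \<bullet> x = c}"
  shows "n = ((n \<bullet> a) / (a \<bullet> a)) *\<^sub>R a"
proof -
  define y where "y = (b / (a \<bullet> a)) *\<^sub>R a"
  define v where "v = n - ((n \<bullet> a) / (a \<bullet> a)) *\<^sub>R a"
  have av: "a \<bullet> v = 0"
    using assms(1) by (simp add: v_def inner_simps inner_commute)
  have "a \<bullet> y = b"
    using assms(1) by (simp add: y_def)
  with av have "y \<in> {x. a \<bullet> x = b}" "y + v \<in> {x. a \<bullet> x = b}"
    by (auto simp: inner_simps)
  with assms(2) have "n \<bullet> y = c" "n \<bullet> (y + v) = c"
    by blast+
  then have "n \<bullet> v = 0"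
    by (simp add: inner_simps)
  with av have "v \<bullet> v = 0"
    by (simp add: v_def inner_simps)
  then show ?thesis
    by (simp add: v_def)
qed

text \<open>Simplices and boxes are treated at once. The condition
  \<open>interior (closure K) = K\<close> makes \<open>K\<close> the set described by the strict
  facet inequalities.\<close>

locale open_polytope =
  fixes K :: "(real^'d) set"
  assumes polytope_closure: "polytope (closure K)"
    and interior_closure_eq: "interior (closure K) = K"
    and nonempty: "K \<noteq> {}"
begin

definition facets :: "(real^'d) set set" where
  "facets = {F. F facet_of closure K}"

definition nrm :: "(real^'d) set \<Rightarrow> real^'d" where
  "nrm F = outer_normal K F"

text \<open>The product with the normal is constant on a facet, so the choice of the point does not
  matter.\<close>

definition lvl :: "(real^'d) set \<Rightarrow> real" where
  "lvl F = nrm F \<bullet> (SOME y. y \<in> F)"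

lemma open_K: "open K"
  using open_interior[of "closure K"] interior_closure_eq by simp

lemma bounded_K: "bounded K"
  by (rule bounded_subset[OF polytope_imp_bounded[OF polytope_closure] closure_subset])

lemma convex_K: "convex K"
  using convex_interior[OF polytope_imp_convex[OF polytope_closure]] interior_closure_eq by simp

lemma aff_dim_closure: "aff_dim (closure K) = int CARD('d)" and affine_hull_closure: "affine hull closure K = UNIV"
proof -
  have "interior (closure K) \<noteq> {}"
    using interior_closure_eq nonempty by simp
  then show "aff_dim (closure K) = int CARD('d)"
    by (subst aff_dim_nonempty_interior) auto
  then show "affine hull closure K = UNIV"
    by (subst aff_dim_eq_full[symmetric]) simp
qed

lemma finite_facets: "finite facets"
  unfolding facets_def by (rule finite_polytope_facets[OF polytope_closure])

text \<open>\<open>outer_normal\<close> is a definite description, so its value is only available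
  after existence and uniqueness. By dimension the facet spans its supporting hyperplane; a
  competing normal is constant on the facet, hence parallel to \<open>a\<close>, and its sign is
  fixed because the cell lies strictly on one side.\<close>

lemma outer_normal_unique:
  assumes F: "F facet_of closure K" "F \<subseteq> {x. a \<bullet> x = b}" and a: "norm a = 1"
    and lt: "\<And>x. x \<in> K \<Longrightarrow> a \<bullet> x < b"
  shows "outer_normal K F = a" "affine hull F = {x. a \<bullet> x = b}"
proof -
  have "a \<noteq> 0" using a by auto
  have FK: "F \<subseteq> closure K" and Fne: "F \<noteq> {}" and Fdim: "aff_dim F = int CARD('d) - 1"
    using F aff_dim_closure by (auto simp: facet_of_def dest: face_of_imp_subset)
  show hull: "affine hull F = {x. a \<bullet> x = b}"
  proof (rule affine_dim_equal)
    show "affine hull F \<subseteq> {x. a \<bullet> x = b}"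
      using F(2) by (intro hull_minimal) (auto simp: affine_hyperplane)
    show "aff_dim (affine hull F) = aff_dim {x. a \<bullet> x = b}"
      using \<open>a \<noteq> 0\<close> Fdim by simp
  qed (use Fne in \<open>auto simp: affine_hyperplane\<close>)
  have "n = a" if n: "norm n = 1" "\<forall>x\<in>K. \<forall>y\<in>F. n \<bullet> x \<le> n \<bullet> y" for n
  proof -
    obtain y x where y: "y \<in> F" and x: "x \<in> K"
      using Fne nonempty by blast
    \<comment> \<open>Points of the facet are limits of points of \<open>K\<close>, so the
      inequality extends to pairs inside the facet. Exchanging the two points turns it into an
      equality.\<close>
    have "n \<bullet> z \<le> n \<bullet> y'" if "z \<in> F" "y' \<in> F" for z y'
    proof -
      have "closure K \<subseteq> {x. n \<bullet> x \<le> n \<bullet> y'}"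
        by (rule closure_minimal) (use n that in \<open>auto simp: closed_halfspace_le\<close>)
      then show ?thesis
        using that FK by auto
    qed
    then have "F \<subseteq> {x. n \<bullet> x = n \<bullet> y}"
      using y by (auto intro: antisym)
    then have "affine hull F \<subseteq> {x. n \<bullet> x = n \<bullet> y}"
      by (intro hull_minimal) (auto simp: affine_hyperplane)
    then have eq: "n = ((n \<bullet> a) / (a \<bullet> a)) *\<^sub>R a"
      unfolding hull using \<open>a \<noteq> 0\<close> hyperplane_subset_imp_parallel by blast
    define l where "l = (n \<bullet> a) / (a \<bullet> a)"
    have nl: "n = l *\<^sub>R a" using eq by (simp add: l_def)
    have "n \<bullet> x \<le> n \<bullet> y" and "a \<bullet> x < a \<bullet> y"
      using n x y F(2) lt[OF x] by auto
    then have "l * (a \<bullet> y - a \<bullet> x) \<ge> 0" "a \<bullet> y - a \<bullet> x > 0"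
      by (auto simp: nl algebra_simps)
    then have "l \<ge> 0"
      by (simp add: zero_le_mult_iff)
    moreover have "\<bar>l\<bar> = 1"
      using n(1) a by (simp add: nl)
    ultimately show ?thesis
      by (simp add: nl)
  qed
  moreover have "\<forall>x\<in>K. \<forall>y\<in>F. a \<bullet> x \<le> a \<bullet> y"
  proof (intro ballI)
    fix x y assume "x \<in> K" "y \<in> F"
    then show "a \<bullet> x \<le> a \<bullet> y"
      using lt[of x] F(2) by auto
  qed
  ultimately show "outer_normal K F = a"
    unfolding outer_normal_def using a by (intro the_equality) blast+
qed

text \<open>In a minimal family of half-spaces cutting out the closed cell, the bounding hyperplanes
  cut out exactly the facets, and strict inequalities describe the relative interior. Dividing by
  the norm of each normal brings the inequalities to the form with \<open>nrm\<close> and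
  \<open>lvl\<close>.\<close>

lemma facet_representation:
  shows norm_nrm: "\<And>F. F \<in> facets \<Longrightarrow> norm (nrm F) = 1"
    and facet_eq: "\<And>F. F \<in> facets \<Longrightarrow> F = closure K \<inter> {x. nrm F \<bullet> x = lvl F}"
    and affine_hull_facet: "\<And>F. F \<in> facets \<Longrightarrow> affine hull F = {x. nrm F \<bullet> x = lvl F}"
    and closure_eq: "closure K = {x. \<forall>F\<in>facets. nrm F \<bullet> x \<le> lvl F}"
    and K_eq: "K = {x. \<forall>F\<in>facets. nrm F \<bullet> x < lvl F}"
proof -
  have "polyhedron (closure K)"
    using polytope_closure polytope_imp_polyhedron by blast
  then obtain H where H: "finite H" "closure K = affine hull closure K \<inter> \<Inter>H"
      "\<forall>h\<in>H. \<exists>a b. a \<noteq> 0 \<and> h = {x. a \<bullet> x \<le> b}"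
      "\<And>F'. F' \<subset> H \<Longrightarrow> closure K \<subset> affine hull closure K \<inter> \<Inter>F'"
    unfolding polyhedron_Int_affine_minimal by metis
  then obtain a b where ab: "\<And>h. h \<in> H \<Longrightarrow> a h \<noteq> 0 \<and> h = {x. a h \<bullet> x \<le> b h}"
    by metis
  have fac: "F \<in> facets \<longleftrightarrow> (\<exists>h\<in>H. F = closure K \<inter> {x. a h \<bullet> x = b h})" for F
    unfolding facets_def using facet_of_polyhedron_explicit[OF H(1,2) ab H(4)] by auto
  have "rel_interior (closure K) = K"
    using interior_closure_eq nonempty by (simp add: rel_interior_nonempty_interior)
  then have int: "K = {x \<in> closure K. \<forall>h\<in>H. a h \<bullet> x < b h}"
    using rel_interior_polyhedron_explicit[OF H(1,2) ab H(4)] by simp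
  have key: "nrm F = a h /\<^sub>R norm (a h)" "lvl F = b h / norm (a h)" "affine hull F = {x. nrm F \<bullet> x = lvl F}"
    if h: "h \<in> H" and F: "F = closure K \<inter> {x. a h \<bullet> x = b h}" for F h
  proof -
    have pos: "norm (a h) > 0" using ab h by simp
    have fF: "F facet_of closure K"
      using fac h F by (auto simp: facets_def)
    have sub: "F \<subseteq> {x. (a h /\<^sub>R norm (a h)) \<bullet> x = b h / norm (a h)}"
      using F by (auto simp: divide_inverse mult.commute)
    have lt: "(a h /\<^sub>R norm (a h)) \<bullet> x < b h / norm (a h)" if "x \<in> K" for x
      using that int h pos by (auto simp: field_simps)
    have nm: "norm (a h /\<^sub>R norm (a h)) = 1"
      using pos by simp
    show 1: "nrm F = a h /\<^sub>R norm (a h)"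
      unfolding nrm_def by (rule outer_normal_unique(1)[OF fF sub nm lt])
    have "(SOME y. y \<in> F) \<in> F"
      using fF by (simp add: facet_of_def some_in_eq)
    then show 2: "lvl F = b h / norm (a h)"
      using sub by (auto simp: lvl_def 1)
    show "affine hull F = {x. nrm F \<bullet> x = lvl F}"
      unfolding 1 2 by (rule outer_normal_unique(2)[OF fF sub nm lt])
  qed
  have hyp: "nrm F \<bullet> x < lvl F \<longleftrightarrow> a h \<bullet> x < b h" "nrm F \<bullet> x \<le> lvl F \<longleftrightarrow> a h \<bullet> x \<le> b h"
      "nrm F \<bullet> x = lvl F \<longleftrightarrow> a h \<bullet> x = b h"
    if h: "h \<in> H" and F: "F = closure K \<inter> {x. a h \<bullet> x = b h}" for F h x
  proof -
    have "norm (a h) > 0" using ab h by simp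
    then show "nrm F \<bullet> x < lvl F \<longleftrightarrow> a h \<bullet> x < b h" "nrm F \<bullet> x \<le> lvl F \<longleftrightarrow> a h \<bullet> x \<le> b h"
      "nrm F \<bullet> x = lvl F \<longleftrightarrow> a h \<bullet> x = b h"
      using key[OF h F] by (auto simp: field_simps)
  qed
  show "norm (nrm F) = 1" "F = closure K \<inter> {x. nrm F \<bullet> x = lvl F}"
      "affine hull F = {x. nrm F \<bullet> x = lvl F}" if FF: "F \<in> facets" for F
  proof -
    obtain h where h: "h \<in> H" "F = closure K \<inter> {x. a h \<bullet> x = b h}"
      using iffD1[OF fac FF] by blast
    show "norm (nrm F) = 1" 
      using key(1)[OF h] ab[OF h(1)] by simp
    show "F = closure K \<inter> {x. nrm F \<bullet> x = lvl F}"
      using hyp(3)[OF h] h(2) by auto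
    show "affine hull F = {x. nrm F \<bullet> x = lvl F}"
      by (rule key(3)[OF h])
  qed
  have cl: "x \<in> closure K \<longleftrightarrow> (\<forall>h\<in>H. a h \<bullet> x \<le> b h)" for x
  proof -
    have "x \<in> closure K \<longleftrightarrow> (\<forall>h\<in>H. x \<in> h)"
      using H(2) unfolding affine_hull_closure by blast
    moreover have "x \<in> h \<longleftrightarrow> a h \<bullet> x \<le> b h" if "h \<in> H" for h
      using ab[OF that] by blast
    ultimately show ?thesis by blast
  qed
  have img: "facets = (\<lambda>h. closure K \<inter> {x. a h \<bullet> x = b h}) ` H"
    using fac by blast
  show "closure K = {x. \<forall>F\<in>facets. nrm F \<bullet> x \<le> lvl F}"
    by (rule set_eqI) (simp add: img cl hyp(2)[OF _ refl] cong: ball_cong)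
  show "K = {x. \<forall>F\<in>facets. nrm F \<bullet> x < lvl F}"
  proof (rule set_eqI)
    fix x
    have "x \<in> K \<longleftrightarrow> (\<forall>h\<in>H. a h \<bullet> x < b h)"
      using cl[of x] by (subst int) (auto intro: less_imp_le)
    then show "x \<in> K \<longleftrightarrow> x \<in> {x. \<forall>F\<in>facets. nrm F \<bullet> x < lvl F}"
      by (simp add: img hyp(1)[OF _ refl] cong: ball_cong)
  qed
qed

text \<open>Each facet lies in the half-space of the other one, so equal normals force equal
  levels.\<close>

lemma nrm_inject:
  assumes "F \<in> facets" "G \<in> facets" "nrm F = nrm G"
  shows "F = G"
proof -
  obtain y z where yz: "y \<in> F" "z \<in> G"
    using assms(1,2) by (auto simp: facets_def facet_of_def)
  have 1: "nrm F \<bullet> y = lvl F" "y \<in> closure K" "nrm G \<bullet> z = lvl G" "z \<in> closure K"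
    using yz facet_eq[OF assms(1)] facet_eq[OF assms(2)] by blast+
  then have "nrm G \<bullet> y \<le> lvl G" "nrm F \<bullet> z \<le> lvl F"
    using assms(1,2) unfolding closure_eq by blast+
  with 1 have "lvl F = lvl G"
    using assms(3) by simp
  then show ?thesis
    using assms facet_eq by metis
qed

lemma closest_point_facet:
  assumes "F \<in> facets"
  shows "closest_point (affine hull F) z = z - (nrm F \<bullet> z - lvl F) *\<^sub>R nrm F"
  by (simp add: affine_hull_facet[OF assms] closest_point_hyperplane norm_nrm[OF assms])

text \<open>The prism is a fixed parameter domain for the facet: surface integrals become volume
  integrals of functions of the foot point \<open>proj F z\<close>.\<close>

definition prism :: "(real^'d) set \<Rightarrow> (real^'d) set" where
  "prism F = {y + t *\<^sub>R nrm F | y t. y \<in> F \<and> 0 \<le> t \<and> t \<le> 1}"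

abbreviation proj :: "(real^'d) set \<Rightarrow> real^'d \<Rightarrow> real^'d" where
  "proj F z \<equiv> z - (nrm F \<bullet> z - lvl F) *\<^sub>R nrm F"

text \<open>A point of the prism is given by its foot in the facet and its height
  \<open>nrm F \<bullet> z - lvl F\<close> above it.\<close>

lemma prism_iff:
  assumes "F \<in> facets"
  shows "z \<in> prism F \<longleftrightarrow> proj F z \<in> F \<and> 0 \<le> nrm F \<bullet> z - lvl F \<and> nrm F \<bullet> z - lvl F \<le> 1"
proof
  have nn: "nrm F \<bullet> nrm F = 1"
    using norm_nrm[OF assms] by (simp add: norm_eq_1)
  assume "z \<in> prism F"
  then obtain y t where z: "z = y + t *\<^sub>R nrm F" "y \<in> F" "0 \<le> t" "t \<le> 1"
    by (auto simp: prism_def)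
  moreover have "nrm F \<bullet> y = lvl F"
    using facet_eq[OF assms] z(2) by auto
  ultimately show "proj F z \<in> F \<and> 0 \<le> nrm F \<bullet> z - lvl F \<and> nrm F \<bullet> z - lvl F \<le> 1"
    by (simp add: inner_simps nn)
next
  assume "proj F z \<in> F \<and> 0 \<le> nrm F \<bullet> z - lvl F \<and> nrm F \<bullet> z - lvl F \<le> 1"
  then show "z \<in> prism F"
    unfolding prism_def by (intro CollectI exI[of _ "proj F z"] exI[of _ "nrm F \<bullet> z - lvl F"]) simp
qed

lemma compact_facet: "F \<in> facets \<Longrightarrow> compact F"
  by (subst facet_eq) (auto intro!: compact_Int_closed closed_hyperplane simp: compact_closure bounded_K)

lemma compact_prism: "F \<in> facets \<Longrightarrow> compact (prism F)"
proof -
  assume F: "F \<in> facets"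
  have "prism F = (\<lambda>(y, t). y + t *\<^sub>R nrm F) ` (F \<times> {0..1})"
    by (force simp: prism_def)
  then show ?thesis
    using compact_facet[OF F]
    by (auto intro!: compact_continuous_image compact_Times continuous_intros simp: case_prod_unfold)
qed

lemma facet_integral_eq:
  assumes F: "F \<in> facets" and [measurable]: "(\<lambda>z. f (proj F z)) \<in> borel_measurable borel"
  shows "facet_integral (outer_normal K F) F f = (LINT z|lborel. indicator (prism F) z * f (proj F z))"
proof -
  have [measurable]: "prism F \<in> sets borel"
    using compact_prism[OF F] by (simp add: borel_compact)
  have "facet_integral (outer_normal K F) F f = (LINT z|lebesgue_on (prism F). f (proj F z))"
    unfolding facet_integral_def closest_point_facet[OF F] by (simp add: prism_def nrm_def)
  also have "\<dots> = (LINT z|lebesgue. indicator (prism F) z * f (proj F z))"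
    by (subst integral_restrict_space) auto
  also have "\<dots> = (LINT z|lborel. indicator (prism F) z * f (proj F z))"
    by (rule integral_completion) measurable
  finally show ?thesis .
qed

end

section \<open>Integrals over thin boundary layers\<close>

lemma AE_lborel_not_in_negligible:
  assumes "negligible N" "N \<in> sets borel"
  shows "AE x in lborel. x \<notin> N"
proof (rule AE_not_in)
  have "N \<in> null_sets lebesgue"
    using assms(1) unfolding negligible_iff_null_sets .
  then show "N \<in> null_sets lborel"
    by (subst (asm) null_sets_completion_iff) (use assms(2) in simp_all)
qed

lemma AE_lborel_not_in_hyperplane:
  fixes a :: "'a::euclidean_space"
  assumes "a \<noteq> 0"
  shows "AE x in lborel. a \<bullet> x \<noteq> b"
proof -
  have "AE x in lborel. x \<notin> {x. a \<bullet> x = b}"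
    using assms by (intro AE_lborel_not_in_negligible negligible_hyperplane borel_closed closed_hyperplane) simp
  then show ?thesis by simp
qed

lemma integrable_lborel_bounded:
  fixes f :: "'a::euclidean_space \<Rightarrow> real"
  assumes [measurable]: "f \<in> borel_measurable borel" and "\<And>x. \<bar>f x\<bar> \<le> M"
    and "bounded B" and "\<And>x. x \<notin> B \<Longrightarrow> f x = 0"
  shows "integrable lborel f"
proof -
  obtain r where r: "B \<subseteq> cball 0 r"
    using assms(3) by (auto simp: bounded_iff subset_iff)
  have "integrable lborel (\<lambda>x. indicator (cball (0::'a) r) x *\<^sub>R M)"
    using emeasure_bounded_finite[of "cball (0::'a) r"]
    by (intro integrable_scaleR_left integrable_real_indicator) simp_all
  then show ?thesis
  proof (rule Bochner_Integration.integrable_bound)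
    show "AE x in lborel. norm (f x) \<le> norm (indicator (cball (0::'a) r) x *\<^sub>R M)"
    proof (rule AE_I2)
      fix x
      show "norm (f x) \<le> norm (indicator (cball (0::'a) r) x *\<^sub>R M)"
        using assms(4)[of x] order_trans[OF assms(2) abs_ge_self, of x] r
        by (cases "x \<in> B") (auto simp: indicator_def)
    qed
  qed simp
qed

text \<open>Substituting \<open>1 / t\<close> for \<open>t\<close> reduces this to dominated
  convergence at infinity. The value \<open>f\<close> for nonpositive arguments only keeps every
  member of the family measurable.\<close>

lemma dominated_convergence_at_right_0:
  fixes f :: "'a \<Rightarrow> real" and s :: "real \<Rightarrow> 'a \<Rightarrow> real"
  assumes "f \<in> borel_measurable M" "integrable M w"
    and s: "\<And>t. t > 0 \<Longrightarrow> s t \<in> borel_measurable M"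
    and lim: "AE x in M. ((\<lambda>t. s t x) \<longlongrightarrow> f x) (at_right 0)"
    and bound: "\<And>t. t > 0 \<Longrightarrow> AE x in M. \<bar>s t x\<bar> \<le> w x"
  shows "((\<lambda>t. integral\<^sup>L M (s t)) \<longlongrightarrow> integral\<^sup>L M f) (at_right 0)"
proof -
  define s' where "s' = (\<lambda>t. if t > 0 then s (inverse t) else f)"
  have ev: "\<forall>\<^sub>F t in at_top. s' t = s (inverse t)"
    using eventually_gt_at_top[of 0] by eventually_elim (simp add: s'_def)
  have "((\<lambda>t. integral\<^sup>L M (s' t)) \<longlongrightarrow> integral\<^sup>L M f) at_top"
  proof (rule integral_dominated_convergence_at_top)
    show "s' t \<in> borel_measurable M" for t
      using s assms(1) by (simp add: s'_def)
    show "AE x in M. ((\<lambda>t. s' t x) \<longlongrightarrow> f x) at_top"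
      using lim
    proof eventually_elim
      case (elim x)
      then have "((\<lambda>t. s (inverse t) x) \<longlongrightarrow> f x) at_top"
        by (simp add: filterlim_at_right_to_top)
      then show ?case
        by (rule Lim_transform_eventually) (use ev in eventually_elim, simp)
    qed
    show "\<forall>\<^sub>F t in at_top. AE x in M. norm (s' t x) \<le> w x"
      using eventually_gt_at_top[of 0]
    proof eventually_elim
      case (elim t)
      then show ?case using bound[of "inverse t"] by (simp add: s'_def)
    qed
  qed (use assms in auto)
  then have "((\<lambda>t. integral\<^sup>L M (s (inverse t))) \<longlongrightarrow> integral\<^sup>L M f) at_top"
    by (rule Lim_transform_eventually) (use ev in eventually_elim, simp)
  then show ?thesis
    by (simp add: filterlim_at_right_to_top)
qed

lemma integral_lborel_translate:
  fixes f :: "'a::euclidean_space \<Rightarrow> real"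
  assumes [measurable]: "f \<in> borel_measurable borel"
  shows "(LINT x|lborel. f (x + c)) = integral\<^sup>L lborel f"
proof -
  have "integral\<^sup>L (distr lborel borel ((+) c)) f = (LINT x|lborel. f (c + x))"
    by (rule integral_distr) auto
  then show ?thesis
    by (simp add: lborel_distr_plus add.commute)
qed

context open_polytope
begin

text \<open>The time at which the line through \<open>x\<close> with velocity \<omega> meets the
  hyperplane of \<open>F\<close>, for \<omega> transverse to it.\<close>

definition exit_time :: "(real^'d) set \<Rightarrow> real^'d \<Rightarrow> real^'d \<Rightarrow> real" where
  "exit_time F \<omega> x = (lvl F - nrm F \<bullet> x) / (nrm F \<bullet> \<omega>)"

definition outflow :: "real^'d \<Rightarrow> (real^'d) set set" where
  "outflow \<omega> = {F \<in> facets. 0 < nrm F \<bullet> \<omega>}"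

text \<open>The region swept by the facet when it moves backwards along \<omega> for time
  \<open>t\<close>, that is, the points that reach \<open>F\<close> within this time.\<close>

definition layer :: "(real^'d) set \<Rightarrow> real^'d \<Rightarrow> real \<Rightarrow> (real^'d) set" where
  "layer F \<omega> t = {x. x + exit_time F \<omega> x *\<^sub>R \<omega> \<in> F \<and> 0 \<le> exit_time F \<omega> x \<and> exit_time F \<omega> x \<le> t}"

text \<open>Parametrises the layer by the prism: the height over the facet, between 0 and 1, becomes
  the fraction of \<open>t\<close> after which the point reaches \<open>F\<close>.\<close>

definition slide :: "(real^'d) set \<Rightarrow> real^'d \<Rightarrow> real \<Rightarrow> real^'d \<Rightarrow> real^'d" where
  "slide F \<omega> t z = proj F z - (t * (nrm F \<bullet> z - lvl F)) *\<^sub>R \<omega>"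

lemma finite_outflow: "finite (outflow \<omega>)"
  using finite_facets by (simp add: outflow_def)

lemma closed_layer: "F \<in> facets \<Longrightarrow> closed (layer F \<omega> t)"
proof -
  assume F: "F \<in> facets"
  have cont: "continuous_on UNIV (exit_time F \<omega>)"
    unfolding exit_time_def by (auto intro!: continuous_intros simp: divide_inverse)
  then have "closed ((\<lambda>x. x + exit_time F \<omega> x *\<^sub>R \<omega>) -` F)"
    by (intro closed_vimage compact_imp_closed compact_facet[OF F] continuous_intros)
  moreover have "layer F \<omega> t = (\<lambda>x. x + exit_time F \<omega> x *\<^sub>R \<omega>) -` F
      \<inter> {x. 0 \<le> exit_time F \<omega> x} \<inter> {x. exit_time F \<omega> x \<le> t}"
    by (auto simp: layer_def)
  ultimately show ?thesis
    using cont by (auto intro!: closed_Int closed_Collect_le continuous_intros)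
qed

text \<open>The cell is an intersection of open half-spaces, so a point leaves it at the smallest
  exit time over the outflow facets. The inequalities of the other facets are never approached along
  \<omega>.\<close>

lemma exits_iff_in_layer:
  assumes x: "x \<in> K" and t: "t > 0"
  shows "x + t *\<^sub>R \<omega> \<notin> K \<longleftrightarrow> (\<exists>F\<in>outflow \<omega>. x \<in> layer F \<omega> t)"
proof
  assume "x + t *\<^sub>R \<omega> \<notin> K"
  then obtain G where G: "G \<in> facets" "nrm G \<bullet> (x + t *\<^sub>R \<omega>) \<ge> lvl G"
    by (subst (asm) (2) K_eq) (auto simp: not_less)
  have lt: "nrm F \<bullet> x < lvl F" if "F \<in> facets" for F
    using x K_eq that by blast
  have "t * (nrm G \<bullet> \<omega>) > 0"
    using lt[OF G(1)] G(2) by (simp add: inner_simps)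
  then have G': "G \<in> outflow \<omega>" "exit_time G \<omega> x \<le> t"
    using t G by (auto simp: outflow_def exit_time_def zero_less_mult_iff field_simps inner_simps)
  \<comment> \<open>The facet that is reached first: at its exit time no other inequality has been
    violated, so the exit point lies in \<open>F\<close> itself and not just in its
    hyperplane.\<close>
  define F where "F = arg_min_on (\<lambda>F. exit_time F \<omega> x) (outflow \<omega>)"
  have F: "F \<in> outflow \<omega>" and min: "\<And>H. H \<in> outflow \<omega> \<Longrightarrow> exit_time F \<omega> x \<le> exit_time H \<omega> x"
    using arg_min_if_finite(1)[OF finite_outflow, of \<omega> "\<lambda>F. exit_time F \<omega> x"]
      arg_min_least[OF finite_outflow, of \<omega> _ "\<lambda>F. exit_time F \<omega> x"] G'(1) by (auto simp: F_def)
  define s where "s = exit_time F \<omega> x"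
  have Ff: "F \<in> facets" and pos: "nrm F \<bullet> \<omega> > 0"
    using F by (auto simp: outflow_def)
  have s0: "s \<ge> 0"
    using lt[OF Ff] pos by (simp add: s_def exit_time_def)
  have on: "nrm F \<bullet> (x + s *\<^sub>R \<omega>) = lvl F"
    using pos by (simp add: s_def exit_time_def inner_simps)
  have "nrm H \<bullet> (x + s *\<^sub>R \<omega>) \<le> lvl H" if H: "H \<in> facets" for H
  proof (cases "nrm H \<bullet> \<omega> > 0")
    case True
    then have "s \<le> exit_time H \<omega> x"
      using min H by (simp add: s_def outflow_def)
    then show ?thesis
      using True by (simp add: exit_time_def inner_simps field_simps)
  next
    case False
    then have "s * (nrm H \<bullet> \<omega>) \<le> 0"
      using s0 by (simp add: mult_nonneg_nonpos)
    then show ?thesis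
      using lt[OF H] by (simp add: inner_simps)
  qed
  then have "x + s *\<^sub>R \<omega> \<in> F"
    using on by (subst facet_eq[OF Ff], subst closure_eq) auto
  moreover have "s \<le> t"
    using min[OF G'(1)] G'(2) by (simp add: s_def)
  ultimately have "x \<in> layer F \<omega> t"
    using s0 by (simp add: layer_def s_def)
  then show "\<exists>F\<in>outflow \<omega>. x \<in> layer F \<omega> t"
    using F by blast
next
  assume "\<exists>F\<in>outflow \<omega>. x \<in> layer F \<omega> t"
  then obtain F where F: "F \<in> facets" "nrm F \<bullet> \<omega> > 0" "exit_time F \<omega> x \<le> t"
    by (auto simp: outflow_def layer_def)
  then have "nrm F \<bullet> (x + t *\<^sub>R \<omega>) \<ge> lvl F"
    by (simp add: exit_time_def inner_simps field_simps)
  then show "x + t *\<^sub>R \<omega> \<notin> K"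
    by (subst K_eq) (use F in \<open>auto simp: not_less intro!: bexI[of _ F]\<close>)
qed

text \<open>The exit point through \<open>G\<close> belongs to the closed cell, so the hyperplane of
  \<open>F\<close> has not been passed before that time. By symmetry the exit times agree wherever
  two layers overlap.\<close>

lemma layer_overlap_exit_time_le:
  assumes "F \<in> outflow \<omega>" "G \<in> outflow \<omega>" "x \<in> layer G \<omega> t"
  shows "exit_time G \<omega> x \<le> exit_time F \<omega> x"
proof -
  have "x + exit_time G \<omega> x *\<^sub>R \<omega> \<in> closure K"
    using assms facet_eq[of G] by (auto simp: layer_def outflow_def)
  then have "nrm F \<bullet> (x + exit_time G \<omega> x *\<^sub>R \<omega>) \<le> lvl F"
    using closure_eq assms(1) by (auto simp: outflow_def)
  then show ?thesis
    using assms(1) by (simp add: exit_time_def[of F] outflow_def inner_simps field_simps)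
qed

text \<open>Equality of exit times is one affine equation in \<open>x\<close>. Its coefficient
  vector vanishes only if the two unit normals coincide, which distinct facets exclude.\<close>

lemma negligible_equal_exit_time:
  assumes "F \<in> outflow \<omega>" "G \<in> outflow \<omega>" "F \<noteq> G"
  shows "AE x in lborel. exit_time F \<omega> x \<noteq> exit_time G \<omega> x"
proof -
  let ?a = "(nrm F \<bullet> \<omega>) *\<^sub>R nrm G - (nrm G \<bullet> \<omega>) *\<^sub>R nrm F"
  have pos: "nrm F \<bullet> \<omega> > 0" "nrm G \<bullet> \<omega> > 0" and fac: "F \<in> facets" "G \<in> facets"
    using assms by (auto simp: outflow_def)
  have "?a \<noteq> 0"
  proof
    assume "?a = 0"
    then have eq: "(nrm F \<bullet> \<omega>) *\<^sub>R nrm G = (nrm G \<bullet> \<omega>) *\<^sub>R nrm F"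
      by simp
    then have "norm ((nrm F \<bullet> \<omega>) *\<^sub>R nrm G) = norm ((nrm G \<bullet> \<omega>) *\<^sub>R nrm F)"
      by simp
    then have same: "nrm F \<bullet> \<omega> = nrm G \<bullet> \<omega>"
      using pos by (simp add: norm_nrm fac)
    have "nrm G = nrm F"
      using eq pos(2) unfolding same scaleR_cancel_left by linarith
    then show False
      using nrm_inject fac assms(3) by blast
  qed
  then have "AE x in lborel. ?a \<bullet> x \<noteq> (nrm F \<bullet> \<omega>) * lvl G - (nrm G \<bullet> \<omega>) * lvl F"
    by (rule AE_lborel_not_in_hyperplane)
  then show ?thesis
    by eventually_elim (use pos in \<open>auto simp: exit_time_def inner_simps field_simps\<close>)
qed

text \<open>Up to a translation, \<open>slide\<close> is the rank-one update with the vector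
  \<open>- (nrm F + t *\<^sub>R \<omega>)\<close>. As \<open>nrm F\<close> is a unit vector, the
  determinant reduces to \<open>- (t * (nrm F \<bullet> \<omega>))\<close>.\<close>

lemma integral_slide:
  assumes F: "F \<in> outflow \<omega>" and t: "t > 0" and [measurable]: "f \<in> borel_measurable borel"
  shows "integral\<^sup>L lborel f = t * (nrm F \<bullet> \<omega>) * (LINT z|lborel. f (slide F \<omega> t z))"
proof -
  let ?a = "- (nrm F + t *\<^sub>R \<omega>)"
  have nn: "nrm F \<bullet> nrm F = 1"
    using F norm_nrm by (simp add: outflow_def norm_eq_1)
  have pos: "nrm F \<bullet> \<omega> > 0"
    using F by (simp add: outflow_def)
  have 1: "1 + nrm F \<bullet> ?a = - (t * (nrm F \<bullet> \<omega>))"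
    by (simp add: inner_simps nn)
  have "integral\<^sup>L lborel f = (LINT x|lborel. f (x + (- lvl F) *\<^sub>R ?a))"
    by (rule integral_lborel_translate[symmetric]) simp
  also have "\<dots> = \<bar>1 + nrm F \<bullet> ?a\<bar> * (LINT z|lborel. f (z + (nrm F \<bullet> z) *\<^sub>R ?a + (- lvl F) *\<^sub>R ?a))"
    by (rule integral_rank_one_update) (use 1 t pos in auto)
  also have "(\<lambda>z. z + (nrm F \<bullet> z) *\<^sub>R ?a + (- lvl F) *\<^sub>R ?a) = slide F \<omega> t"
    by (auto simp: slide_def algebra_simps)
  finally show ?thesis
    unfolding 1 using t pos by (simp add: slide_def)
qed

lemma slide_in_layer_iff:
  assumes F: "F \<in> outflow \<omega>" and t: "t > 0"
  shows "slide F \<omega> t z \<in> layer F \<omega> t \<longleftrightarrow> z \<in> prism F"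
proof -
  have nn: "nrm F \<bullet> nrm F = 1"
    using F norm_nrm by (simp add: outflow_def norm_eq_1)
  have pos: "nrm F \<bullet> \<omega> > 0" and fac: "F \<in> facets"
    using F by (auto simp: outflow_def)
  have "exit_time F \<omega> (slide F \<omega> t z) = t * (nrm F \<bullet> z - lvl F)"
    using pos by (simp add: exit_time_def slide_def inner_simps nn)
  then show ?thesis
    unfolding prism_iff[OF fac] layer_def using t
    by (simp add: slide_def zero_le_mult_iff mult_le_cancel_left1)
qed

lemma borel_measurable_slide [measurable]: "slide F \<omega> t \<in> borel_measurable borel"
  unfolding slide_def by measurable

text \<open>The leaving points are the part of the layers inside the cell. Layers overlap only where
  exit times are equal, a null set, so the integral splits into a sum over the outflow facets, each
  of which is pulled back to its prism.\<close>

lemma exit_layer_integral: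
  assumes t: "t > 0" and [measurable]: "G \<in> borel_measurable borel" and M: "\<And>x. \<bar>G x\<bar> \<le> M"
  shows "(LINT x|lborel. indicator {x \<in> K. x + t *\<^sub>R \<omega> \<notin> K} x * G x)
    = (\<Sum>F\<in>outflow \<omega>. t * (nrm F \<bullet> \<omega>) *
        (LINT z|lborel. indicator (prism F) z * (indicator K (slide F \<omega> t z) * G (slide F \<omega> t z))))"
proof -
  have [measurable]: "K \<in> sets borel"
    using open_K by simp
  have [measurable]: "layer F \<omega> t \<in> sets borel" if "F \<in> outflow \<omega>" for F
    using closed_layer that by (auto simp: outflow_def)
  have "AE x in lborel. \<forall>F\<in>outflow \<omega>. \<forall>H\<in>outflow \<omega>. F \<noteq> H \<longrightarrow> exit_time F \<omega> x \<noteq> exit_time H \<omega> x"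
    by (intro AE_finite_allI finite_outflow AE_impI negligible_equal_exit_time)
  then have "AE x in lborel. indicator {x \<in> K. x + t *\<^sub>R \<omega> \<notin> K} x * G x
      = (\<Sum>F\<in>outflow \<omega>. indicator (layer F \<omega> t) x * (indicator K x * G x))"
  proof eventually_elim
    case (elim x)
    show ?case
    proof (cases "x \<in> K \<and> x + t *\<^sub>R \<omega> \<notin> K")
      case True
      then obtain F where F: "F \<in> outflow \<omega>" "x \<in> layer F \<omega> t"
        using exits_iff_in_layer t by blast
      have "x \<notin> layer H \<omega> t" if H: "H \<in> outflow \<omega> - {F}" for H
      proof
        assume "x \<in> layer H \<omega> t"
        then have "exit_time H \<omega> x = exit_time F \<omega> x"
          using layer_overlap_exit_time_le[of F \<omega> H] layer_overlap_exit_time_le[of H \<omega> F] F H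
          by (meson DiffD1 antisym)
        then show False
          using elim F(1) H by blast
      qed
      then have "(\<Sum>H\<in>outflow \<omega>. indicator (layer H \<omega> t) x * (indicator K x * G x))
          = indicator (layer F \<omega> t) x * (indicator K x * G x)"
        by (subst sum.remove[OF finite_outflow F(1)]) simp
      then show ?thesis
        using True F by simp
    next
      case False
      then have "indicator (layer F \<omega> t) x * (indicator K x * G x) = 0" if "F \<in> outflow \<omega>" for F
        using exits_iff_in_layer[OF _ t, of x \<omega>] that by (auto simp: indicator_def)
      then have "(\<Sum>F\<in>outflow \<omega>. indicator (layer F \<omega> t) x * (indicator K x * G x)) = 0"
        by (intro sum.neutral ballI)
      then show ?thesis
        using False by (auto simp: indicator_def)
    qed
  qed
  then have "(LINT x|lborel. indicator {x \<in> K. x + t *\<^sub>R \<omega> \<notin> K} x * G x)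
      = (LINT x|lborel. (\<Sum>F\<in>outflow \<omega>. indicator (layer F \<omega> t) x * (indicator K x * G x)))"
    by (intro integral_cong_AE) measurable
  also have "\<dots> = (\<Sum>F\<in>outflow \<omega>. LINT x|lborel. indicator (layer F \<omega> t) x * (indicator K x * G x))"
  proof (intro Bochner_Integration.integral_sum integrable_lborel_bounded)
    have "0 \<le> M" using order_trans[OF abs_ge_zero M] by blast
    then show "\<bar>indicator (layer F \<omega> t) x * (indicator K x * G x)\<bar> \<le> M" for F x
      using M by (simp add: indicator_def)
  qed (use bounded_K in auto)
  also have "\<dots> = (\<Sum>F\<in>outflow \<omega>. t * (nrm F \<bullet> \<omega>) *
        (LINT z|lborel. indicator (prism F) z * (indicator K (slide F \<omega> t z) * G (slide F \<omega> t z))))"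
  proof (rule sum.cong[OF refl])
    fix F assume F: "F \<in> outflow \<omega>"
    have "(LINT x|lborel. indicator (layer F \<omega> t) x * (indicator K x * G x))
      = t * (nrm F \<bullet> \<omega>) * (LINT z|lborel. indicator (layer F \<omega> t) (slide F \<omega> t z) *
          (indicator K (slide F \<omega> t z) * G (slide F \<omega> t z)))"
      using F by (intro integral_slide t) measurable
    also have "(\<lambda>z. indicator (layer F \<omega> t) (slide F \<omega> t z) :: real) = indicator (prism F)"
      using slide_in_layer_iff[OF F t] by (auto simp: indicator_def fun_eq_iff)
    finally show "(LINT x|lborel. indicator (layer F \<omega> t) x * (indicator K x * G x))
      = t * (nrm F \<bullet> \<omega>) * (LINT z|lborel. indicator (prism F) z *
          (indicator K (slide F \<omega> t z) * G (slide F \<omega> t z)))"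
      by (simp add: fun_eq_iff)
  qed
  finally show ?thesis .
qed

text \<open>The feet on the hyperplane of \<open>G\<close> come from a single hyperplane of points
  \<open>z\<close>, unless \<open>m = 0\<close>. In that case the normals are opposite, and the
  hyperplane of \<open>G\<close> is parallel to that of \<open>F\<close> and never met.\<close>

lemma AE_proj_not_in_other_facet:
  assumes F: "F \<in> facets" and G: "G \<in> facets" "G \<noteq> F"
  shows "AE z in lborel. nrm G \<bullet> proj F z \<noteq> lvl G"
proof -
  define m where "m = nrm G - (nrm G \<bullet> nrm F) *\<^sub>R nrm F"
  have eq: "nrm G \<bullet> proj F z = m \<bullet> z + lvl F * (nrm G \<bullet> nrm F)" for z
    by (simp add: m_def algebra_simps inner_simps inner_commute)
  show ?thesis
  proof (cases "m = 0")
    case True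
    define l where "l = nrm G \<bullet> nrm F"
    have Gl: "nrm G = l *\<^sub>R nrm F"
      using True by (simp add: m_def l_def)
    then have "\<bar>l\<bar> = 1"
      using norm_nrm[OF F] norm_nrm[OF G(1)] by simp
    moreover have "l \<noteq> 1"
      using Gl nrm_inject[OF G(1) F] G(2) by auto
    ultimately have l: "l = -1" by auto
    obtain x where "x \<in> K" using nonempty by blast
    then have "nrm F \<bullet> x < lvl F" "nrm G \<bullet> x < lvl G"
      using F G K_eq by auto
    then have "lvl F * l \<noteq> lvl G"
      using Gl l by simp
    then show ?thesis
      unfolding eq using True by (simp add: l_def)
  next
    case False
    then have "AE z in lborel. m \<bullet> z \<noteq> lvl G - lvl F * (nrm G \<bullet> nrm F)"
      by (rule AE_lborel_not_in_hyperplane)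
    then show ?thesis
      unfolding eq by eventually_elim auto
  qed
qed

text \<open>The foot satisfies all other inequalities strictly and keeps them under a small motion.
  The inequality of \<open>F\<close> becomes strict because the motion goes back against \<omega>,
  by a positive amount as the height is positive.\<close>

lemma eventually_slide_in_K:
  assumes F: "F \<in> outflow \<omega>" and z: "z \<in> prism F" "nrm F \<bullet> z - lvl F > 0"
    and other: "\<And>G. G \<in> facets \<Longrightarrow> G \<noteq> F \<Longrightarrow> nrm G \<bullet> proj F z \<noteq> lvl G"
  shows "\<forall>\<^sub>F t in at_right 0. slide F \<omega> t z \<in> K"
proof -
  have pos: "nrm F \<bullet> \<omega> > 0" and fac: "F \<in> facets"
    using F by (auto simp: outflow_def)
  have nn: "nrm F \<bullet> nrm F = 1"
    using fac norm_nrm by (simp add: norm_eq_1)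
  have y: "proj F z \<in> F"
    using z prism_iff[OF fac] by blast
  have "\<forall>\<^sub>F t in at_right 0. nrm G \<bullet> slide F \<omega> t z < lvl G" if G: "G \<in> facets" for G
  proof (cases "G = F")
    case True
    show ?thesis
      using eventually_at_right_less
    proof eventually_elim
      case (elim t)
      then have "t * (nrm F \<bullet> z - lvl F) * (nrm F \<bullet> \<omega>) > 0"
        using z pos by simp
      then show ?case
        unfolding True by (simp add: slide_def inner_simps nn)
    qed
  next
    case False
    have "nrm G \<bullet> proj F z \<le> lvl G"
      using y facet_eq[OF fac] closure_eq G by blast
    with other[OF G False] have lt: "nrm G \<bullet> proj F z < lvl G" by simp
    have "((\<lambda>t. nrm G \<bullet> slide F \<omega> t z) \<longlongrightarrow> nrm G \<bullet> (proj F z - (0 * (nrm F \<bullet> z - lvl F)) *\<^sub>R \<omega>)) (at_right 0)"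
      unfolding slide_def by (intro tendsto_intros)
    then show ?thesis
      using lt by (intro order_tendstoD) auto
  qed
  then have "\<forall>\<^sub>F t in at_right 0. \<forall>G\<in>facets. nrm G \<bullet> slide F \<omega> t z < lvl G"
    using finite_facets by (intro eventually_ball_finite) auto
  then show ?thesis
    by eventually_elim (subst K_eq, simp)
qed

text \<open>The Jacobian of \<open>slide\<close> cancels the factor \<open>1 / t\<close>, and
  dominated convergence applies on the fixed prism. The integrand may depend on \<open>t\<close>, as
  required for points that enter a cell. Limits are demanded only for heights strictly between 0 and
  1, since both end faces of the prism are null sets.\<close>

lemma exit_layer_limit:
  assumes G: "\<And>t. t > 0 \<Longrightarrow> G t \<in> borel_measurable borel" "\<And>t x. t > 0 \<Longrightarrow> \<bar>G t x\<bar> \<le> M"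
    and g: "\<And>F. (\<lambda>z. g F (proj F z)) \<in> borel_measurable borel"
    and lim: "\<And>F z. F \<in> outflow \<omega> \<Longrightarrow> 0 < nrm F \<bullet> z - lvl F \<Longrightarrow> nrm F \<bullet> z - lvl F < 1 \<Longrightarrow> proj F z \<in> F \<Longrightarrow>
      ((\<lambda>t. G t (slide F \<omega> t z)) \<longlongrightarrow> g F (proj F z)) (at_right 0)"
  shows "((\<lambda>t. (1 / t) * (LINT x|lborel. indicator {x \<in> K. x + t *\<^sub>R \<omega> \<notin> K} x * G t x))
    \<longlongrightarrow> (\<Sum>F\<in>outflow \<omega>. (nrm F \<bullet> \<omega>) * (LINT z|lborel. indicator (prism F) z * g F (proj F z)))) (at_right 0)"
proof -
  have [measurable]: "K \<in> sets borel"
    using open_K by simp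
  have pr[measurable]: "prism F \<in> sets borel" if "F \<in> outflow \<omega>" for F
    using compact_prism that by (auto simp: borel_compact outflow_def)
  have M0: "M \<ge> 0"
    using order_trans[OF abs_ge_zero G(2)[of 1]] by simp
  have "((\<lambda>t. \<Sum>F\<in>outflow \<omega>. (nrm F \<bullet> \<omega>) *
        (LINT z|lborel. indicator (prism F) z * (indicator K (slide F \<omega> t z) * G t (slide F \<omega> t z))))
    \<longlongrightarrow> (\<Sum>F\<in>outflow \<omega>. (nrm F \<bullet> \<omega>) * (LINT z|lborel. indicator (prism F) z * g F (proj F z)))) (at_right 0)"
  proof (intro tendsto_sum tendsto_mult tendsto_const dominated_convergence_at_right_0)
    fix F assume F: "F \<in> outflow \<omega>"
    note [measurable] = G(1) g pr[OF F]
    have fac: "F \<in> facets" and pos: "nrm F \<bullet> \<omega> > 0"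
      using F by (auto simp: outflow_def)
    have n0: "nrm F \<noteq> 0"
      using norm_nrm[OF fac] by auto
    show "(\<lambda>z. indicator (prism F) z * g F (proj F z)) \<in> borel_measurable lborel"
      by measurable
    show "(\<lambda>z. indicator (prism F) z * (indicator K (slide F \<omega> t z) * G t (slide F \<omega> t z)))
      \<in> borel_measurable lborel" if "t > 0" for t
      using that by measurable
    show "integrable lborel (\<lambda>z. indicator (prism F) z * M)"
      using compact_prism[OF fac] M0
      by (intro integrable_lborel_bounded[where M = M and B = "prism F"])
        (auto simp: compact_imp_bounded indicator_def)
    show "AE z in lborel. \<bar>indicator (prism F) z * (indicator K (slide F \<omega> t z) * G t (slide F \<omega> t z))\<bar>
      \<le> indicator (prism F) z * M" if "t > 0" for t
      using G(2)[OF that] M0 by (intro AE_I2) (auto simp: indicator_def)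
    have "AE z in lborel. nrm F \<bullet> z \<noteq> lvl F" "AE z in lborel. nrm F \<bullet> z \<noteq> lvl F + 1"
      using n0 by (rule AE_lborel_not_in_hyperplane)+
    moreover have "AE z in lborel. \<forall>G\<in>facets. G \<noteq> F \<longrightarrow> nrm G \<bullet> proj F z \<noteq> lvl G"
      by (intro AE_finite_allI finite_facets AE_impI AE_proj_not_in_other_facet fac)
    ultimately show "AE z in lborel. ((\<lambda>t. indicator (prism F) z * (indicator K (slide F \<omega> t z) * G t (slide F \<omega> t z)))
      \<longlongrightarrow> indicator (prism F) z * g F (proj F z)) (at_right 0)"
    proof eventually_elim
      case (elim z)
      show ?case
      proof (cases "z \<in> prism F")
        case True
        then have h: "0 < nrm F \<bullet> z - lvl F" "nrm F \<bullet> z - lvl F < 1" "proj F z \<in> F"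
          using elim prism_iff[OF fac, of z] by auto
        have "\<forall>\<^sub>F t in at_right 0. slide F \<omega> t z \<in> K"
          by (rule eventually_slide_in_K[OF F True h(1)]) (use elim in blast)
        then have "\<forall>\<^sub>F t in at_right 0. G t (slide F \<omega> t z) =
            indicator (prism F) z * (indicator K (slide F \<omega> t z) * G t (slide F \<omega> t z))"
          by eventually_elim (use True in simp)
        with lim[OF F h] have "((\<lambda>t. indicator (prism F) z * (indicator K (slide F \<omega> t z) * G t (slide F \<omega> t z)))
            \<longlongrightarrow> g F (proj F z)) (at_right 0)"
          by (rule Lim_transform_eventually)
        then show ?thesis
          using True by simp
      qed simp
    qed
  qed
  moreover have "\<forall>\<^sub>F t in at_right 0. (\<Sum>F\<in>outflow \<omega>. (nrm F \<bullet> \<omega>) *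
        (LINT z|lborel. indicator (prism F) z * (indicator K (slide F \<omega> t z) * G t (slide F \<omega> t z))))
      = (1 / t) * (LINT x|lborel. indicator {x \<in> K. x + t *\<^sub>R \<omega> \<notin> K} x * G t x)"
    using eventually_at_right_less
  proof eventually_elim
    case (elim t)
    then show ?case
      by (subst exit_layer_integral[OF elim G(1)[OF elim] G(2)[OF elim]])
        (simp add: sum_distrib_left sum_divide_distrib mult.assoc)
  qed
  ultimately show ?thesis
    by (rule Lim_transform_eventually)
qed

end

section \<open>Piecewise smooth functions and the upwind transport form\<close>

definition C1_function :: "(real^'d \<Rightarrow> real) \<Rightarrow> bool" where
  "C1_function p \<longleftrightarrow> (\<exists>g. continuous_on UNIV g \<and> (\<forall>x. (p has_derivative (\<lambda>h. g x \<bullet> h)) (at x)))"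

text \<open>Unlike the finite element space, this class is closed under products, which occur in all
  energy integrals. It keeps the convention of the value 0 off the open cells.\<close>

definition piecewise_C1 :: "(real^'d) set set \<Rightarrow> (real^'d \<Rightarrow> real) set" where
  "piecewise_C1 T = {u. (\<forall>K\<in>T. \<exists>p. C1_function p \<and> (\<forall>x\<in>K. u x = p x)) \<and> (\<forall>x. x \<notin> \<Union>T \<longrightarrow> u x = 0)}"

lemma C1_function_const: "C1_function (\<lambda>x. c)"
  unfolding C1_function_def by (intro exI[of _ "\<lambda>x. 0"])
    (auto intro!: has_derivative_eq_rhs[OF has_derivative_const])

lemma C1_function_inner: "C1_function (\<lambda>x. b \<bullet> x)"
  unfolding C1_function_def by (intro exI[of _ "\<lambda>x. b"]) (auto intro!: bounded_linear_imp_has_derivative bounded_linear_inner_right)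

lemma C1_function_add:
  assumes "C1_function p" "C1_function q"
  shows "C1_function (\<lambda>x. p x + q x)"
proof -
  obtain g h where "continuous_on UNIV g" "\<And>x. (p has_derivative (\<lambda>y. g x \<bullet> y)) (at x)"
    "continuous_on UNIV h" "\<And>x. (q has_derivative (\<lambda>y. h x \<bullet> y)) (at x)"
    using assms unfolding C1_function_def by blast
  then show ?thesis
    unfolding C1_function_def
    by (intro exI[of _ "\<lambda>x. g x + h x"]) (auto intro!: continuous_intros derivative_eq_intros simp: inner_simps)
qed

lemma C1_function_mult:
  assumes "C1_function p" "C1_function q"
  shows "C1_function (\<lambda>x. p x * q x)"
proof -
  obtain g h where gh: "continuous_on UNIV g" "\<And>x. (p has_derivative (\<lambda>y. g x \<bullet> y)) (at x)"
    "continuous_on UNIV h" "\<And>x. (q has_derivative (\<lambda>y. h x \<bullet> y)) (at x)"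
    using assms unfolding C1_function_def by blast
  then have "continuous_on UNIV p" "continuous_on UNIV q"
    by (auto intro!: continuous_at_imp_continuous_on has_derivative_continuous)
  with gh show ?thesis
    unfolding C1_function_def
    by (intro exI[of _ "\<lambda>x. p x *\<^sub>R h x + q x *\<^sub>R g x"])
      (auto intro!: continuous_intros derivative_eq_intros simp: inner_simps algebra_simps)
qed

lemma C1_function_sum: "(\<And>i. i \<in> A \<Longrightarrow> C1_function (f i)) \<Longrightarrow> C1_function (\<lambda>x. \<Sum>i\<in>A. f i x)"
  by (induction A rule: infinite_finite_induct) (auto intro: C1_function_const C1_function_add)

lemma C1_function_prod: "(\<And>i. i \<in> A \<Longrightarrow> C1_function (f i)) \<Longrightarrow> C1_function (\<lambda>x. \<Prod>i\<in>A. f i x)"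
  by (induction A rule: infinite_finite_induct) (auto intro: C1_function_const C1_function_mult)

lemma Z1_C1_function:
  assumes "p \<in> Z1 mt"
  shows "C1_function p"
proof (cases mt)
  case Simplicial
  then obtain a b where "p = (\<lambda>x. a + b \<bullet> x)"
    using assms by (auto simp: Z1_def)
  then show ?thesis
    by (simp add: C1_function_add C1_function_const C1_function_inner)
next
  case Cartesian
  then obtain c :: "'a set \<Rightarrow> real" where p: "p = (\<lambda>x. \<Sum>I\<in>UNIV. c I * (\<Prod>i\<in>I. x $ i))"
    using assms by (auto simp: Z1_def)
  have "C1_function (\<lambda>x. x $ i)" for i :: 'a
    using C1_function_inner[of "axis i 1"] by (simp add: inner_axis')
  then show ?thesis
    unfolding p by (intro C1_function_sum C1_function_mult C1_function_prod C1_function_const)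
qed

lemma V_h_subset_piecewise_C1: "V_h mt T \<subseteq> piecewise_C1 T"
  unfolding V_h_def piecewise_C1_def using Z1_C1_function by blast

lemma C1_function_continuous: "C1_function p \<Longrightarrow> continuous_on UNIV p"
  unfolding C1_function_def by (meson continuous_at_imp_continuous_on has_derivative_continuous)

lemma C1_function_lipschitz:
  assumes "C1_function p" "bounded S" "convex S"
  shows "\<exists>M\<ge>0. \<forall>x\<in>S. \<forall>y\<in>S. \<bar>p x - p y\<bar> \<le> M * norm (x - y)"
proof -
  obtain g where g: "continuous_on UNIV g" "\<And>x. (p has_derivative (\<lambda>y. g x \<bullet> y)) (at x)"
    using assms unfolding C1_function_def by blast
  have "compact (g ` closure S)"
    using assms by (intro compact_continuous_image continuous_on_subset[OF g(1)]) auto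
  then obtain M where M: "M > 0" "\<And>x. x \<in> closure S \<Longrightarrow> norm (g x) \<le> M"
    using compact_imp_bounded by (force simp: bounded_pos)
  have "onorm (\<lambda>h. g x \<bullet> h) \<le> M" if "x \<in> S" for x
  proof (rule onorm_le)
    fix h
    have "\<bar>g x \<bullet> h\<bar> \<le> norm (g x) * norm h"
      by (rule Cauchy_Schwarz_ineq2)
    also have "\<dots> \<le> M * norm h"
      using M(2)[of x] that closure_subset by (intro mult_right_mono) auto
    finally show "norm (g x \<bullet> h) \<le> M * norm h" by simp
  qed
  then have "M-lipschitz_on S p"
    using M(1) assms(3) has_derivative_at_withinI[OF g(2)]
    by (intro bounded_derivative_imp_lipschitz[where f' = "\<lambda>x h. g x \<bullet> h"]) auto
  then show ?thesis
    using M(1) by (intro exI[of _ M]) (auto simp: lipschitz_on_def dist_norm)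
qed

text \<open>The parameters for which the ray lies in a convex set form an interval, so membership is
  constant near 0: if there are such parameters arbitrarily close to 0, everything between two of
  them belongs to the set.\<close>

lemma eventually_mem_convex_ray:
  fixes S :: "'a::real_normed_vector set"
  assumes "convex S"
  shows "(\<forall>\<^sub>F \<delta> in at_left 0. y + \<delta> *\<^sub>R \<omega> \<in> S) \<or> (\<forall>\<^sub>F \<delta> in at_left (0::real). y + \<delta> *\<^sub>R \<omega> \<notin> S)"
proof (rule disjCI)
  assume n: "\<not> (\<forall>\<^sub>F \<delta> in at_left (0::real). y + \<delta> *\<^sub>R \<omega> \<notin> S)"
  have ex: "\<exists>\<delta>. b < \<delta> \<and> \<delta> < 0 \<and> y + \<delta> *\<^sub>R \<omega> \<in> S" if "b < 0" for b
    using n that unfolding eventually_at_left[of "b::real" 0, OF that] by (meson not_le)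
  obtain a where a: "a < 0" "y + a *\<^sub>R \<omega> \<in> S"
    using ex[of "-1"] by auto
  have "y + \<delta> *\<^sub>R \<omega> \<in> S" if d: "a < \<delta>" "\<delta> < 0" for \<delta>
  proof -
    obtain c where c: "\<delta> < c" "c < 0" "y + c *\<^sub>R \<omega> \<in> S"
      using ex[OF d(2)] by blast
    define s where "s = (\<delta> - a) / (c - a)"
    have s: "0 \<le> s" "s \<le> 1" "\<delta> = a + s * (c - a)"
      using d c by (auto simp: s_def field_simps)
    have "(1 - s) *\<^sub>R (y + a *\<^sub>R \<omega>) + s *\<^sub>R (y + c *\<^sub>R \<omega>) \<in> S"
      using assms a(2) c(3) s by (intro convexD) auto
    also have "(1 - s) *\<^sub>R (y + a *\<^sub>R \<omega>) + s *\<^sub>R (y + c *\<^sub>R \<omega>) = y + \<delta> *\<^sub>R \<omega>"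
      unfolding s(3) by (simp add: algebra_simps)
    finally show ?thesis .
  qed
  then show "\<forall>\<^sub>F \<delta> in at_left 0. y + \<delta> *\<^sub>R \<omega> \<in> S"
    unfolding eventually_at_left[OF a(1)] using a(1) by blast
qed

text \<open>The upwind trace without the case distinction at the boundary of the domain; for
  functions that vanish off the cells both agree.\<close>

definition left_limit :: "real^'d \<Rightarrow> (real^'d \<Rightarrow> real) \<Rightarrow> real^'d \<Rightarrow> real" where
  "left_limit \<omega> u y = Lim (at_left 0) (\<lambda>\<delta>. u (y + \<delta> *\<^sub>R \<omega>))"

definition cell_form :: "(real^'d) set \<Rightarrow> real^'d \<Rightarrow> (real^'d) set \<Rightarrow> (real^'d \<Rightarrow> real) \<Rightarrow> (real^'d \<Rightarrow> real) \<Rightarrow> real"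
  where "cell_form D \<omega> K u v =
    - (LINT x|lebesgue_on K. u x * (\<omega> \<bullet> grad v x))
    + boundary_integral K (\<lambda>\<nu> x. upwind_trace D \<omega> u x * (\<omega> \<bullet> \<nu>) * interior_trace K v x)"

lemma LINT_lebesgue_on_borel:
  fixes f :: "'a::euclidean_space \<Rightarrow> real"
  assumes [measurable]: "S \<in> sets borel" "f \<in> borel_measurable borel"
  shows "(LINT x|lebesgue_on S. f x) = (LINT x|lborel. indicator S x * f x)"
proof -
  have "(LINT x|lebesgue_on S. f x) = (LINT x|lebesgue. indicator S x * f x)"
    by (subst integral_restrict_space) auto
  also have "\<dots> = (LINT x|lborel. indicator S x * f x)"
    by (rule integral_completion) measurable
  finally show ?thesis .
qed

lemma (in open_polytope) facet_integral_cong: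
  assumes "F \<in> facets" "\<And>x. x \<in> F \<Longrightarrow> f x = g x"
  shows "facet_integral (outer_normal K F) F f = facet_integral (outer_normal K F) F g"
  unfolding facet_integral_def prism_def[unfolded nrm_def, symmetric] closest_point_facet[OF assms(1)]
  by (rule Bochner_Integration.integral_cong) (use assms prism_iff[OF assms(1)] in auto)

locale polytopal_mesh =
  fixes T :: "(real^'d) set set"
  assumes finite_T: "finite T"
    and cells: "K \<in> T \<Longrightarrow> open_polytope K"
    and disjoint: "pairwise disjnt T"
begin

lemma open_cell: "K \<in> T \<Longrightarrow> open K"
  and convex_cell: "K \<in> T \<Longrightarrow> convex K"
  and bounded_cell: "K \<in> T \<Longrightarrow> bounded K"
  using cells open_polytope.open_K open_polytope.convex_K open_polytope.bounded_K by blast+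

lemma borel_cell: "K \<in> T \<Longrightarrow> K \<in> sets borel"
  by (intro borel_open open_cell)

lemma bounded_Union: "bounded (\<Union>T)"
  using finite_T bounded_cell by (intro bounded_Union) auto

lemma cell_unique: "K \<in> T \<Longrightarrow> L \<in> T \<Longrightarrow> x \<in> K \<Longrightarrow> x \<in> L \<Longrightarrow> K = L"
  using disjoint by (auto simp: pairwise_def disjnt_def)

lemma piecewise_C1_zero: "u \<in> piecewise_C1 T \<Longrightarrow> x \<notin> \<Union>T \<Longrightarrow> u x = 0"
  by (auto simp: piecewise_C1_def)

lemma sum_indicator_cells:
  assumes "K \<in> T" "x \<in> K"
  shows "(\<Sum>L\<in>T. indicator L x * f L) = (f K :: real)"
proof -
  have "(\<Sum>L\<in>T. indicator L x * f L) = indicator K x * f K + (\<Sum>L\<in>T - {K}. indicator L x * f L)"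
    by (rule sum.remove[OF finite_T assms(1)])
  also have "(\<Sum>L\<in>T - {K}. indicator L x * f L) = 0"
    using cell_unique[OF assms(1) _ assms(2)] by (intro sum.neutral) (auto simp: indicator_def)
  finally show ?thesis
    using assms by simp
qed

lemma sum_indicator_cells_zero: "x \<notin> \<Union>T \<Longrightarrow> (\<Sum>L\<in>T. indicator L x * f L) = (0 :: real)"
  by (intro sum.neutral) (auto simp: indicator_def)

lemma sum_indicator_piecewise: "u \<in> piecewise_C1 T \<Longrightarrow> (\<Sum>L\<in>T. indicator L x * u x) = u x"
  using sum_indicator_cells[of _ x "\<lambda>_. u x"] sum_indicator_cells_zero[of x "\<lambda>_. u x"] piecewise_C1_zero[of u x]
  by (cases "x \<in> \<Union>T") auto

lemma piecewise_C1_eq: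
  assumes "u \<in> piecewise_C1 T"
  obtains p where "\<And>K. K \<in> T \<Longrightarrow> C1_function (p K)" "\<And>K x. K \<in> T \<Longrightarrow> x \<in> K \<Longrightarrow> u x = p K x"
    "u = (\<lambda>x. \<Sum>K\<in>T. indicator K x * p K x)"
proof -
  obtain p where p: "\<And>K. K \<in> T \<Longrightarrow> C1_function (p K) \<and> (\<forall>x\<in>K. u x = p K x)"
    using assms unfolding piecewise_C1_def by (auto dest!: bchoice)
  have "u x = (\<Sum>K\<in>T. indicator K x * p K x)" for x
  proof (cases "x \<in> \<Union>T")
    case True
    then obtain K where "K \<in> T" "x \<in> K" by blast
    then show ?thesis
      using sum_indicator_cells[of K x "\<lambda>K. p K x"] p by simp
  next
    case False
    then show ?thesis
      using sum_indicator_cells_zero[of x "\<lambda>K. p K x"] piecewise_C1_zero[OF assms] by simp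
  qed
  then show ?thesis
    using p by (intro that[of p]) auto
qed

lemma piecewise_C1_on_cell:
  "u \<in> piecewise_C1 T \<Longrightarrow> K \<in> T \<Longrightarrow> \<exists>p. C1_function p \<and> (\<forall>x\<in>K. u x = p x)"
  by (simp add: piecewise_C1_def)

lemma piecewise_C1_combine:
  assumes u: "u \<in> piecewise_C1 T" and v: "v \<in> piecewise_C1 T" and "f 0 0 = 0"
    and f: "\<And>p q :: real^'d \<Rightarrow> real. C1_function p \<Longrightarrow> C1_function q \<Longrightarrow> C1_function (\<lambda>x. f (p x) (q x))"
  shows "(\<lambda>x. f (u x) (v x)) \<in> piecewise_C1 T"
  unfolding piecewise_C1_def
proof (intro CollectI conjI ballI allI impI)
  fix K assume K: "K \<in> T"
  obtain p q where "C1_function p" "\<forall>x\<in>K. u x = p x" "C1_function q" "\<forall>x\<in>K. v x = q x"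
    using piecewise_C1_on_cell[OF u K] piecewise_C1_on_cell[OF v K] by blast
  then show "\<exists>p. C1_function p \<and> (\<forall>x\<in>K. f (u x) (v x) = p x)"
    using f[of p q] by (intro exI[of _ "\<lambda>x. f (p x) (q x)"]) simp
qed (simp add: piecewise_C1_zero[OF u] piecewise_C1_zero[OF v] assms(3))

lemma piecewise_C1_add: "u \<in> piecewise_C1 T \<Longrightarrow> v \<in> piecewise_C1 T \<Longrightarrow> (\<lambda>x. u x + v x) \<in> piecewise_C1 T"
  by (rule piecewise_C1_combine[where f = "(+)"]) (auto intro: C1_function_add)

lemma piecewise_C1_mult: "u \<in> piecewise_C1 T \<Longrightarrow> v \<in> piecewise_C1 T \<Longrightarrow> (\<lambda>x. u x * v x) \<in> piecewise_C1 T"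
  by (rule piecewise_C1_combine[where f = "(*)"]) (auto intro: C1_function_mult)

lemma piecewise_C1_cmult: "u \<in> piecewise_C1 T \<Longrightarrow> (\<lambda>x. c * u x) \<in> piecewise_C1 T"
  by (rule piecewise_C1_combine[where f = "\<lambda>a b. c * a"]) (auto intro: C1_function_mult C1_function_const)

lemma piecewise_C1_sum:
  "(\<And>i. i \<in> A \<Longrightarrow> f i \<in> piecewise_C1 T) \<Longrightarrow> (\<lambda>x. \<Sum>i\<in>A. f i x) \<in> piecewise_C1 T"
proof (induction A rule: infinite_finite_induct)
  case (insert i A)
  then show ?case by (simp add: piecewise_C1_add)
qed (auto simp: piecewise_C1_def intro: C1_function_const)

lemma piecewise_C1_borel: "u \<in> piecewise_C1 T \<Longrightarrow> u \<in> borel_measurable borel"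
proof -
  assume "u \<in> piecewise_C1 T"
  then obtain p where p: "\<And>K. K \<in> T \<Longrightarrow> C1_function (p K)" "u = (\<lambda>x. \<Sum>K\<in>T. indicator K x * p K x)"
    by (rule piecewise_C1_eq) blast
  have "p K \<in> borel_measurable borel" if "K \<in> T" for K
    by (intro borel_measurable_continuous_onI C1_function_continuous p(1) that)
  then show ?thesis
    unfolding p(2) using borel_cell
    by (intro borel_measurable_sum borel_measurable_times borel_measurable_indicator) auto
qed

text \<open>The smooth representative on \<open>K\<close> is truncated at its bound on the closed
  cell. The result is continuous and bounded on the whole space, so it can be evaluated at projected
  and shifted points that are not in \<open>K\<close>.\<close>

lemma piecewise_C1_extension:
  assumes "u \<in> piecewise_C1 T" "K \<in> T"
  obtains p M where "continuous_on UNIV p" "\<And>x. \<bar>p x\<bar> \<le> M" "\<And>x. x \<in> K \<Longrightarrow> u x = p x" "M \<ge> 0"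
proof -
  obtain p where p: "C1_function p" "\<And>x. x \<in> K \<Longrightarrow> u x = p x"
    using piecewise_C1_on_cell[OF assms] by blast
  note cont = C1_function_continuous[OF p(1)]
  have "compact (p ` closure K)"
    using assms bounded_cell by (intro compact_continuous_image continuous_on_subset[OF cont]) auto
  then obtain M where M: "M > 0" "\<And>x. x \<in> closure K \<Longrightarrow> \<bar>p x\<bar> \<le> M"
    using compact_imp_bounded by (force simp: bounded_pos)
  show ?thesis
  proof (rule that[of "\<lambda>x. max (- M) (min M (p x))" M])
    show "continuous_on UNIV (\<lambda>x. max (- M) (min M (p x)))"
      using cont by (intro continuous_intros)
    show "u x = max (- M) (min M (p x))" if "x \<in> K" for x
    proof -
      have "\<bar>p x\<bar> \<le> M" using M(2)[of x] that closure_subset by blast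
      then show ?thesis using p(2)[OF that] by auto
    qed
  qed (use M(1) in auto)
qed

lemma piecewise_C1_bounded:
  assumes "u \<in> piecewise_C1 T"
  obtains M where "\<And>x. \<bar>u x\<bar> \<le> M" "M \<ge> 0"
proof -
  have "\<exists>M\<ge>0. \<forall>x\<in>K. \<bar>u x\<bar> \<le> M" if "K \<in> T" for K
    by (rule piecewise_C1_extension[OF assms that]) (intro exI[of _ M for M] conjI ballI, assumption, simp)
  then obtain M where M: "\<And>K. K \<in> T \<Longrightarrow> M K \<ge> 0 \<and> (\<forall>x\<in>K. \<bar>u x\<bar> \<le> M K)"
    by metis
  show ?thesis
  proof (rule that[of "sum M T"])
    show "sum M T \<ge> 0"
      using M by (intro sum_nonneg) auto
    show "\<bar>u x\<bar> \<le> sum M T" for x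
    proof (cases "x \<in> \<Union>T")
      case True
      then obtain K where K: "K \<in> T" "x \<in> K" by blast
      then have "\<bar>u x\<bar> \<le> M K" using M by blast
      also have "\<dots> \<le> sum M T"
        using K M by (intro member_le_sum finite_T) auto
      finally show ?thesis .
    qed (use \<open>sum M T \<ge> 0\<close> piecewise_C1_zero[OF assms] in auto)
  qed
qed

lemma piecewise_C1_integrable: "u \<in> piecewise_C1 T \<Longrightarrow> integrable lborel u"
  by (rule piecewise_C1_bounded[of u], assumption)
    (rule integrable_lborel_bounded[OF piecewise_C1_borel _ bounded_Union piecewise_C1_zero])

lemma piecewise_C1_lipschitz:
  assumes "u \<in> piecewise_C1 T"
  obtains M where "M \<ge> 0" "\<And>K x y. K \<in> T \<Longrightarrow> x \<in> K \<Longrightarrow> y \<in> K \<Longrightarrow> \<bar>u x - u y\<bar> \<le> M * norm (x - y)"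
proof -
  have "\<exists>M\<ge>0. \<forall>x\<in>K. \<forall>y\<in>K. \<bar>u x - u y\<bar> \<le> M * norm (x - y)" if K: "K \<in> T" for K
  proof -
    obtain p where p: "C1_function p" "\<And>x. x \<in> K \<Longrightarrow> u x = p x"
      using piecewise_C1_on_cell[OF assms K] by blast
    then show ?thesis
      using C1_function_lipschitz[OF p(1) bounded_cell[OF K] convex_cell[OF K]] by auto
  qed
  then obtain M where M: "\<And>K. K \<in> T \<Longrightarrow> M K \<ge> 0 \<and> (\<forall>x\<in>K. \<forall>y\<in>K. \<bar>u x - u y\<bar> \<le> M K * norm (x - y))"
    by metis
  show ?thesis
  proof (rule that[of "sum M T"])
    show "sum M T \<ge> 0"
      using M by (intro sum_nonneg) auto
    fix K x y assume K: "K \<in> T" "x \<in> K" "y \<in> K"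
    then have "\<bar>u x - u y\<bar> \<le> M K * norm (x - y)" using M by blast
    also have "\<dots> \<le> sum M T * norm (x - y)"
      using K M by (intro mult_right_mono member_le_sum finite_T) auto
    finally show "\<bar>u x - u y\<bar> \<le> sum M T * norm (x - y)" .
  qed
qed

lemma piecewise_C1_derivative:
  assumes "u \<in> piecewise_C1 T" "K \<in> T"
  obtains g where "continuous_on UNIV g" "\<And>x. x \<in> K \<Longrightarrow> grad u x = g x"
    "\<And>x. x \<in> K \<Longrightarrow> (u has_derivative (\<lambda>h. g x \<bullet> h)) (at x)"
proof -
  obtain p where p: "C1_function p" "\<And>x. x \<in> K \<Longrightarrow> u x = p x"
    using piecewise_C1_on_cell[OF assms] by blast
  then obtain g where g: "continuous_on UNIV g" "\<And>x. (p has_derivative (\<lambda>h. g x \<bullet> h)) (at x)"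
    by (auto simp: C1_function_def)
  have d: "(u has_derivative (\<lambda>h. g x \<bullet> h)) (at x)" if "x \<in> K" for x
    using g(2) open_cell[OF assms(2)] that
    by (rule has_derivative_transform_within_open) (simp add: p(2))
  show ?thesis
  proof (rule that[OF g(1) _ d])
    fix x assume "x \<in> K"
    then have "frechet_derivative u (at x) = (\<lambda>h. g x \<bullet> h)"
      using d frechet_derivative_at by metis
    then show "grad u x = g x"
      by (simp add: grad_def vec_eq_iff inner_axis)
  qed
qed

text \<open>Each cell contributes a continuous function times an indicator, and along a ray the
  indicator of a convex set is eventually constant. So the limit exists everywhere, also at corners
  and for rays that run along the skeleton.\<close>

lemma left_limit_tendsto:
  assumes "u \<in> piecewise_C1 T"
  shows "((\<lambda>\<delta>. u (y + \<delta> *\<^sub>R \<omega>)) \<longlongrightarrow> left_limit \<omega> u y) (at_left 0)"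
proof -
  obtain p where p: "\<And>K. K \<in> T \<Longrightarrow> C1_function (p K)" "u = (\<lambda>x. \<Sum>K\<in>T. indicator K x * p K x)"
    by (rule piecewise_C1_eq[OF assms]) blast
  have "\<exists>l. ((\<lambda>\<delta>. indicator K (y + \<delta> *\<^sub>R \<omega>) * p K (y + \<delta> *\<^sub>R \<omega>)) \<longlongrightarrow> l) (at_left 0)" if K: "K \<in> T" for K
  proof -
    have "isCont (p K) y"
      using C1_function_continuous[OF p(1)[OF K]] by (simp add: continuous_on_eq_continuous_at)
    moreover have "((\<lambda>\<delta>::real. y + \<delta> *\<^sub>R \<omega>) \<longlongrightarrow> y + 0 *\<^sub>R \<omega>) (at_left 0)"
      by (intro tendsto_intros)
    ultimately have "((\<lambda>\<delta>. p K (y + \<delta> *\<^sub>R \<omega>)) \<longlongrightarrow> p K y) (at_left 0)"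
      by (intro isCont_tendsto_compose[of _ "p K"]) simp_all
    moreover have "\<exists>c::real. ((\<lambda>\<delta>. indicator K (y + \<delta> *\<^sub>R \<omega>)) \<longlongrightarrow> c) (at_left 0)"
      using eventually_mem_convex_ray[OF convex_cell[OF K], of y \<omega>]
    proof
      assume "\<forall>\<^sub>F \<delta> in at_left 0. y + \<delta> *\<^sub>R \<omega> \<in> K"
      then have "\<forall>\<^sub>F \<delta> in at_left 0. indicator K (y + \<delta> *\<^sub>R \<omega>) = (1::real)"
        by eventually_elim simp
      then show ?thesis by (intro exI[of _ 1] tendsto_eventually)
    next
      assume "\<forall>\<^sub>F \<delta> in at_left 0. y + \<delta> *\<^sub>R \<omega> \<notin> K"
      then have "\<forall>\<^sub>F \<delta> in at_left 0. indicator K (y + \<delta> *\<^sub>R \<omega>) = (0::real)"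
        by eventually_elim simp
      then show ?thesis by (intro exI[of _ 0] tendsto_eventually)
    qed
    ultimately show ?thesis
      using tendsto_mult by (elim exE, intro exI)
  qed
  then obtain l where "\<forall>K\<in>T. ((\<lambda>\<delta>. indicator K (y + \<delta> *\<^sub>R \<omega>) * p K (y + \<delta> *\<^sub>R \<omega>)) \<longlongrightarrow> l K) (at_left 0)"
    using bchoice[of T "\<lambda>K l. ((\<lambda>\<delta>. indicator K (y + \<delta> *\<^sub>R \<omega>) * p K (y + \<delta> *\<^sub>R \<omega>)) \<longlongrightarrow> l) (at_left 0)"]
    by blast
  then have "((\<lambda>\<delta>. u (y + \<delta> *\<^sub>R \<omega>)) \<longlongrightarrow> sum l T) (at_left 0)"
    unfolding p(2) by (intro tendsto_sum) blast
  then show ?thesis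
    unfolding left_limit_def by (simp add: tendsto_Lim)
qed

lemma left_limit_borel:
  assumes "u \<in> piecewise_C1 T"
  shows "left_limit \<omega> u \<in> borel_measurable borel"
proof (rule borel_measurable_LIMSEQ_real)
  note [measurable] = piecewise_C1_borel[OF assms]
  show "(\<lambda>y. u (y + (- inverse (real (Suc n))) *\<^sub>R \<omega>)) \<in> borel_measurable borel" for n
    by measurable
  have "filterlim (\<lambda>n. - inverse (real (Suc n))) (at_left 0) sequentially"
    unfolding filterlim_at
    using tendsto_minus[OF LIMSEQ_inverse_real_of_nat] by auto
  then show "(\<lambda>n. u (y + (- inverse (real (Suc n))) *\<^sub>R \<omega>)) \<longlonglongrightarrow> left_limit \<omega> u y" for y
    by (rule filterlim_compose[OF left_limit_tendsto[OF assms]])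
qed

text \<open>Points of a layer approach the facet with a speed that depends on their height in the
  prism; every positive speed leads to the same one-sided limit.\<close>

lemma left_limit_along:
  assumes "u \<in> piecewise_C1 T" "c > 0"
  shows "((\<lambda>t. u (y - (t * c) *\<^sub>R \<omega>)) \<longlongrightarrow> left_limit \<omega> u y) (at_right 0)"
proof -
  have "filterlim (\<lambda>t::real. - (t * c)) (at_left 0) (at_right 0)"
    unfolding filterlim_at
  proof
    have "((\<lambda>t::real. - (t * c)) \<longlongrightarrow> - (0 * c)) (at_right 0)"
      by (intro tendsto_intros)
    then show "((\<lambda>t::real. - (t * c)) \<longlongrightarrow> 0) (at_right 0)" by simp
    show "\<forall>\<^sub>F t in at_right 0. - (t * c) \<in> {..<0} \<and> - (t * c) \<noteq> 0"
      using eventually_at_right_less by eventually_elim (use assms in auto)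
  qed
  from filterlim_compose[OF left_limit_tendsto[OF assms(1)] this] show ?thesis
    by simp
qed

lemma upwind_trace_eq:
  assumes "u \<in> piecewise_C1 T" "\<Union>T \<subseteq> D"
  shows "upwind_trace D \<omega> u = left_limit \<omega> u"
proof -
  have "(if x \<in> D then u x else 0) = u x" for x
    using assms piecewise_C1_zero[OF assms(1), of x] by auto
  then show ?thesis
    by (simp add: upwind_trace_def left_limit_def fun_eq_iff)
qed

lemma interior_trace_eq:
  assumes "K \<in> T" "continuous_on UNIV p" "\<And>x. x \<in> K \<Longrightarrow> v x = p x" "y \<in> closure K"
  shows "interior_trace K v y = p y"
proof -
  have "y islimpt K"
    using assms(4) interior_limit_point[of y K] interior_open[OF open_cell[OF assms(1)]]
    by (auto simp: closure_def)
  then have nt: "at y within K \<noteq> bot"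
    by (simp add: trivial_limit_within)
  have "(p \<longlongrightarrow> p y) (at y within K)"
    using assms(2) by (auto simp: continuous_on_def intro: tendsto_within_subset)
  then have "(v \<longlongrightarrow> p y) (at y within K)"
    by (rule Lim_transform_eventually) (auto simp: eventually_at_filter assms(3))
  then show ?thesis
    unfolding interior_trace_def using nt by (rule tendsto_Lim[rotated])
qed

end

context polytopal_mesh
begin

text \<open>The facets are sorted by the sign of \<open>nrm F \<bullet> \<omega>\<close>. Those
  parallel to \<omega> contribute nothing, and the inflow facets for \<omega> are the outflow facets
  for \<open>- \<omega>\<close>, so that exit layers cover both cases.\<close>

lemma boundary_integral_eq:
  assumes K: "K \<in> T" and u: "u \<in> piecewise_C1 T" and TD: "\<Union>T \<subseteq> D"
    and p: "continuous_on UNIV p" "\<And>x. x \<in> K \<Longrightarrow> v x = p x"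
  shows "boundary_integral K (\<lambda>\<nu> x. upwind_trace D \<omega> u x * (\<omega> \<bullet> \<nu>) * interior_trace K v x)
    = (\<Sum>F\<in>open_polytope.outflow K \<omega>. (open_polytope.nrm K F \<bullet> \<omega>) *
        (LINT z|lborel. indicator (open_polytope.prism K F) z *
          (left_limit \<omega> u (open_polytope.proj K F z) * p (open_polytope.proj K F z))))
    - (\<Sum>F\<in>open_polytope.outflow K (- \<omega>). (open_polytope.nrm K F \<bullet> (- \<omega>)) *
        (LINT z|lborel. indicator (open_polytope.prism K F) z *
          (left_limit \<omega> u (open_polytope.proj K F z) * p (open_polytope.proj K F z))))"
proof -
  interpret P: open_polytope K by (rule cells[OF K])
  note [measurable] = left_limit_borel[OF u, of \<omega>]
  have [measurable]: "p \<in> borel_measurable borel"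
    using p(1) by (rule borel_measurable_continuous_onI)
  define I where "I F = (LINT z|lborel. indicator (P.prism F) z *
    (left_limit \<omega> u (P.proj F z) * p (P.proj F z)))" for F
  have one: "facet_integral (outer_normal K F) F
      (\<lambda>x. upwind_trace D \<omega> u x * (\<omega> \<bullet> outer_normal K F) * interior_trace K v x)
      = (P.nrm F \<bullet> \<omega>) * I F" if F: "F \<in> P.facets" for F
  proof -
    have "F \<subseteq> closure K"
      using P.facet_eq[OF F] by blast
    then have "facet_integral (outer_normal K F) F
      (\<lambda>x. upwind_trace D \<omega> u x * (\<omega> \<bullet> outer_normal K F) * interior_trace K v x)
      = facet_integral (outer_normal K F) F (\<lambda>x. (P.nrm F \<bullet> \<omega>) * (left_limit \<omega> u x * p x))"
      by (intro P.facet_integral_cong[OF F])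
        (auto simp: upwind_trace_eq[OF u TD] interior_trace_eq[OF K p] P.nrm_def inner_commute)
    also have "\<dots> = (LINT z|lborel. indicator (P.prism F) z *
        ((P.nrm F \<bullet> \<omega>) * (left_limit \<omega> u (P.proj F z) * p (P.proj F z))))"
      by (rule P.facet_integral_eq[OF F]) measurable
    also have "\<dots> = (LINT z|lborel. (P.nrm F \<bullet> \<omega>) * (indicator (P.prism F) z *
        (left_limit \<omega> u (P.proj F z) * p (P.proj F z))))"
      by (simp add: mult.left_commute)
    also have "\<dots> = (P.nrm F \<bullet> \<omega>) * I F"
      unfolding I_def by simp
    finally show ?thesis .
  qed
  have "boundary_integral K (\<lambda>\<nu> x. upwind_trace D \<omega> u x * (\<omega> \<bullet> \<nu>) * interior_trace K v x)
    = (\<Sum>F\<in>P.facets. (P.nrm F \<bullet> \<omega>) * I F)"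
    unfolding boundary_integral_def P.facets_def[symmetric] by (rule sum.cong[OF refl]) (rule one)
  also have "\<dots> = (\<Sum>F\<in>P.facets. (if 0 < P.nrm F \<bullet> \<omega> then (P.nrm F \<bullet> \<omega>) * I F else 0)
      - (if 0 < P.nrm F \<bullet> (- \<omega>) then (P.nrm F \<bullet> (- \<omega>)) * I F else 0))"
    by (rule sum.cong) auto
  also have "\<dots> = (\<Sum>F\<in>P.outflow \<omega>. (P.nrm F \<bullet> \<omega>) * I F) - (\<Sum>F\<in>P.outflow (- \<omega>). (P.nrm F \<bullet> (- \<omega>)) * I F)"
    unfolding sum_subtractf P.outflow_def by (simp add: sum.inter_filter P.finite_facets cong: if_cong)
  finally show ?thesis
    unfolding I_def .
qed

text \<open>Pairs \<open>x\<close>, \<open>x + t \<omega>\<close> inside the cell produce the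
  derivative, pairs that leave it the outflow facets, pairs that enter it the inflow facets. In both
  kinds of layers \<open>u x\<close> is the value at the upstream end, inside the cell for leaving
  and outside for entering pairs; this is why the limit contains the upwind trace on every
  facet.\<close>

lemma cell_form_limit:
  assumes K: "K \<in> T" and u: "u \<in> piecewise_C1 T" and v: "v \<in> piecewise_C1 T" and TD: "\<Union>T \<subseteq> D"
  shows "((\<lambda>t. (1 / t) * (LINT x|lborel. u x * (indicator K x * v x - indicator K (x + t *\<^sub>R \<omega>) * v (x + t *\<^sub>R \<omega>))))
    \<longlongrightarrow> cell_form D \<omega> K u v) (at_right 0)"
proof -
  interpret P: open_polytope K by (rule cells[OF K])
  obtain p M where p: "continuous_on UNIV p" "\<And>x. \<bar>p x\<bar> \<le> M" "\<And>x. x \<in> K \<Longrightarrow> v x = p x" "M \<ge> 0"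
    by (rule piecewise_C1_extension[OF v K]) blast
  obtain N where N: "\<And>x. \<bar>u x\<bar> \<le> N" "N \<ge> 0"
    by (rule piecewise_C1_bounded[OF u]) blast
  obtain g where g: "continuous_on UNIV g" "\<And>x. x \<in> K \<Longrightarrow> grad v x = g x"
    "\<And>x. x \<in> K \<Longrightarrow> (v has_derivative (\<lambda>h. g x \<bullet> h)) (at x)"
    by (rule piecewise_C1_derivative[OF v K]) blast
  obtain L where L: "L \<ge> 0" "\<And>K x y. K \<in> T \<Longrightarrow> x \<in> K \<Longrightarrow> y \<in> K \<Longrightarrow> \<bar>v x - v y\<bar> \<le> L * norm (x - y)"
    by (rule piecewise_C1_lipschitz[OF v]) blast
  have [measurable]: "p \<in> borel_measurable borel" "g \<in> borel_measurable borel" "K \<in> sets borel"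
    using p(1) g(1) borel_cell[OF K] by (auto intro: borel_measurable_continuous_onI)
  note [measurable] = piecewise_C1_borel[OF u] piecewise_C1_borel[OF v] left_limit_borel[OF u, of \<omega>]
  have isCont_p: "isCont p y" for y
    using p(1) by (simp add: continuous_on_eq_continuous_at)
  define I where "I F = (LINT z|lborel. indicator (P.prism F) z *
    (left_limit \<omega> u (P.proj F z) * p (P.proj F z)))" for F
  let ?a = "\<lambda>t x. indicator {x \<in> K. x + t *\<^sub>R \<omega> \<in> K} x * (u x * (v x - v (x + t *\<^sub>R \<omega>)))"
  let ?b = "\<lambda>t x. indicator {x \<in> K. x + t *\<^sub>R \<omega> \<notin> K} x * (u x * p x)"
  let ?c = "\<lambda>t x. indicator {x. x \<notin> K \<and> x + t *\<^sub>R \<omega> \<in> K} x * (u x * p (x + t *\<^sub>R \<omega>))"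
  have slide_lim: "((\<lambda>t. P.slide F \<omega>' t z) \<longlongrightarrow> P.proj F z) (at_right 0)" for F \<omega>' z
  proof -
    have "((\<lambda>t. P.slide F \<omega>' t z) \<longlongrightarrow> P.proj F z - (0 * (P.nrm F \<bullet> z - P.lvl F)) *\<^sub>R \<omega>') (at_right 0)"
      unfolding P.slide_def by (intro tendsto_intros)
    then show ?thesis by simp
  qed
  have p_slide: "((\<lambda>t. p (P.slide F \<omega>' t z)) \<longlongrightarrow> p (P.proj F z)) (at_right 0)" for F \<omega>' z
    by (rule isCont_tendsto_compose[OF isCont_p slide_lim])
  have bnd: "\<bar>a * b\<bar> \<le> N * M" if "\<bar>a\<bar> \<le> N" "\<bar>b\<bar> \<le> M" for a b :: real
    unfolding abs_mult using that N(2) by (intro mult_mono) auto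
  have b: "((\<lambda>t. (1 / t) * (LINT x|lborel. ?b t x)) \<longlongrightarrow> (\<Sum>F\<in>P.outflow \<omega>. (P.nrm F \<bullet> \<omega>) * I F)) (at_right 0)"
    unfolding I_def
  proof (rule P.exit_layer_limit[where g = "\<lambda>_ y. left_limit \<omega> u y * p y" and G = "\<lambda>_ x. u x * p x" and M = "N * M"])
    show "((\<lambda>t. u (P.slide F \<omega> t z) * p (P.slide F \<omega> t z)) \<longlongrightarrow> left_limit \<omega> u (P.proj F z) * p (P.proj F z)) (at_right 0)"
      if "0 < P.nrm F \<bullet> z - P.lvl F" for F z
      using left_limit_along[OF u that, of "P.proj F z" \<omega>] p_slide[of F \<omega> z]
      unfolding P.slide_def by (rule tendsto_mult)
  qed (use bnd N p in \<open>auto\<close>)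
  \<comment> \<open>A shift by \<open>t \<omega>\<close> turns the entering points into points that
    leave the cell in direction \<open>- \<omega>\<close>; \<open>u\<close> is then evaluated at
    \<open>x - t \<omega>\<close>, which makes the integrand depend on \<open>t\<close>.\<close>
  have c: "((\<lambda>t. (1 / t) * (LINT x|lborel. ?c t x)) \<longlongrightarrow> (\<Sum>F\<in>P.outflow (- \<omega>). (P.nrm F \<bullet> (- \<omega>)) * I F)) (at_right 0)"
  proof -
    have "((\<lambda>t. (1 / t) * (LINT x|lborel. indicator {x \<in> K. x + t *\<^sub>R (- \<omega>) \<notin> K} x * (u (x - t *\<^sub>R \<omega>) * p x)))
        \<longlongrightarrow> (\<Sum>F\<in>P.outflow (- \<omega>). (P.nrm F \<bullet> (- \<omega>)) * I F)) (at_right 0)"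
      unfolding I_def
    proof (rule P.exit_layer_limit[where g = "\<lambda>_ y. left_limit \<omega> u y * p y" and M = "N * M"])
      show "((\<lambda>t. u (P.slide F (- \<omega>) t z - t *\<^sub>R \<omega>) * p (P.slide F (- \<omega>) t z))
          \<longlongrightarrow> left_limit \<omega> u (P.proj F z) * p (P.proj F z)) (at_right 0)"
        if h: "P.nrm F \<bullet> z - P.lvl F < 1" for F z
      proof (rule tendsto_mult[OF _ p_slide])
        \<comment> \<open>A point of height \<open>h\<close> lies \<open>t * h\<close> downstream of
          its foot, and after the shift \<open>t * (1 - h)\<close> upstream of it. This is positive
          because the height is below 1.\<close>
        define c where "c = 1 - (P.nrm F \<bullet> z - P.lvl F)"
        have "c > 0" using h by (simp add: c_def)
        have "P.slide F (- \<omega>) t z - t *\<^sub>R \<omega> = P.proj F z - (t * c) *\<^sub>R \<omega>" for t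
          by (simp add: P.slide_def c_def algebra_simps)
        then show "((\<lambda>t. u (P.slide F (- \<omega>) t z - t *\<^sub>R \<omega>)) \<longlongrightarrow> left_limit \<omega> u (P.proj F z)) (at_right 0)"
          using left_limit_along[OF u \<open>c > 0\<close>, of "P.proj F z" \<omega>] by simp
      qed
    qed (use bnd N p in \<open>auto\<close>)
    moreover have "(LINT x|lborel. indicator {x \<in> K. x + t *\<^sub>R (- \<omega>) \<notin> K} x * (u (x - t *\<^sub>R \<omega>) * p x))
        = (LINT x|lborel. ?c t x)" for t
    proof -
      have "(LINT x|lborel. indicator {x \<in> K. x + t *\<^sub>R (- \<omega>) \<notin> K} x * (u (x - t *\<^sub>R \<omega>) * p x))
        = (LINT x|lborel. indicator {x \<in> K. x + t *\<^sub>R (- \<omega>) \<notin> K} (x + t *\<^sub>R \<omega>) *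
            (u (x + t *\<^sub>R \<omega> - t *\<^sub>R \<omega>) * p (x + t *\<^sub>R \<omega>)))"
        by (rule integral_lborel_translate[symmetric]) measurable
      also have "\<dots> = (LINT x|lborel. ?c t x)"
        by (intro Bochner_Integration.integral_cong refl) (auto simp: indicator_def)
      finally show ?thesis .
    qed
    ultimately show ?thesis by simp
  qed
  have a: "((\<lambda>t. LINT x|lborel. (1 / t) * ?a t x) \<longlongrightarrow> (LINT x|lborel. indicator K x * (- (u x * (\<omega> \<bullet> g x))))) (at_right 0)"
  proof (rule dominated_convergence_at_right_0)
    show "integrable lborel (\<lambda>x. indicator K x * (N * (L * norm \<omega>)))"
      using bounded_cell[OF K] N L(1)
      by (intro integrable_lborel_bounded[where M = "N * (L * norm \<omega>)" and B = K]) (auto simp: indicator_def)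
    show "AE x in lborel. \<bar>(1 / t) * ?a t x\<bar> \<le> indicator K x * (N * (L * norm \<omega>))" if t: "t > 0" for t
    proof (rule AE_I2)
      fix x
      show "\<bar>(1 / t) * ?a t x\<bar> \<le> indicator K x * (N * (L * norm \<omega>))"
      proof (cases "x \<in> K \<and> x + t *\<^sub>R \<omega> \<in> K")
        case True
        then have "\<bar>v x - v (x + t *\<^sub>R \<omega>)\<bar> \<le> L * (t * norm \<omega>)"
          using L(2)[OF K, of x "x + t *\<^sub>R \<omega>"] t by simp
        then have "\<bar>u x\<bar> * \<bar>v x - v (x + t *\<^sub>R \<omega>)\<bar> \<le> N * (L * (t * norm \<omega>))"
          using N by (intro mult_mono) auto
        then have "(1 / t) * \<bar>u x * (v x - v (x + t *\<^sub>R \<omega>))\<bar> \<le> (1 / t) * (N * (L * (t * norm \<omega>)))"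
          using t by (intro mult_left_mono) (auto simp: abs_mult)
        moreover have "\<bar>(1 / t) * ?a t x\<bar> = (1 / t) * \<bar>u x * (v x - v (x + t *\<^sub>R \<omega>))\<bar>"
          using True t by (simp add: abs_mult)
        ultimately show ?thesis
          using True t by simp
      next
        case False
        then show ?thesis
          using N L(1) by (auto simp: indicator_def)
      qed
    qed
    show "AE x in lborel. ((\<lambda>t. (1 / t) * ?a t x) \<longlongrightarrow> indicator K x * (- (u x * (\<omega> \<bullet> g x)))) (at_right 0)"
    proof (rule AE_I2)
      fix x
      show "((\<lambda>t. (1 / t) * ?a t x) \<longlongrightarrow> indicator K x * (- (u x * (\<omega> \<bullet> g x)))) (at_right 0)"
      proof (cases "x \<in> K")
        case True
        have "((\<lambda>t. x + t *\<^sub>R \<omega>) has_derivative (\<lambda>s. s *\<^sub>R \<omega>)) (at 0)"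
          by (auto intro!: derivative_eq_intros)
        moreover have "(v has_derivative (\<lambda>h. g x \<bullet> h)) (at (x + 0 *\<^sub>R \<omega>))"
          using g(3)[OF True] by simp
        ultimately have "((\<lambda>t. v (x + t *\<^sub>R \<omega>)) has_derivative (\<lambda>s. g x \<bullet> (s *\<^sub>R \<omega>))) (at 0)"
          by (rule has_derivative_compose)
        then have "((\<lambda>t. v (x + t *\<^sub>R \<omega>)) has_real_derivative (g x \<bullet> \<omega>)) (at 0)"
          by (simp add: has_field_derivative_def mult_commute_abs)
        then have "((\<lambda>t. (v (x + t *\<^sub>R \<omega>) - v x) / t) \<longlongrightarrow> g x \<bullet> \<omega>) (at 0)"
          by (simp add: DERIV_def)
        then have "((\<lambda>t. - (u x * ((v (x + t *\<^sub>R \<omega>) - v x) / t))) \<longlongrightarrow> - (u x * (\<omega> \<bullet> g x))) (at_right 0)"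
          by (intro tendsto_intros) (simp add: inner_commute filterlim_at_split)
        moreover have "\<forall>\<^sub>F t in at_right 0. - (u x * ((v (x + t *\<^sub>R \<omega>) - v x) / t)) = (1 / t) * ?a t x"
        proof -
          have "((\<lambda>t. x + t *\<^sub>R \<omega>) \<longlongrightarrow> x + 0 *\<^sub>R \<omega>) (at_right 0)"
            by (intro tendsto_intros)
          then have "\<forall>\<^sub>F t in at_right 0. x + t *\<^sub>R \<omega> \<in> K"
            using topological_tendstoD[of _ "x + 0 *\<^sub>R \<omega>"] open_cell[OF K] True by simp
          then show ?thesis
            using eventually_at_right_less
            by eventually_elim (use True in \<open>simp add: field_simps\<close>)
        qed
        ultimately have "((\<lambda>t. (1 / t) * ?a t x) \<longlongrightarrow> - (u x * (\<omega> \<bullet> g x))) (at_right 0)"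
          by (rule Lim_transform_eventually)
        then show ?thesis
          using True by simp
      qed (simp add: indicator_def)
    qed
  qed measurable
  have int: "integrable lborel (?a t)" "integrable lborel (?b t)" "integrable lborel (?c t)" for t
  proof -
    have "\<bar>u x * (v x - v (x + t *\<^sub>R \<omega>))\<bar> \<le> N * (\<bar>M\<bar> + \<bar>M\<bar>)" if "x \<in> K" "x + t *\<^sub>R \<omega> \<in> K" for x
    proof -
      have "\<bar>v x\<bar> \<le> M" "\<bar>v (x + t *\<^sub>R \<omega>)\<bar> \<le> M"
        using that p by auto
      then have "\<bar>v x - v (x + t *\<^sub>R \<omega>)\<bar> \<le> \<bar>M\<bar> + \<bar>M\<bar>" by linarith
      then show ?thesis
        unfolding abs_mult using N by (intro mult_mono) auto
    qed
    then show "integrable lborel (?a t)"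
      using bounded_cell[OF K] N by (intro integrable_lborel_bounded[where B = K and M = "N * (\<bar>M\<bar> + \<bar>M\<bar>)"])
        (auto simp: indicator_def)
    show "integrable lborel (?b t)"
      using bounded_cell[OF K] bnd[OF N(1) p(2)] N(2) p(4)
      by (intro integrable_lborel_bounded[where B = K and M = "N * M"]) (auto simp: indicator_def)
    show "integrable lborel (?c t)"
      using bounded_Union bnd[OF N(1) p(2)] N(2) p(4) piecewise_C1_zero[OF u]
      by (intro integrable_lborel_bounded[where B = "\<Union>T" and M = "N * M"]) (auto simp: indicator_def)
  qed
  have "(1 / t) * (LINT x|lborel. u x * (indicator K x * v x - indicator K (x + t *\<^sub>R \<omega>) * v (x + t *\<^sub>R \<omega>)))
      = (LINT x|lborel. (1 / t) * ?a t x) + (1 / t) * (LINT x|lborel. ?b t x) - (1 / t) * (LINT x|lborel. ?c t x)" for t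
  proof -
    have "(LINT x|lborel. u x * (indicator K x * v x - indicator K (x + t *\<^sub>R \<omega>) * v (x + t *\<^sub>R \<omega>)))
        = (LINT x|lborel. ?a t x + ?b t x - ?c t x)"
      by (intro Bochner_Integration.integral_cong refl) (auto simp: indicator_def p(3) algebra_simps)
    also have "\<dots> = (LINT x|lborel. ?a t x) + (LINT x|lborel. ?b t x) - (LINT x|lborel. ?c t x)"
      using int[of t] by (simp add: Bochner_Integration.integral_add Bochner_Integration.integral_diff)
    finally have split: "(LINT x|lborel. u x * (indicator K x * v x - indicator K (x + t *\<^sub>R \<omega>) * v (x + t *\<^sub>R \<omega>)))
        = (LINT x|lborel. ?a t x) + (LINT x|lborel. ?b t x) - (LINT x|lborel. ?c t x)" .
    have "c * (x + y - z) = c * x + c * y - c * z" for c x y z :: real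
      by (simp add: algebra_simps)
    then show ?thesis
      unfolding split integral_mult_right_zero .
  qed
  moreover have "cell_form D \<omega> K u v = (LINT x|lborel. indicator K x * (- (u x * (\<omega> \<bullet> g x))))
      + (\<Sum>F\<in>P.outflow \<omega>. (P.nrm F \<bullet> \<omega>) * I F) - (\<Sum>F\<in>P.outflow (- \<omega>). (P.nrm F \<bullet> (- \<omega>)) * I F)"
  proof -
    have "(LINT x|lebesgue_on K. u x * (\<omega> \<bullet> grad v x)) = (LINT x|lebesgue_on K. u x * (\<omega> \<bullet> g x))"
      by (intro Bochner_Integration.integral_cong refl) (simp add: g(2))
    also have "\<dots> = (LINT x|lborel. indicator K x * (u x * (\<omega> \<bullet> g x)))"
      by (rule LINT_lebesgue_on_borel) measurable
    finally have vol: "(LINT x|lebesgue_on K. u x * (\<omega> \<bullet> grad v x))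
        = (LINT x|lborel. indicator K x * (u x * (\<omega> \<bullet> g x)))" .
    have "boundary_integral K (\<lambda>\<nu> x. upwind_trace D \<omega> u x * (\<omega> \<bullet> \<nu>) * interior_trace K v x)
        = (\<Sum>F\<in>P.outflow \<omega>. (P.nrm F \<bullet> \<omega>) * I F) - (\<Sum>F\<in>P.outflow (- \<omega>). (P.nrm F \<bullet> (- \<omega>)) * I F)"
      unfolding I_def by (rule boundary_integral_eq[OF K u TD p(1,3)])
    then show ?thesis
      unfolding cell_form_def vol by simp
  qed
  ultimately show ?thesis
    using tendsto_diff[OF tendsto_add[OF a b] c] by simp
qed

definition transport :: "real^'d \<Rightarrow> (real^'d \<Rightarrow> real) \<Rightarrow> (real^'d \<Rightarrow> real) \<Rightarrow> real \<Rightarrow> real" where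
  "transport \<omega> u v t = (1 / t) * (LINT x|lborel. u x * (v x - v (x + t *\<^sub>R \<omega>)))"

lemma integrable_shift:
  assumes "u \<in> piecewise_C1 T"
  shows "integrable lborel (\<lambda>x. u (x + c))"
proof -
  note [measurable] = piecewise_C1_borel[OF assms]
  obtain N where N: "\<And>x. \<bar>u x\<bar> \<le> N"
    by (rule piecewise_C1_bounded[OF assms]) blast
  have "bounded ((\<lambda>x. - c + x) ` \<Union>T)"
    using bounded_Union by (rule bounded_translation)
  then show ?thesis
    by (rule integrable_lborel_bounded[rotated 2, where M = N])
      (use N piecewise_C1_zero[OF assms] in \<open>force+\<close>)
qed

lemma integrable_mult_shift:
  assumes u: "u \<in> piecewise_C1 T" and v: "v \<in> piecewise_C1 T"
  shows "integrable lborel (\<lambda>x. u (x + b) * v (x + c))"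
proof -
  note [measurable] = piecewise_C1_borel[OF u] piecewise_C1_borel[OF v]
  obtain N where N: "\<And>x. \<bar>u x\<bar> \<le> N"
    by (rule piecewise_C1_bounded[OF u]) blast
  have "integrable lborel (\<lambda>x. v (x + c) * N)"
    by (intro integrable_mult_left integrable_shift v)
  then show ?thesis
  proof (rule Bochner_Integration.integrable_bound)
    have "\<bar>u (x + b)\<bar> * \<bar>v (x + c)\<bar> \<le> \<bar>N\<bar> * \<bar>v (x + c)\<bar>" for x
      using order_trans[OF N abs_ge_self] by (intro mult_right_mono) auto
    then show "AE x in lborel. norm (u (x + b) * v (x + c)) \<le> norm (v (x + c) * N)"
      by (intro AE_I2) (simp add: abs_mult mult.commute)
  qed measurable
qed

text \<open>The cells are disjoint and \<open>v\<close> vanishes off them, so the difference of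
  \<open>v\<close> is the sum of the differences of its truncations to single cells.\<close>

theorem transport_limit:
  assumes u: "u \<in> piecewise_C1 T" and v: "v \<in> piecewise_C1 T" and TD: "\<Union>T \<subseteq> D"
  shows "(transport \<omega> u v \<longlongrightarrow> (\<Sum>K\<in>T. cell_form D \<omega> K u v)) (at_right 0)"
proof -
  have cell: "(\<lambda>x. indicator K x * v x) \<in> piecewise_C1 T" if K: "K \<in> T" for K
    unfolding piecewise_C1_def
  proof (intro CollectI conjI ballI allI impI)
    fix L assume L: "L \<in> T"
    show "\<exists>p. C1_function p \<and> (\<forall>x\<in>L. indicator K x * v x = p x)"
    proof (cases "L = K")
      case True
      then show ?thesis using piecewise_C1_on_cell[OF v K] by auto
    next
      case False
      then show ?thesis
        using cell_unique[OF K L] by (intro exI[of _ "\<lambda>_. 0"]) (auto simp: indicator_def C1_function_const)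
    qed
  qed (simp add: piecewise_C1_zero[OF v])
  have "transport \<omega> u v t = (\<Sum>K\<in>T. (1 / t) *
      (LINT x|lborel. u x * (indicator K x * v x - indicator K (x + t *\<^sub>R \<omega>) * v (x + t *\<^sub>R \<omega>))))" for t
  proof -
    have "u x * (v x - v (x + t *\<^sub>R \<omega>))
        = (\<Sum>K\<in>T. u x * (indicator K x * v x - indicator K (x + t *\<^sub>R \<omega>) * v (x + t *\<^sub>R \<omega>)))" for x
      by (simp only: sum_distrib_left[symmetric] sum_subtractf sum_indicator_piecewise[OF v])
    then have "(LINT x|lborel. u x * (v x - v (x + t *\<^sub>R \<omega>)))
        = (LINT x|lborel. (\<Sum>K\<in>T. u x * (indicator K x * v x - indicator K (x + t *\<^sub>R \<omega>) * v (x + t *\<^sub>R \<omega>))))"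
      by simp
    also have "\<dots> = (\<Sum>K\<in>T. (LINT x|lborel. u x * (indicator K x * v x - indicator K (x + t *\<^sub>R \<omega>) * v (x + t *\<^sub>R \<omega>))))"
    proof (rule Bochner_Integration.integral_sum)
      fix K assume "K \<in> T"
      from cell[OF this] show "integrable lborel (\<lambda>x. u x * (indicator K x * v x - indicator K (x + t *\<^sub>R \<omega>) * v (x + t *\<^sub>R \<omega>)))"
        unfolding right_diff_distrib
        using integrable_mult_shift[OF u, of "\<lambda>x. indicator K x * v x" 0 0]
          integrable_mult_shift[OF u, of "\<lambda>x. indicator K x * v x" 0 "t *\<^sub>R \<omega>"]
        by (intro Bochner_Integration.integrable_diff) simp_all
    qed
    finally show ?thesis
      by (simp add: transport_def sum_distrib_left)
  qed
  then have eq: "transport \<omega> u v = (\<lambda>t. \<Sum>K\<in>T. (1 / t) *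
      (LINT x|lborel. u x * (indicator K x * v x - indicator K (x + t *\<^sub>R \<omega>) * v (x + t *\<^sub>R \<omega>))))"
    by (rule ext)
  show ?thesis
    unfolding eq by (intro tendsto_sum cell_form_limit u v TD)
qed

end

section \<open>Energy identity and continuity of functions without energy\<close>

context polytopal_mesh
begin

text \<open>The number of cells that contain exactly one of \<open>x\<close> and
  \<open>x + t \<omega>\<close>. Where it is 0, both points lie in a common cell or both outside all
  cells.\<close>

definition crossing :: "real^'d \<Rightarrow> real \<Rightarrow> real^'d \<Rightarrow> real" where
  "crossing \<omega> t x = (\<Sum>K\<in>T. indicator {x \<in> K. x + t *\<^sub>R \<omega> \<notin> K} x + indicator {x. x \<notin> K \<and> x + t *\<^sub>R \<omega> \<in> K} x)"

lemma crossing_nonneg: "crossing \<omega> t x \<ge> 0"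
  unfolding crossing_def by (intro sum_nonneg) (auto simp: indicator_def)

lemma crossing_le: "crossing \<omega> t x \<le> 2 * real (card T)"
proof -
  have "crossing \<omega> t x \<le> (\<Sum>K\<in>T. 2)"
    unfolding crossing_def by (intro sum_mono) (auto simp: indicator_def)
  then show ?thesis by simp
qed

lemma crossing_ge_1:
  assumes "K \<in> T" "(x \<in> K) \<noteq> (x + t *\<^sub>R \<omega> \<in> K)"
  shows "crossing \<omega> t x \<ge> 1"
proof -
  have "1 \<le> (indicator {x \<in> K. x + t *\<^sub>R \<omega> \<notin> K} x + indicator {x. x \<notin> K \<and> x + t *\<^sub>R \<omega> \<in> K} x :: real)"
    using assms(2) by (auto simp: indicator_def)
  also have "\<dots> \<le> crossing \<omega> t x"
    unfolding crossing_def by (rule member_le_sum) (use assms finite_T in \<open>auto simp: indicator_def\<close>)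
  finally show ?thesis .
qed

lemma borel_crossing [measurable]: "crossing \<omega> t \<in> borel_measurable borel"
  unfolding crossing_def
proof (intro borel_measurable_sum)
  fix K assume "K \<in> T"
  then have [measurable]: "K \<in> sets borel" by (rule borel_cell)
  show "(\<lambda>x. indicator {x \<in> K. x + t *\<^sub>R \<omega> \<notin> K} x + indicator {x. x \<notin> K \<and> x + t *\<^sub>R \<omega> \<in> K} x :: real) \<in> borel_measurable borel"
    by measurable
qed

lemma integrable_exit:
  assumes "K \<in> T"
  shows "integrable lborel (\<lambda>x. indicator {x \<in> K. x + t *\<^sub>R \<omega> \<notin> K} x :: real)"
    and "integrable lborel (\<lambda>x. indicator {x. x \<notin> K \<and> x + t *\<^sub>R \<omega> \<in> K} x :: real)"
    and "(LINT x|lborel. indicator {x. x \<notin> K \<and> x + t *\<^sub>R \<omega> \<in> K} x)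
      = (LINT x|lborel. indicator {x \<in> K. x + t *\<^sub>R (- \<omega>) \<notin> K} x :: real)"
proof -
  have [measurable]: "K \<in> sets borel" using assms by (rule borel_cell)
  show "integrable lborel (\<lambda>x. indicator {x \<in> K. x + t *\<^sub>R \<omega> \<notin> K} x :: real)"
    using bounded_cell[OF assms] by (intro integrable_lborel_bounded[where M = 1 and B = K]) (auto simp: indicator_def)
  have "bounded ((\<lambda>x. - (t *\<^sub>R \<omega>) + x) ` K)"
    using bounded_cell[OF assms] by (rule bounded_translation)
  then show "integrable lborel (\<lambda>x. indicator {x. x \<notin> K \<and> x + t *\<^sub>R \<omega> \<in> K} x :: real)"
    by (rule integrable_lborel_bounded[rotated 2, where M = 1]) (force simp: indicator_def image_iff)+
  have "(LINT x|lborel. indicator {x \<in> K. x + t *\<^sub>R (- \<omega>) \<notin> K} x :: real)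
      = (LINT x|lborel. indicator {x \<in> K. x + t *\<^sub>R (- \<omega>) \<notin> K} (x + t *\<^sub>R \<omega>))"
    by (rule integral_lborel_translate[symmetric]) measurable
  also have "\<dots> = (LINT x|lborel. indicator {x. x \<notin> K \<and> x + t *\<^sub>R \<omega> \<in> K} x)"
    by (intro Bochner_Integration.integral_cong refl) (auto simp: indicator_def)
  finally show "(LINT x|lborel. indicator {x. x \<notin> K \<and> x + t *\<^sub>R \<omega> \<in> K} x)
      = (LINT x|lborel. indicator {x \<in> K. x + t *\<^sub>R (- \<omega>) \<notin> K} x :: real)" ..
qed

lemma integrable_crossing: "integrable lborel (crossing \<omega> t)"
  unfolding crossing_def
  by (intro Bochner_Integration.integrable_sum Bochner_Integration.integrable_add integrable_exit)

lemma exit_measure_limit: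
  assumes "K \<in> T"
  shows "\<exists>l. ((\<lambda>t. (1 / t) * (LINT x|lborel. indicator {x \<in> K. x + t *\<^sub>R \<omega> \<notin> K} x)) \<longlongrightarrow> l) (at_right 0)"
  using open_polytope.exit_layer_limit[OF cells[OF assms], of "\<lambda>_ _. 1" 1 "\<lambda>_ _. 1" \<omega>]
  by (intro exI) simp

text \<open>The points that leave a cell within time \<open>t\<close> have measure of order
  \<open>t\<close>, by the layer limit for the constant 1. Entering points are leaving points for
  the opposite direction after a shift.\<close>

lemma crossing_measure_bound:
  "\<exists>C>0. \<forall>\<^sub>F t in at_right 0. (1 / t) * (LINT x|lborel. crossing \<omega> t x) \<le> C"
proof -
  have "\<exists>l. ((\<lambda>t. (1 / t) * (LINT x|lborel. indicator {x \<in> K. x + t *\<^sub>R \<omega> \<notin> K} x + indicator {x. x \<notin> K \<and> x + t *\<^sub>R \<omega> \<in> K} x)) \<longlongrightarrow> l) (at_right 0)"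
    if K: "K \<in> T" for K
  proof -
    obtain l where l: "((\<lambda>t. (1 / t) * (LINT x|lborel. indicator {x \<in> K. x + t *\<^sub>R \<omega> \<notin> K} x)) \<longlongrightarrow> l) (at_right 0)"
      using exit_measure_limit[OF K, of \<omega>] by blast
    obtain m where m: "((\<lambda>t. (1 / t) * (LINT x|lborel. indicator {x \<in> K. x + t *\<^sub>R (- \<omega>) \<notin> K} x)) \<longlongrightarrow> m) (at_right 0)"
      using exit_measure_limit[OF K, of "- \<omega>"] by blast
    have "(1 / t) * (LINT x|lborel. indicator {x \<in> K. x + t *\<^sub>R \<omega> \<notin> K} x + indicator {x. x \<notin> K \<and> x + t *\<^sub>R \<omega> \<in> K} x)
      = (1 / t) * (LINT x|lborel. indicator {x \<in> K. x + t *\<^sub>R \<omega> \<notin> K} x) + (1 / t) * (LINT x|lborel. indicator {x \<in> K. x + t *\<^sub>R (- \<omega>) \<notin> K} x)"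
      for t
      unfolding Bochner_Integration.integral_add[OF integrable_exit(1,2)[OF K]] integrable_exit(3)[OF K] distrib_left ..
    then show ?thesis
      using tendsto_add[OF l m] by (intro exI[of _ "l + m"]) simp
  qed
  then obtain l where l: "\<forall>K\<in>T. ((\<lambda>t. (1 / t) * (LINT x|lborel. indicator {x \<in> K. x + t *\<^sub>R \<omega> \<notin> K} x + indicator {x. x \<notin> K \<and> x + t *\<^sub>R \<omega> \<in> K} x)) \<longlongrightarrow> l K) (at_right 0)"
    using bchoice[of T "\<lambda>K l. ((\<lambda>t. (1 / t) * (LINT x|lborel. indicator {x \<in> K. x + t *\<^sub>R \<omega> \<notin> K} x + indicator {x. x \<notin> K \<and> x + t *\<^sub>R \<omega> \<in> K} x)) \<longlongrightarrow> l) (at_right 0)"]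
    by blast
  have "(1 / t) * (LINT x|lborel. crossing \<omega> t x)
      = (\<Sum>K\<in>T. (1 / t) * (LINT x|lborel. indicator {x \<in> K. x + t *\<^sub>R \<omega> \<notin> K} x + indicator {x. x \<notin> K \<and> x + t *\<^sub>R \<omega> \<in> K} x))" for t
    unfolding crossing_def
    by (subst Bochner_Integration.integral_sum)
      (auto simp: sum_distrib_left intro!: Bochner_Integration.integrable_add integrable_exit)
  moreover have "((\<lambda>t. \<Sum>K\<in>T. (1 / t) * (LINT x|lborel. indicator {x \<in> K. x + t *\<^sub>R \<omega> \<notin> K} x + indicator {x. x \<notin> K \<and> x + t *\<^sub>R \<omega> \<in> K} x)) \<longlongrightarrow> sum l T) (at_right 0)"
    using l by (intro tendsto_sum) blast
  ultimately have lim: "((\<lambda>t. (1 / t) * (LINT x|lborel. crossing \<omega> t x)) \<longlongrightarrow> sum l T) (at_right 0)"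
    by simp
  have "sum l T < \<bar>sum l T\<bar> + 1" by linarith
  from order_tendstoD(2)[OF lim this] show ?thesis
    by (intro exI[of _ "\<bar>sum l T\<bar> + 1"]) (auto elim!: eventually_mono)
qed

text \<open>By translation invariance both squares in the expanded difference have the same
  integral, so the mixed term alone determines the result.\<close>

lemma transport_square:
  assumes u: "u \<in> piecewise_C1 T"
  shows "2 * transport \<omega> u u t = (1 / t) * (LINT x|lborel. (u (x + t *\<^sub>R \<omega>) - u x)\<^sup>2)"
proof -
  note int = integrable_mult_shift[OF u u]
  note [measurable] = piecewise_C1_borel[OF u]
  let ?s = "t *\<^sub>R \<omega>"
  have sq: "(LINT x|lborel. u (x + ?s) * u (x + ?s)) = (LINT x|lborel. u x * u x)"
    by (rule integral_lborel_translate[of "\<lambda>x. u x * u x"]) measurable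
  have "(LINT x|lborel. (u (x + ?s) - u x)\<^sup>2)
      = (LINT x|lborel. u (x + ?s) * u (x + ?s) + u x * u x - 2 * (u x * u (x + ?s)))"
    by (intro Bochner_Integration.integral_cong refl) (simp add: power2_eq_square algebra_simps)
  also have "\<dots> = 2 * ((LINT x|lborel. u x * u x) - (LINT x|lborel. u x * u (x + ?s)))"
    using int[of 0 0] int[of 0 ?s] int[of ?s ?s] by (simp add: sq)
  also have "(LINT x|lborel. u x * u x) - (LINT x|lborel. u x * u (x + ?s)) = (LINT x|lborel. u x * (u x - u (x + ?s)))"
    using int[of 0 0] int[of 0 ?s] by (simp add: right_diff_distrib)
  finally show ?thesis
    by (simp add: transport_def)
qed

lemma transport_energy_nonneg:
  assumes u: "u \<in> piecewise_C1 T" and TD: "\<Union>T \<subseteq> D"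
  shows "(\<Sum>K\<in>T. cell_form D \<omega> K u u) \<ge> 0"
proof (rule tendsto_lowerbound[OF transport_limit[OF u u TD]])
  show "\<forall>\<^sub>F t in at_right 0. 0 \<le> transport \<omega> u u t"
    using eventually_at_right_less
  proof eventually_elim
    case (elim t)
    have "0 \<le> 2 * transport \<omega> u u t"
      unfolding transport_square[OF u] using elim by simp
    then show ?case by simp
  qed
qed simp

text \<open>The crossing count has integral \<open>O(t)\<close> and the squared difference has
  integral \<open>o(t)\<close>. A weighted form of the Cauchy-Schwarz estimate makes the integral of
  the product \<open>o(t)\<close>.\<close>

lemma crossing_difference_small:
  assumes u: "u \<in> piecewise_C1 T"
    and zero: "((\<lambda>t. (1 / t) * (LINT x|lborel. (u (x + t *\<^sub>R \<omega>) - u x)\<^sup>2)) \<longlongrightarrow> 0) (at_right 0)"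
  shows "((\<lambda>t. (1 / t) * (LINT x|lborel. crossing \<omega> t x * \<bar>u (x + t *\<^sub>R \<omega>) - u x\<bar>)) \<longlongrightarrow> 0) (at_right 0)"
proof (rule tendstoI)
  fix e :: real assume e: "e > 0"
  obtain C where C: "C > 0" "\<forall>\<^sub>F t in at_right 0. (1 / t) * (LINT x|lborel. crossing \<omega> t x) \<le> C"
    using crossing_measure_bound by blast
  \<comment> \<open>\<eta> and \<open>N\<close> are the weights in
    \<open>\<bar>d\<bar> \<le> \<eta> + d^2 / \<eta>\<close> after multiplication by the crossing
    count, which is at most \<open>2 * card T\<close>. One half of the tolerance \<open>e\<close> is
    spent on each of the two terms.\<close>
  define \<eta> where "\<eta> = e / (2 * C)"
  have \<eta>: "\<eta> > 0" using e C by (simp add: \<eta>_def)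
  define N where "N = 2 * real (card T) / \<eta>"
  have N: "N \<ge> 0" using \<eta> by (simp add: N_def)
  have "\<forall>\<^sub>F t in at_right 0. (1 / t) * (LINT x|lborel. (u (x + t *\<^sub>R \<omega>) - u x)\<^sup>2) < e / (2 * (N + 1))"
    by (rule order_tendstoD(2)[OF zero]) (use e N in simp)
  with C(2) show "\<forall>\<^sub>F t in at_right 0. dist ((1 / t) * (LINT x|lborel. crossing \<omega> t x * \<bar>u (x + t *\<^sub>R \<omega>) - u x\<bar>)) 0 < e"
    using eventually_at_right_less
  proof eventually_elim
    case (elim t)
    let ?d = "\<lambda>x. u (x + t *\<^sub>R \<omega>) - u x"
    note [measurable] = piecewise_C1_borel[OF u]
    note int = integrable_mult_shift[OF u u]
    have sq: "(?d x)\<^sup>2 = u (x + t *\<^sub>R \<omega>) * u (x + t *\<^sub>R \<omega>) + u (x + 0) * u (x + 0) - 2 * (u (x + 0) * u (x + t *\<^sub>R \<omega>))" for x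
      by (simp add: power2_eq_square algebra_simps)
    have isq: "integrable lborel (\<lambda>x. (?d x)\<^sup>2)"
      unfolding sq by (intro Bochner_Integration.integrable_add Bochner_Integration.integrable_diff integrable_mult_right int)
    have pw: "crossing \<omega> t x * \<bar>?d x\<bar> \<le> \<eta> * crossing \<omega> t x + N * (?d x)\<^sup>2" for x
    proof -
      have "\<eta> * a \<le> \<eta>\<^sup>2 + a\<^sup>2" if "a \<ge> 0" for a
      proof -
        have "0 \<le> (\<eta> - a)\<^sup>2" by simp
        then have "2 * (\<eta> * a) \<le> \<eta>\<^sup>2 + a\<^sup>2"
          by (simp add: power2_eq_square algebra_simps)
        moreover have "0 \<le> \<eta> * a"
          using \<eta> that by simp
        ultimately show ?thesis by linarith
      qed
      from this[of "\<bar>?d x\<bar>"] have "\<bar>?d x\<bar> \<le> \<eta> + (?d x)\<^sup>2 / \<eta>"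
        using \<eta> by (simp add: field_simps power2_eq_square)
      then have "crossing \<omega> t x * \<bar>?d x\<bar> \<le> crossing \<omega> t x * (\<eta> + (?d x)\<^sup>2 / \<eta>)"
        by (intro mult_left_mono crossing_nonneg)
      also have "\<dots> \<le> \<eta> * crossing \<omega> t x + 2 * real (card T) * ((?d x)\<^sup>2 / \<eta>)"
        using mult_right_mono[OF crossing_le[of \<omega> t x], of "(?d x)\<^sup>2 / \<eta>"] \<eta> by (simp add: algebra_simps)
      finally show ?thesis by (simp add: N_def)
    qed
    have bint: "integrable lborel (\<lambda>x. \<eta> * crossing \<omega> t x + N * (?d x)\<^sup>2)"
      using isq integrable_crossing by simp
    have "integrable lborel (\<lambda>x. crossing \<omega> t x * \<bar>?d x\<bar>)"
      by (rule Bochner_Integration.integrable_bound[OF bint])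
        (use pw crossing_nonneg in \<open>auto intro!: AE_I2 order_trans[OF pw abs_ge_self] simp: abs_mult\<close>)
    then have "(LINT x|lborel. crossing \<omega> t x * \<bar>?d x\<bar>) \<le> (LINT x|lborel. \<eta> * crossing \<omega> t x + N * (?d x)\<^sup>2)"
      using bint pw by (rule integral_mono)
    also have "\<dots> = \<eta> * (LINT x|lborel. crossing \<omega> t x) + N * (LINT x|lborel. (?d x)\<^sup>2)"
      using isq integrable_crossing by simp
    finally have "(1 / t) * (LINT x|lborel. crossing \<omega> t x * \<bar>?d x\<bar>)
        \<le> (1 / t) * (\<eta> * (LINT x|lborel. crossing \<omega> t x) + N * (LINT x|lborel. (?d x)\<^sup>2))"
      using elim by (intro mult_left_mono) auto
    also have "\<dots> = \<eta> * ((1 / t) * (LINT x|lborel. crossing \<omega> t x)) + N * ((1 / t) * (LINT x|lborel. (?d x)\<^sup>2))"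
      by (simp add: algebra_simps)
    also have "\<dots> \<le> \<eta> * C + N * (e / (2 * (N + 1)))"
      using elim \<eta> N by (intro add_mono mult_left_mono) auto
    also have "\<dots> < e"
    proof -
      have "\<eta> * C = e / 2" using C by (simp add: \<eta>_def)
      moreover have "N * (e / (2 * (N + 1))) < e / 2"
        using N e by (simp add: field_simps)
      ultimately show ?thesis by linarith
    qed
    finally have "(1 / t) * (LINT x|lborel. crossing \<omega> t x * \<bar>?d x\<bar>) < e" .
    moreover have "(1 / t) * (LINT x|lborel. crossing \<omega> t x * \<bar>?d x\<bar>) \<ge> 0"
      using elim crossing_nonneg by (intro mult_nonneg_nonneg integral_nonneg_AE AE_I2) auto
    ultimately show ?case by simp
  qed
qed

text \<open>The shift by \<open>s\<close> is divided into \<open>n + 1\<close> steps of length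
  \<open>t\<close>. Inside a cell a step changes \<open>u\<close> by at most \<open>M * t\<close>;
  the crossings of one step cost at most \<open>r t\<close>, an integral over the whole space that
  depends neither on \<open>A\<close> nor on the position of the step. As \<open>r t\<close> is
  \<open>o(t)\<close>, the total cost of the crossings tends to 0 when \<open>n\<close>
  grows.\<close>

lemma difference_integral_bound:
  assumes u: "u \<in> piecewise_C1 T" and TD: "\<Union>T \<subseteq> D"
    and zero: "(\<Sum>K\<in>T. cell_form D \<omega> K u u) = 0"
  shows "\<exists>M\<ge>0. \<forall>s\<ge>0. \<forall>A\<in>sets borel. bounded A \<longrightarrow>
    (LINT x|lborel. indicator A x * \<bar>u (x + s *\<^sub>R \<omega>) - u x\<bar>) \<le> M * s * measure lborel A"
proof -
  note [measurable] = piecewise_C1_borel[OF u]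
  obtain L where L: "L \<ge> 0" "\<And>K x y. K \<in> T \<Longrightarrow> x \<in> K \<Longrightarrow> y \<in> K \<Longrightarrow> \<bar>u x - u y\<bar> \<le> L * norm (x - y)"
    by (rule piecewise_C1_lipschitz[OF u]) blast
  define M where "M = L * norm \<omega>"
  have M: "M \<ge> 0" using L by (simp add: M_def)
  define r where "r t = (LINT x|lborel. crossing \<omega> t x * \<bar>u (x + t *\<^sub>R \<omega>) - u x\<bar>)" for t
  have "((\<lambda>t. 2 * transport \<omega> u u t) \<longlongrightarrow> 2 * 0) (at_right 0)"
    using transport_limit[OF u u TD, of \<omega>] zero by (intro tendsto_intros) simp
  then have "((\<lambda>t. (1 / t) * (LINT x|lborel. (u (x + t *\<^sub>R \<omega>) - u x)\<^sup>2)) \<longlongrightarrow> 0) (at_right 0)"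
    unfolding transport_square[OF u] by simp
  then have r: "((\<lambda>t. (1 / t) * r t) \<longlongrightarrow> 0) (at_right 0)"
    unfolding r_def by (rule crossing_difference_small[OF u])
  have du: "integrable lborel (\<lambda>x. \<bar>u (x + b) - u (x + c)\<bar>)" for b c
    using integrable_shift[OF u] by (intro integrable_abs Bochner_Integration.integrable_diff)
  have pw: "\<bar>u (x + t *\<^sub>R \<omega>) - u x\<bar> \<le> M * t + crossing \<omega> t x * \<bar>u (x + t *\<^sub>R \<omega>) - u x\<bar>" if "t > 0" for t x
  proof (cases "\<exists>K\<in>T. (x \<in> K) \<noteq> (x + t *\<^sub>R \<omega> \<in> K)")
    case True
    then have "1 * \<bar>u (x + t *\<^sub>R \<omega>) - u x\<bar> \<le> crossing \<omega> t x * \<bar>u (x + t *\<^sub>R \<omega>) - u x\<bar>"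
      using crossing_ge_1 by (intro mult_right_mono) auto
    then show ?thesis using M that by (intro add_increasing) auto
  next
    case False
    have "\<bar>u (x + t *\<^sub>R \<omega>) - u x\<bar> \<le> M * t"
    proof (cases "x \<in> \<Union>T")
      case True
      then obtain K where K: "K \<in> T" "x \<in> K" by blast
      with False have "x + t *\<^sub>R \<omega> \<in> K" by blast
      from L(2)[OF K(1) this K(2)] show ?thesis
        using that by (simp add: M_def mult.assoc mult.commute mult.left_commute)
    next
      case outside: False
      with False have "x + t *\<^sub>R \<omega> \<notin> \<Union>T" by blast
      then show ?thesis
        using outside M that by (simp add: piecewise_C1_zero[OF u])
    qed
    moreover have "0 \<le> crossing \<omega> t x * \<bar>u (x + t *\<^sub>R \<omega>) - u x\<bar>"
      by (intro mult_nonneg_nonneg crossing_nonneg) simp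
    ultimately show ?thesis by (rule add_increasing2[rotated])
  qed
  \<comment> \<open>Translation moves the step with number \<open>k\<close> to the first one and
    \<open>A\<close> to a set of the same measure.\<close>
  have step: "(LINT x|lborel. indicator A x * \<bar>u (x + (real (Suc k) * t) *\<^sub>R \<omega>) - u (x + (real k * t) *\<^sub>R \<omega>)\<bar>)
      \<le> M * t * measure lborel A + r t"
    if t: "t > 0" and A[measurable]: "A \<in> sets borel" and bA: "bounded A" for t A k
  proof -
    let ?c = "(real k * t) *\<^sub>R \<omega>"
    have fin: "emeasure lborel A < \<infinity>"
      using bA by (rule emeasure_bounded_finite)
    have icr: "integrable lborel (\<lambda>x. crossing \<omega> t x * \<bar>u (x + t *\<^sub>R \<omega>) - u x\<bar>)"
    proof (rule Bochner_Integration.integrable_bound)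
      show "integrable lborel (\<lambda>x. 2 * real (card T) * \<bar>u (x + t *\<^sub>R \<omega>) - u (x + 0)\<bar>)"
        by (intro integrable_mult_right du)
      show "AE x in lborel. norm (crossing \<omega> t x * \<bar>u (x + t *\<^sub>R \<omega>) - u x\<bar>) \<le> norm (2 * real (card T) * \<bar>u (x + t *\<^sub>R \<omega>) - u (x + 0)\<bar>)"
        using crossing_le crossing_nonneg by (intro AE_I2) (auto simp: abs_mult intro!: mult_right_mono)
    qed measurable
    have "(LINT x|lborel. indicator A x * \<bar>u (x + (real (Suc k) * t) *\<^sub>R \<omega>) - u (x + ?c)\<bar>)
        = (LINT x|lborel. indicator A (x + ?c - ?c) * \<bar>u (x + ?c + t *\<^sub>R \<omega>) - u (x + ?c)\<bar>)"
      by (intro Bochner_Integration.integral_cong refl) (simp add: algebra_simps)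
    also have "\<dots> = (LINT x|lborel. indicator A (x - ?c) * \<bar>u (x + t *\<^sub>R \<omega>) - u x\<bar>)"
      by (rule integral_lborel_translate[of "\<lambda>x. indicator A (x - ?c) * \<bar>u (x + t *\<^sub>R \<omega>) - u x\<bar>"]) measurable
    also have "\<dots> \<le> (LINT x|lborel. M * t * indicator A (x + (- ?c)) + crossing \<omega> t x * \<bar>u (x + t *\<^sub>R \<omega>) - u x\<bar>)"
    proof (rule integral_mono)
      have "integrable lborel (\<lambda>x. indicator A (x + (- ?c)) :: real)"
      proof -
        have "bounded ((\<lambda>x. ?c + x) ` A)"
          using bA by (rule bounded_translation)
        then show ?thesis
          by (rule integrable_lborel_bounded[rotated 2, where M = 1])
            (measurable, auto simp: indicator_def image_iff intro!: bexI[of _ "_ - ?c"])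
      qed
      then show "integrable lborel (\<lambda>x. M * t * indicator A (x + (- ?c)) + crossing \<omega> t x * \<bar>u (x + t *\<^sub>R \<omega>) - u x\<bar>)"
        using icr by (intro Bochner_Integration.integrable_add integrable_mult_right)
      show "integrable lborel (\<lambda>x. indicator A (x - ?c) * \<bar>u (x + t *\<^sub>R \<omega>) - u x\<bar>)"
        using du[of "t *\<^sub>R \<omega>" 0]
        by (rule Bochner_Integration.integrable_bound) (measurable, auto simp: indicator_def intro!: AE_I2)
      show "indicator A (x - ?c) * \<bar>u (x + t *\<^sub>R \<omega>) - u x\<bar>
          \<le> M * t * indicator A (x + (- ?c)) + crossing \<omega> t x * \<bar>u (x + t *\<^sub>R \<omega>) - u x\<bar>" for x
        using pw[OF t, of x] crossing_nonneg[of \<omega> t x] by (auto simp: indicator_def)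
    qed
    also have "\<dots> = M * t * (LINT x|lborel. indicator A (x + (- ?c))) + r t"
    proof -
      have "integrable lborel (\<lambda>x. indicator A (x + (- ?c)) :: real)"
      proof -
        have "bounded ((\<lambda>x. ?c + x) ` A)"
          using bA by (rule bounded_translation)
        then show ?thesis
          by (rule integrable_lborel_bounded[rotated 2, where M = 1])
            (measurable, auto simp: indicator_def image_iff intro!: bexI[of _ "_ - ?c"])
      qed
      then show ?thesis
        unfolding r_def using icr by (subst Bochner_Integration.integral_add) auto
    qed
    also have "(LINT x|lborel. indicator A (x + (- ?c)) :: real) = measure lborel A"
      by (subst integral_lborel_translate) auto
    finally show ?thesis .
  qed
  show ?thesis
  proof (intro exI[of _ M] conjI allI impI ballI M)
    fix s :: real and A :: "(real^'d) set"
    assume s: "s \<ge> 0" and A[measurable]: "A \<in> sets borel" and bA: "bounded A"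
    show "(LINT x|lborel. indicator A x * \<bar>u (x + s *\<^sub>R \<omega>) - u x\<bar>) \<le> M * s * measure lborel A"
    proof (cases "s = 0")
      case False
      with s have s: "s > 0" by simp
      have iA: "integrable lborel (\<lambda>x. indicator A x * \<bar>u (x + b) - u (x + c)\<bar>)" for b c
        using du[of b c]
        by (rule Bochner_Integration.integrable_bound) (measurable, auto simp: indicator_def intro!: AE_I2)
      have "(LINT x|lborel. indicator A x * \<bar>u (x + s *\<^sub>R \<omega>) - u x\<bar>)
          \<le> M * s * measure lborel A + s * ((1 / (s / real (Suc n))) * r (s / real (Suc n)))" for n
      proof -
        define t where "t = s / real (Suc n)"
        have t: "t > 0" and nt: "real (Suc n) * t = s"
          using s by (auto simp: t_def)
        let ?v = "\<lambda>k x. u (x + (real k * t) *\<^sub>R \<omega>)"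
        have "(LINT x|lborel. indicator A x * \<bar>u (x + s *\<^sub>R \<omega>) - u x\<bar>)
          \<le> (LINT x|lborel. (\<Sum>k<Suc n. indicator A x * \<bar>?v (Suc k) x - ?v k x\<bar>))"
        proof (rule integral_mono)
          show "integrable lborel (\<lambda>x. indicator A x * \<bar>u (x + s *\<^sub>R \<omega>) - u x\<bar>)"
            using iA[of "s *\<^sub>R \<omega>" 0] by simp
          show "integrable lborel (\<lambda>x. \<Sum>k<Suc n. indicator A x * \<bar>?v (Suc k) x - ?v k x\<bar>)"
            by (intro Bochner_Integration.integrable_sum iA)
          show "indicator A x * \<bar>u (x + s *\<^sub>R \<omega>) - u x\<bar> \<le> (\<Sum>k<Suc n. indicator A x * \<bar>?v (Suc k) x - ?v k x\<bar>)" for x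
          proof -
            have "u (x + s *\<^sub>R \<omega>) - u x = (\<Sum>k<Suc n. ?v (Suc k) x - ?v k x)"
              unfolding sum_lessThan_telescope[of "\<lambda>k. ?v k x"] nt by simp
            then have "\<bar>u (x + s *\<^sub>R \<omega>) - u x\<bar> \<le> (\<Sum>k<Suc n. \<bar>?v (Suc k) x - ?v k x\<bar>)"
              by (simp only: sum_abs)
            then show ?thesis
              unfolding sum_distrib_left[symmetric] by (intro mult_left_mono) auto
          qed
        qed
        also have "\<dots> = (\<Sum>k<Suc n. (LINT x|lborel. indicator A x * \<bar>?v (Suc k) x - ?v k x\<bar>))"
          by (intro Bochner_Integration.integral_sum iA)
        also have "\<dots> \<le> (\<Sum>k<Suc n. M * t * measure lborel A + r t)"
          by (intro sum_mono step t A bA)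
        also have "\<dots> = M * (real (Suc n) * t) * measure lborel A + real (Suc n) * r t"
          by (simp add: algebra_simps)
        also have "real (Suc n) * r t = s * ((1 / t) * r t)"
          using t by (simp add: nt[symmetric] field_simps)
        finally show ?thesis
          by (simp only: nt) (simp add: t_def)
      qed
      moreover have "(\<lambda>n. M * s * measure lborel A + s * ((1 / (s / real (Suc n))) * r (s / real (Suc n)))) \<longlonglongrightarrow> M * s * measure lborel A + s * 0"
      proof (intro tendsto_intros filterlim_compose[OF r])
        have "(\<lambda>n. s * inverse (real (Suc n))) \<longlonglongrightarrow> s * 0"
          by (intro tendsto_intros LIMSEQ_inverse_real_of_nat)
        then show "filterlim (\<lambda>n. s / real (Suc n)) (at_right 0) sequentially"
          using s by (simp add: filterlim_at divide_inverse)
      qed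
      ultimately show ?thesis
        by (intro LIMSEQ_le_const) auto
    qed simp
  qed
qed

end

text \<open>From a boundary point, moving down along \<open>n\<close> leads below the graph of
  \<gamma>, into the exterior. Thus \<open>D\<close> has no slits, and the zero extension sees the
  boundary values from outside.\<close>

lemma lipschitz_domain_frontier:
  assumes "lipschitz_domain D"
  shows "frontier D \<subseteq> closure (- closure D)"
proof
  fix x assume x: "x \<in> frontier D"
  have "open D" using assms by (simp add: lipschitz_domain_def)
  then have "x \<notin> D"
    using x by (simp add: frontier_def interior_open)
  obtain r n \<gamma> L where r: "r > 0" and n: "norm n = 1" and \<gamma>: "L-lipschitz_on UNIV \<gamma>"
    and D: "D \<inter> ball x r = {y \<in> ball x r. \<gamma> (y - (y \<bullet> n) *\<^sub>R n) < y \<bullet> n}"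
    using assms x unfolding lipschitz_domain_def by blast
  have nn: "n \<bullet> n = 1" using n by (simp add: norm_eq_1)
  have cont: "continuous_on UNIV \<gamma>"
    using \<gamma> by (rule lipschitz_on_continuous_on)
  define U where "U = ball x r \<inter> {y. y \<bullet> n < \<gamma> (y - (y \<bullet> n) *\<^sub>R n)}"
  have "open U"
    unfolding U_def by (intro open_Int open_ball open_Collect_less continuous_intros continuous_on_compose2[OF cont]) auto
  moreover have "U \<inter> D = {}"
  proof (rule equals0I)
    fix y assume y: "y \<in> U \<inter> D"
    then have "y \<in> D \<inter> ball x r" by (simp add: U_def)
    then have "\<gamma> (y - (y \<bullet> n) *\<^sub>R n) < y \<bullet> n" unfolding D by simp
    then show False using y by (simp add: U_def)
  qed
  ultimately have U: "U \<subseteq> - closure D"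
    using open_Int_closure_eq_empty[of U D] by blast
  have "\<gamma> (x - (x \<bullet> n) *\<^sub>R n) \<ge> x \<bullet> n"
    using D r \<open>x \<notin> D\<close> by force
  then have mem: "x - s *\<^sub>R n \<in> U" if "0 < s" "s < r" for s
    using that n by (simp add: U_def dist_norm inner_simps nn algebra_simps)
  show "x \<in> closure (- closure D)"
  proof (rule closure_approachable[THEN iffD2], intro allI impI)
    fix e :: real assume e: "e > 0"
    define s where "s = min e r / 2"
    have "0 < s" "s < r" "s < e" using e r by (auto simp: s_def)
    then show "\<exists>y\<in>- closure D. dist y x < e"
      using mem[of s] U n by (intro bexI[of _ "x - s *\<^sub>R n"]) (auto simp: dist_norm)
  qed
qed

text \<open>The integrated form of \<open>\<bar>u (x + h) - u x\<bar> \<le> B\<close> almost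
  everywhere. It can be added over increments without keeping track of exceptional sets.\<close>

definition mean_difference_bound :: "(real^'d \<Rightarrow> real) \<Rightarrow> real^'d \<Rightarrow> real \<Rightarrow> bool" where
  "mean_difference_bound u h B \<longleftrightarrow> (\<forall>A\<in>sets borel. bounded A \<longrightarrow>
    (LINT x|lborel. indicator A x * \<bar>u (x + h) - u x\<bar>) \<le> B * measure lborel A)"

lemma mean_difference_bound_mono:
  fixes u :: "real^'d \<Rightarrow> real"
  assumes "mean_difference_bound u h B" "B \<le> C"
  shows "mean_difference_bound u h C"
  unfolding mean_difference_bound_def
proof (intro ballI impI)
  fix A :: "(real^'d) set" assume "A \<in> sets borel" "bounded A"
  then have "(LINT x|lborel. indicator A x * \<bar>u (x + h) - u x\<bar>) \<le> B * measure lborel A"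
    using assms(1) by (simp add: mean_difference_bound_def)
  also have "\<dots> \<le> C * measure lborel A"
    using assms(2) by (intro mult_right_mono) auto
  finally show "(LINT x|lborel. indicator A x * \<bar>u (x + h) - u x\<bar>) \<le> C * measure lborel A" .
qed

lemma measure_lborel_translate:
  fixes A :: "(real^'d) set"
  assumes [measurable]: "A \<in> sets borel"
  shows "measure lborel {x. x + c \<in> A} = measure lborel A" "{x. x + c \<in> A} \<in> sets borel"
    "bounded A \<Longrightarrow> bounded {x. x + c \<in> A}"
proof -
  show m[measurable]: "{x. x + c \<in> A} \<in> sets borel"
    by measurable
  have "measure lborel {x. x + c \<in> A} = (LINT x|lborel. indicator {x. x + c \<in> A} x)"
    by simp
  also have "\<dots> = (LINT x|lborel. indicator A (x + c))"
    by (intro Bochner_Integration.integral_cong) (auto simp: indicator_def)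
  also have "\<dots> = measure lborel A"
    by (subst integral_lborel_translate) auto
  finally show "measure lborel {x. x + c \<in> A} = measure lborel A" .
  assume "bounded A"
  then have "bounded ((\<lambda>x. - c + x) ` A)"
    by (rule bounded_translation)
  moreover have "{x. x + c \<in> A} = (\<lambda>x. - c + x) ` A"
    by (auto simp: image_iff intro!: bexI[of _ "_ + c"])
  ultimately show "bounded {x. x + c \<in> A}" by simp
qed

section \<open>Addition of mean difference bounds and their pointwise meaning\<close>

context polytopal_mesh
begin

lemma integrable_indicator_difference:
  assumes u: "u \<in> piecewise_C1 T" and [measurable]: "A \<in> sets borel"
  shows "integrable lborel (\<lambda>x. indicator A x * \<bar>u (x + b) - u (x + c)\<bar>)"
proof -
  note [measurable] = piecewise_C1_borel[OF u]
  have "integrable lborel (\<lambda>x. \<bar>u (x + b) - u (x + c)\<bar>)"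
    using integrable_shift[OF u] by (intro integrable_abs Bochner_Integration.integrable_diff)
  then show ?thesis
    by (rule Bochner_Integration.integrable_bound) (measurable, auto simp: indicator_def intro!: AE_I2)
qed

lemma mean_difference_bound_shifted:
  assumes u: "u \<in> piecewise_C1 T" and "mean_difference_bound u h B" and [measurable]: "A \<in> sets borel" and "bounded A"
  shows "(LINT x|lborel. indicator A x * \<bar>u (x + c + h) - u (x + c)\<bar>) \<le> B * measure lborel A"
proof -
  note [measurable] = piecewise_C1_borel[OF u]
  have "(LINT x|lborel. indicator A x * \<bar>u (x + c + h) - u (x + c)\<bar>)
      = (LINT x|lborel. indicator A (x + c + - c) * \<bar>u (x + c + h) - u (x + c)\<bar>)"
    by simp
  also have "\<dots> = (LINT x|lborel. indicator A (x + - c) * \<bar>u (x + h) - u x\<bar>)"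
    by (rule integral_lborel_translate[of "\<lambda>x. indicator A (x + - c) * \<bar>u (x + h) - u x\<bar>"]) measurable
  also have "\<dots> = (LINT x|lborel. indicator {x. x + - c \<in> A} x * \<bar>u (x + h) - u x\<bar>)"
    by (intro Bochner_Integration.integral_cong) (auto simp: indicator_def)
  also have "\<dots> \<le> B * measure lborel {x. x + - c \<in> A}"
    using assms(2,4) measure_lborel_translate(2,3)[of A "- c"] unfolding mean_difference_bound_def by auto
  finally show ?thesis
    by (simp add: measure_lborel_translate(1)[of A "- c", simplified])
qed

lemma mean_difference_bound_add:
  assumes u: "u \<in> piecewise_C1 T" and h: "mean_difference_bound u h B" and k: "mean_difference_bound u k C"
  shows "mean_difference_bound u (h + k) (B + C)"
  unfolding mean_difference_bound_def
proof (intro ballI impI)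
  fix A :: "(real^'d) set" assume A: "A \<in> sets borel" "bounded A"
  note int = integrable_indicator_difference[OF u A(1)]
  have "(LINT x|lborel. indicator A x * \<bar>u (x + (h + k)) - u x\<bar>)
      \<le> (LINT x|lborel. indicator A x * \<bar>u (x + (h + k)) - u (x + h)\<bar> + indicator A x * \<bar>u (x + h) - u x\<bar>)"
  proof (rule integral_mono)
    show "integrable lborel (\<lambda>x. indicator A x * \<bar>u (x + (h + k)) - u x\<bar>)"
      using int[of "h + k" 0] by simp
    show "integrable lborel (\<lambda>x. indicator A x * \<bar>u (x + (h + k)) - u (x + h)\<bar> + indicator A x * \<bar>u (x + h) - u x\<bar>)"
      using int[of "h + k" h] int[of h 0] by (intro Bochner_Integration.integrable_add) simp_all
  qed (auto simp: indicator_def)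
  also have "\<dots> = (LINT x|lborel. indicator A x * \<bar>u (x + (h + k)) - u (x + h)\<bar>) + (LINT x|lborel. indicator A x * \<bar>u (x + h) - u x\<bar>)"
    using int[of "h + k" h] int[of h 0] by (intro Bochner_Integration.integral_add) simp_all
  also have "\<dots> \<le> C * measure lborel A + B * measure lborel A"
    using mean_difference_bound_shifted[OF u k A, of h] mean_difference_bound_shifted[OF u h A, of 0]
    by (intro add_mono) (simp_all add: add.assoc)
  finally show "(LINT x|lborel. indicator A x * \<bar>u (x + (h + k)) - u x\<bar>) \<le> (B + C) * measure lborel A"
    by (simp add: algebra_simps)
qed

lemma mean_difference_bound_minus:
  assumes u: "u \<in> piecewise_C1 T" and h: "mean_difference_bound u h B"
  shows "mean_difference_bound u (- h) B"
  unfolding mean_difference_bound_def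
proof (intro ballI impI)
  fix A :: "(real^'d) set" assume A: "A \<in> sets borel" "bounded A"
  then show "(LINT x|lborel. indicator A x * \<bar>u (x + - h) - u x\<bar>) \<le> B * measure lborel A"
    using mean_difference_bound_shifted[OF u h A, of "- h"] by (simp add: abs_minus_commute)
qed

lemma mean_difference_bound_sum:
  assumes u: "u \<in> piecewise_C1 T" and "finite I" and "\<And>i. i \<in> I \<Longrightarrow> mean_difference_bound u (h i) (B i)"
  shows "mean_difference_bound u (sum h I) (sum B I)"
  using assms(2,3)
proof (induction I rule: finite_induct)
  case empty
  then show ?case by (simp add: mean_difference_bound_def)
qed (simp add: mean_difference_bound_add[OF u])

text \<open>If the bound failed at points of continuity, the difference would exceed some
  \<open>c > B\<close> on a small ball around \<open>x\<close>, against the bound for that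
  ball.\<close>

lemma mean_difference_bound_pointwise:
  assumes u: "u \<in> piecewise_C1 T" and h: "mean_difference_bound u h B"
    and cont: "isCont u x" "isCont u (x + h)"
  shows "\<bar>u (x + h) - u x\<bar> \<le> B"
proof (rule ccontr)
  assume "\<not> \<bar>u (x + h) - u x\<bar> \<le> B"
  then obtain c where c: "B < c" "c < \<bar>u (x + h) - u x\<bar>"
    using dense[of B "\<bar>u (x + h) - u x\<bar>"] unfolding not_le by blast
  define F where "F = (\<lambda>y. \<bar>u (y + h) - u y\<bar>)"
  have "isCont F x"
    unfolding F_def
  proof -
    have "isCont (\<lambda>y. u (y + h)) x"
      by (rule isCont_o2[of x "\<lambda>y. y + h" u]) (use cont(2) in auto)
    then show "isCont (\<lambda>y. \<bar>u (y + h) - u y\<bar>) x"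
      using cont(1) by (intro continuous_rabs continuous_diff)
  qed
  then have "\<forall>\<^sub>F y in nhds x. c < \<bar>u (y + h) - u y\<bar>"
    using order_tendstoD(1)[of F "F x" "nhds x" c] c(2)
    by (simp add: isCont_def tendsto_at_iff_tendsto_nhds) (simp add: F_def)
  then obtain r where r: "r > 0" "\<And>y. dist y x < r \<Longrightarrow> c < \<bar>u (y + h) - u y\<bar>"
    by (auto simp: eventually_nhds_metric)
  let ?A = "ball x r"
  have pos: "measure lborel ?A > 0"
    using r(1) by (simp add: content_ball_pos)
  have "c * measure lborel ?A = (LINT y|lborel. indicator ?A y * c)"
    by simp
  also have "\<dots> \<le> (LINT y|lborel. indicator ?A y * \<bar>u (y + h) - u y\<bar>)"
  proof (rule integral_mono)
    show "integrable lborel (\<lambda>y. indicator ?A y * c)"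
      by (intro integrable_lborel_bounded[where B = ?A and M = "\<bar>c\<bar>"]) (auto simp: indicator_def)
    show "integrable lborel (\<lambda>y. indicator ?A y * \<bar>u (y + h) - u y\<bar>)"
      using integrable_indicator_difference[OF u, of ?A h 0] by simp
    show "indicator ?A y * c \<le> indicator ?A y * \<bar>u (y + h) - u y\<bar>" for y
      using r(2)[of y] by (auto simp: indicator_def dist_commute)
  qed
  also have "\<dots> \<le> B * measure lborel ?A"
    using h by (simp add: mean_difference_bound_def)
  finally show False
    using c(1) pos by simp
qed

lemma isCont_cell:
  assumes "u \<in> piecewise_C1 T" "K \<in> T" "x \<in> K"
  shows "isCont u x"
proof -
  obtain g where "(u has_derivative (\<lambda>h. g x \<bullet> h)) (at x)"
    using piecewise_C1_derivative[OF assms(1,2)] assms(3) by blast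
  then show ?thesis
    by (rule has_derivative_continuous)
qed

end

section \<open>Continuous extensions and the transport form with a continuous argument\<close>

locale domain_mesh = polytopal_mesh T for T :: "(real^'d) set set" +
  fixes D :: "(real^'d) set"
  assumes open_D: "open D" and bounded_D: "bounded D"
    and cells_subset: "\<Union>T \<subseteq> D" and cover: "D \<subseteq> (\<Union>K\<in>T. closure K)"
    and frontier_D: "frontier D \<subseteq> closure (- closure D)"
begin

lemma closure_D_subset: "closure D \<subseteq> (\<Union>K\<in>T. closure K)"
  using cover finite_T by (intro closure_minimal closed_UN) auto

lemma AE_in_cells: "AE x in lborel. x \<in> D \<longrightarrow> x \<in> \<Union>T"
proof -
  have "negligible (\<Union>K\<in>T. frontier K)"
    using finite_T convex_cell by (intro negligible_Union) (auto intro: negligible_convex_frontier)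
  moreover have "(\<Union>K\<in>T. frontier K) \<in> sets borel"
    using finite_T by (intro borel_closed closed_UN) auto
  ultimately have "AE x in lborel. x \<notin> (\<Union>K\<in>T. frontier K)"
    by (rule AE_lborel_not_in_negligible)
  then show ?thesis
  proof eventually_elim
    case (elim x)
    show ?case
    proof
      assume "x \<in> D"
      then obtain K where K: "K \<in> T" "x \<in> closure K"
        using cover by blast
      then have "x \<in> K"
        using elim open_cell[OF K(1)] by (auto simp: frontier_def interior_open)
      then show "x \<in> \<Union>T" using K by blast
    qed
  qed
qed

text \<open>The extension of \<open>u\<close> by zero is a function on the whole space, so the condition on the mean
  differences also controls the trace of \<open>u\<close> on the boundary of \<open>D\<close>.\<close>

lemma continuous_extension:
  assumes u: "u \<in> piecewise_C1 T" and M: "\<And>h. mean_difference_bound u h (M * norm h)" "M \<ge> 0"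
  shows "\<exists>g. continuous_on (closure D) g \<and> (\<forall>x\<in>\<Union>T. u x = g x) \<and> (\<forall>x\<in>frontier D. g x = 0)"
proof -
  \<comment> \<open>The open cells together with the exterior of \<open>D\<close>: a dense set on
    which \<open>u\<close> is continuous. The pointwise bounds make \<open>u\<close> Lipschitz on
    it, and a Lipschitz function extends to the closure.\<close>
  define U where "U = \<Union>T \<union> (- closure D)"
  have zero: "u x = 0" if "x \<notin> D" for x
    using that cells_subset piecewise_C1_zero[OF u] by blast
  have cont: "isCont u x" if x: "x \<in> U" for x
  proof (cases "x \<in> \<Union>T")
    case True
    then show ?thesis using isCont_cell[OF u] by blast
  next
    case False
    then have "x \<in> - closure D" using x by (auto simp: U_def)
    moreover have "open (- closure D)" by (rule open_Compl[OF closed_closure])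
    ultimately have "\<forall>\<^sub>F y in nhds x. y \<in> - closure D"
      by (intro eventually_nhds_in_open)
    then have "\<forall>\<^sub>F y in nhds x. u y = 0"
      by eventually_elim (use zero closure_subset in blast)
    then show ?thesis
      by (subst isCont_cong[where g = "\<lambda>_. 0"]) auto
  qed
  have "M-lipschitz_on U u"
  proof (rule lipschitz_onI)
    fix x y assume xy: "x \<in> U" "y \<in> U"
    have "\<bar>u (x + (y - x)) - u x\<bar> \<le> M * norm (y - x)"
      by (rule mean_difference_bound_pointwise[OF u M(1)]) (use cont xy in auto)
    then show "dist (u x) (u y) \<le> M * dist x y"
      by (simp add: dist_norm norm_minus_commute abs_minus_commute)
  qed (rule M(2))
  then obtain g where g: "M-lipschitz_on (closure U) g" "\<forall>x\<in>U. g x = u x"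
    using lipschitz_extend_closure by blast
  have "closure U = UNIV"
  proof -
    have "closure D \<subseteq> closure (\<Union>T)"
      by (rule subset_trans[OF closure_D_subset]) (intro UN_least closure_mono Union_upper)
    then show ?thesis
      using closure_subset[of U] closure_mono[of "\<Union>T" U] unfolding U_def by blast
  qed
  then have cg: "continuous_on UNIV g"
    using g(1) lipschitz_on_continuous_on by metis
  \<comment> \<open>The extension is 0 on the exterior, hence on its closure, which contains the
    boundary of \<open>D\<close>.\<close>
  have "g x = 0" if "x \<in> frontier D" for x
  proof -
    have "closure (- closure D) \<subseteq> {x. g x = 0}"
    proof (rule closure_minimal)
      show "- closure D \<subseteq> {x. g x = 0}"
      proof
        fix x assume "x \<in> - closure D"
        then have "x \<in> U" "x \<notin> D"
          using closure_subset by (auto simp: U_def)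
        then show "x \<in> {x. g x = 0}"
          using g(2) zero by simp
      qed
      show "closed {x. g x = 0}"
        using cg by (intro closed_Collect_eq) auto
    qed
    then show ?thesis using frontier_D that by blast
  qed
  moreover have "continuous_on (closure D) g"
    using cg by (rule continuous_on_subset) simp
  ultimately show ?thesis
    using g(2) by (intro exI[of _ g]) (auto simp: U_def)
qed

definition continuous_zero :: "(real^'d \<Rightarrow> real) \<Rightarrow> bool" where
  "continuous_zero v \<longleftrightarrow>
     (\<exists>g. continuous_on (closure D) g \<and> (\<forall>x\<in>\<Union>T. v x = g x) \<and> (\<forall>x\<in>frontier D. g x = 0))"

text \<open>The continuous representative, extended by zero, is Lipschitz with one constant on each
  closed cell and on the complement of \<open>D\<close>. These finitely many closed sets cover every
  segment, so the constant holds along the segment and thus between its end points.\<close>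

lemma lipschitz_extension:
  assumes v: "v \<in> piecewise_C1 T" and "continuous_zero v"
  obtains g M where "M-lipschitz_on UNIV g" "\<And>x. x \<in> \<Union>T \<Longrightarrow> v x = g x" "\<And>x. x \<notin> D \<Longrightarrow> g x = 0"
proof -
  obtain f where f: "continuous_on (closure D) f" "\<And>x. x \<in> \<Union>T \<Longrightarrow> v x = f x" "\<And>x. x \<in> frontier D \<Longrightarrow> f x = 0"
    using assms(2) by (auto simp: continuous_zero_def)
  obtain L where L: "L \<ge> 0" "\<And>K x y. K \<in> T \<Longrightarrow> x \<in> K \<Longrightarrow> y \<in> K \<Longrightarrow> \<bar>v x - v y\<bar> \<le> L * norm (x - y)"
    by (rule piecewise_C1_lipschitz[OF v]) blast
  define g where "g = (\<lambda>x. if x \<in> closure D then f x else 0)"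
  have cg: "continuous_on UNIV g"
  proof -
    have "continuous_on (closure D \<union> - D) g"
      unfolding g_def
    proof (rule continuous_on_cases)
      show "\<forall>x. x \<in> closure D \<and> x \<notin> closure D \<or> x \<in> - D \<and> x \<in> closure D \<longrightarrow> f x = 0"
        using f(3) open_D by (auto simp: frontier_def interior_open)
    qed (use f(1) open_D in auto)
    moreover have "closure D \<union> - D = UNIV"
      using closure_subset by blast
    ultimately show ?thesis by simp
  qed
  have gT: "v x = g x" if "x \<in> \<Union>T" for x
  proof -
    have "x \<in> closure D"
      using that cells_subset closure_subset[of D] by blast
    then show ?thesis
      using f(2)[OF that] by (simp add: g_def)
  qed
  have gD: "g x = 0" if "x \<notin> D" for x
    using that f(3)[of x] open_D by (simp add: g_def frontier_def interior_open)
  have cell: "L-lipschitz_on (closure K) g" if K: "K \<in> T" for K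
  proof (rule lipschitz_on_closure)
    show "L-lipschitz_on K g"
    proof (rule lipschitz_onI)
      show "dist (g x) (g y) \<le> L * dist x y" if "x \<in> K" "y \<in> K" for x y
      proof -
        have "v x = g x" "v y = g y"
          using gT K that by blast+
        then show ?thesis
          using L(2)[OF K that] by (simp add: dist_norm)
      qed
    qed (rule L(1))
    show "continuous_on (closure K) g"
      using cg by (rule continuous_on_subset) simp
  qed
  have "L-lipschitz_on UNIV g"
  proof (rule lipschitz_onI)
    fix x y :: "real^'d"
    define \<gamma> where "\<gamma> = (\<lambda>s::real. x + s *\<^sub>R (y - x))"
    define U where "U = (\<lambda>S. \<gamma> -` S)"
    have c\<gamma>: "continuous_on UNIV \<gamma>"
      unfolding \<gamma>_def by (intro continuous_intros)
    have "(L * norm (y - x))-lipschitz_on {0..1} (g \<circ> \<gamma>)"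
    proof (rule lipschitz_on_closed_Union[where U = U and I = "insert (- D) (closure ` T)"])
      show "(L * norm (y - x))-lipschitz_on (U S) (g \<circ> \<gamma>)" if "S \<in> insert (- D) (closure ` T)" for S
      proof (rule lipschitz_onI)
        fix a b assume ab: "a \<in> U S" "b \<in> U S"
        have d: "dist (\<gamma> a) (\<gamma> b) = norm (y - x) * dist a b"
        proof -
          have "\<gamma> a - \<gamma> b = (a - b) *\<^sub>R (y - x)"
            by (simp add: \<gamma>_def algebra_simps)
          then show ?thesis by (simp add: dist_norm)
        qed
        have "dist (g (\<gamma> a)) (g (\<gamma> b)) \<le> L * dist (\<gamma> a) (\<gamma> b)"
          using that
        proof
          assume "S = - D"
          then show ?thesis
            using ab gD L(1) by (simp add: U_def)
        next
          assume "S \<in> closure ` T"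
          then show ?thesis
            using ab cell by (auto simp: U_def lipschitz_on_def)
        qed
        then show "dist ((g \<circ> \<gamma>) a) ((g \<circ> \<gamma>) b) \<le> L * norm (y - x) * dist a b"
          by (simp add: d mult.assoc)
      qed (use L(1) in simp)
      show "closed (U S)" if "S \<in> insert (- D) (closure ` T)" for S
        unfolding U_def using that open_D c\<gamma> by (intro closed_vimage) auto
      show "{0..1} \<subseteq> (\<Union>S\<in>insert (- D) (closure ` T). U S)"
        using cover by (auto simp: U_def)
    qed (use finite_T L(1) in auto)
    then have "dist ((g \<circ> \<gamma>) 0) ((g \<circ> \<gamma>) 1) \<le> L * norm (y - x) * dist (0::real) 1"
      by (rule lipschitz_onD) auto
    then show "dist (g x) (g y) \<le> L * dist x y"
      by (simp add: \<gamma>_def dist_norm norm_minus_commute)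
  qed (rule L(1))
  then show ?thesis
    using gT gD by (rule that)
qed

text \<open>The Lipschitz extension also bounds the difference quotient where the shift crosses a
  cell boundary, so dominated convergence yields the cellwise gradient without face terms. The
  function \<open>v\<close> agrees with the extension off the skeleton, hence almost
  everywhere.\<close>

lemma difference_quotient_limit:
  assumes u: "u \<in> piecewise_C1 T" and v: "v \<in> piecewise_C1 T" and "continuous_zero v"
  shows "((\<lambda>t. (1 / t) * (LINT x|lborel. u x * (v (x + t *\<^sub>R \<omega>) - v x)))
    \<longlongrightarrow> (\<Sum>K\<in>T. LINT x|lebesgue_on K. u x * (\<omega> \<bullet> grad v x))) (at_right 0)"
proof -
  obtain g M where g: "M-lipschitz_on UNIV g" "\<And>x. x \<in> \<Union>T \<Longrightarrow> v x = g x" "\<And>x. x \<notin> D \<Longrightarrow> g x = 0"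
    by (rule lipschitz_extension[OF v assms(3)]) blast
  have M: "M \<ge> 0" using g(1) by (rule lipschitz_on_nonneg)
  note [measurable] = piecewise_C1_borel[OF u] piecewise_C1_borel[OF v]
  have [measurable]: "g \<in> borel_measurable borel"
    using g(1) by (intro borel_measurable_continuous_onI lipschitz_on_continuous_on)
  obtain N where N: "\<And>x. \<bar>u x\<bar> \<le> N" "N \<ge> 0"
    by (rule piecewise_C1_bounded[OF u]) blast
  have vg: "v x = g x" if "x \<in> D \<longrightarrow> x \<in> \<Union>T" for x
    using that g(2,3) piecewise_C1_zero[OF v, of x] cells_subset by (cases "x \<in> D") auto
  have "\<forall>K\<in>T. \<exists>G. continuous_on UNIV G \<and> (\<forall>x\<in>K. grad v x = G x \<and> (v has_derivative (\<lambda>h. G x \<bullet> h)) (at x))"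
    using piecewise_C1_derivative[OF v] by metis
  then obtain G where G: "\<forall>K\<in>T. continuous_on UNIV (G K) \<and> (\<forall>x\<in>K. grad v x = G K x \<and> (v has_derivative (\<lambda>h. G K x \<bullet> h)) (at x))"
    by (rule bchoice[THEN exE])
  have Gm: "G K \<in> borel_measurable borel" if "K \<in> T" for K
    using G that by (intro borel_measurable_continuous_onI) blast
  define f where "f = (\<lambda>x. \<Sum>K\<in>T. indicator K x * (u x * (\<omega> \<bullet> G K x)))"
  have fm: "f \<in> borel_measurable borel"
    unfolding f_def
  proof (rule borel_measurable_sum)
    fix K assume K: "K \<in> T"
    note [measurable] = Gm[OF K] borel_cell[OF K]
    show "(\<lambda>x. indicator K x * (u x * (\<omega> \<bullet> G K x))) \<in> borel_measurable borel"
      by measurable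
  qed
  have lim: "((\<lambda>t. LINT x|lborel. (1 / t) * (u x * (v (x + t *\<^sub>R \<omega>) - v x))) \<longlongrightarrow> (LINT x|lborel. f x)) (at_right 0)"
  proof (rule dominated_convergence_at_right_0)
    show "integrable lborel (\<lambda>x. indicator (\<Union>T) x * (N * (M * norm \<omega>)))"
      using bounded_Union N M borel_cell finite_T
      by (intro integrable_lborel_bounded[where B = "\<Union>T" and M = "N * (M * norm \<omega>)"])
        (auto simp: indicator_def intro!: borel_measurable_times borel_measurable_indicator sets.finite_Union)
    show "AE x in lborel. \<bar>(1 / t) * (u x * (v (x + t *\<^sub>R \<omega>) - v x))\<bar> \<le> indicator (\<Union>T) x * (N * (M * norm \<omega>))"
      if t: "t > 0" for t
    proof -
      \<comment> \<open>By translation invariance the shifted skeleton is a null set as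
        well.\<close>
      have "AE x in lborel. x + t *\<^sub>R \<omega> \<in> D \<longrightarrow> x + t *\<^sub>R \<omega> \<in> \<Union>T"
      proof -
        have "AE x in distr lborel borel ((+) (t *\<^sub>R \<omega>)). x \<in> D \<longrightarrow> x \<in> \<Union>T"
          unfolding lborel_distr_plus by (rule AE_in_cells)
        then show ?thesis
        proof (subst (asm) AE_distr_iff)
          have "\<Union>T \<in> sets borel"
            using finite_T borel_cell by (intro sets.finite_Union) auto
          then have "- D \<union> \<Union>T \<in> sets borel"
            using open_D by (intro sets.Un) auto
          also have "- D \<union> \<Union>T = {x \<in> space borel. x \<in> D \<longrightarrow> x \<in> \<Union>T}"
            by auto
          finally show "{x \<in> space borel. x \<in> D \<longrightarrow> x \<in> \<Union>T} \<in> sets borel" .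
        qed (auto simp: add.commute)
      qed
      with AE_in_cells show ?thesis
      proof eventually_elim
        case (elim x)
        show ?case
        proof (cases "x \<in> \<Union>T")
          case True
          have "dist (g (x + t *\<^sub>R \<omega>)) (g x) \<le> M * dist (x + t *\<^sub>R \<omega>) x"
            using g(1) by (rule lipschitz_onD) auto
          then have "\<bar>v (x + t *\<^sub>R \<omega>) - v x\<bar> \<le> M * (t * norm \<omega>)"
            using vg[OF elim(1)] vg[OF elim(2)] t by (simp add: dist_norm)
          then have "\<bar>u x\<bar> * \<bar>v (x + t *\<^sub>R \<omega>) - v x\<bar> \<le> N * (M * (t * norm \<omega>))"
            using N by (intro mult_mono) auto
          then have "(1 / t) * (\<bar>u x\<bar> * \<bar>v (x + t *\<^sub>R \<omega>) - v x\<bar>) \<le> (1 / t) * (N * (M * (t * norm \<omega>)))"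
            using t by (intro mult_left_mono) auto
          then show ?thesis
            using t True by (simp add: abs_mult)
        qed (simp add: piecewise_C1_zero[OF u])
      qed
    qed
    show "AE x in lborel. ((\<lambda>t. (1 / t) * (u x * (v (x + t *\<^sub>R \<omega>) - v x))) \<longlongrightarrow> f x) (at_right 0)"
    proof (rule AE_I2)
      fix x
      show "((\<lambda>t. (1 / t) * (u x * (v (x + t *\<^sub>R \<omega>) - v x))) \<longlongrightarrow> f x) (at_right 0)"
      proof (cases "x \<in> \<Union>T")
        case True
        then obtain K where K: "K \<in> T" "x \<in> K" by blast
        have "((\<lambda>t. x + t *\<^sub>R \<omega>) has_derivative (\<lambda>s. s *\<^sub>R \<omega>)) (at 0)"
          by (auto intro!: derivative_eq_intros)
        moreover have "(v has_derivative (\<lambda>h. G K x \<bullet> h)) (at (x + 0 *\<^sub>R \<omega>))"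
          using G K by simp
        ultimately have "((\<lambda>t. v (x + t *\<^sub>R \<omega>)) has_derivative (\<lambda>s. G K x \<bullet> (s *\<^sub>R \<omega>))) (at 0)"
          by (rule has_derivative_compose)
        then have "((\<lambda>t. v (x + t *\<^sub>R \<omega>)) has_real_derivative (G K x \<bullet> \<omega>)) (at 0)"
          by (simp add: has_field_derivative_def mult_commute_abs)
        then have "((\<lambda>t. (v (x + t *\<^sub>R \<omega>) - v x) / t) \<longlongrightarrow> G K x \<bullet> \<omega>) (at 0)"
          by (simp add: DERIV_def)
        then have "((\<lambda>t. u x * ((v (x + t *\<^sub>R \<omega>) - v x) / t)) \<longlongrightarrow> u x * (\<omega> \<bullet> G K x)) (at_right 0)"
          by (intro tendsto_intros) (simp add: inner_commute filterlim_at_split)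
        moreover have "f x = u x * (\<omega> \<bullet> G K x)"
          unfolding f_def by (rule sum_indicator_cells[OF K])
        ultimately show ?thesis
          by simp
      next
        case False
        then have "f x = 0"
          unfolding f_def by (rule sum_indicator_cells_zero)
        with False show ?thesis
          by (simp add: piecewise_C1_zero[OF u])
      qed
    qed
  qed (use fm in auto)
  have "(LINT x|lborel. f x) = (\<Sum>K\<in>T. LINT x|lborel. indicator K x * (u x * (\<omega> \<bullet> G K x)))"
    unfolding f_def
  proof (rule Bochner_Integration.integral_sum)
    fix K assume K: "K \<in> T"
    note [measurable] = Gm[OF K] borel_cell[OF K]
    have "compact (G K ` closure K)"
      using G K bounded_cell by (intro compact_continuous_image) (auto intro: continuous_on_subset)
    then obtain R where R: "\<And>x. x \<in> closure K \<Longrightarrow> norm (G K x) \<le> R"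
      using compact_imp_bounded by (force simp: bounded_iff)
    show "integrable lborel (\<lambda>x. indicator K x * (u x * (\<omega> \<bullet> G K x)))"
    proof (rule integrable_lborel_bounded[where B = K and M = "N * (norm \<omega> * \<bar>R\<bar>)"])
      show "\<bar>indicator K x * (u x * (\<omega> \<bullet> G K x))\<bar> \<le> N * (norm \<omega> * \<bar>R\<bar>)" for x
      proof (cases "x \<in> K")
        case True
        have "\<bar>\<omega> \<bullet> G K x\<bar> \<le> norm \<omega> * norm (G K x)"
          by (rule Cauchy_Schwarz_ineq2)
        also have "\<dots> \<le> norm \<omega> * \<bar>R\<bar>"
          using R[of x] True closure_subset by (intro mult_left_mono) (auto intro: order_trans[OF _ abs_ge_self])
        finally have "\<bar>u x\<bar> * \<bar>\<omega> \<bullet> G K x\<bar> \<le> N * (norm \<omega> * \<bar>R\<bar>)"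
          using N by (intro mult_mono) auto
        then show ?thesis using True by (simp add: abs_mult)
      qed (use N in simp)
    qed (use bounded_cell[OF K] in auto)
  qed
  also have "\<dots> = (\<Sum>K\<in>T. LINT x|lebesgue_on K. u x * (\<omega> \<bullet> grad v x))"
  proof (rule sum.cong[OF refl])
    fix K assume K: "K \<in> T"
    note [measurable] = Gm[OF K] borel_cell[OF K]
    have "(LINT x|lborel. indicator K x * (u x * (\<omega> \<bullet> G K x))) = (LINT x|lebesgue_on K. u x * (\<omega> \<bullet> G K x))"
      by (rule LINT_lebesgue_on_borel[symmetric]) measurable
    also have "\<dots> = (LINT x|lebesgue_on K. u x * (\<omega> \<bullet> grad v x))"
      using G K by (intro Bochner_Integration.integral_cong) auto
    finally show "(LINT x|lborel. indicator K x * (u x * (\<omega> \<bullet> G K x))) = (LINT x|lebesgue_on K. u x * (\<omega> \<bullet> grad v x))" .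
  qed
  finally show ?thesis
    using lim by simp
qed

text \<open>The difference in \<open>transport\<close> falls on the continuous argument, so in the
  sum over all cells the boundary integrals cancel.\<close>

lemma cell_form_continuous_test:
  assumes u: "u \<in> piecewise_C1 T" and v: "v \<in> piecewise_C1 T" "continuous_zero v"
  shows "(\<Sum>K\<in>T. cell_form D \<omega> K u v) = - (\<Sum>K\<in>T. LINT x|lebesgue_on K. u x * (\<omega> \<bullet> grad v x))"
proof (rule tendsto_unique[OF _ transport_limit[OF u v(1) cells_subset]])
  have "transport \<omega> u v t = - ((1 / t) * (LINT x|lborel. u x * (v (x + t *\<^sub>R \<omega>) - v x)))" for t
  proof -
    have "(LINT x|lborel. u x * (v x - v (x + t *\<^sub>R \<omega>))) = (LINT x|lborel. - (u x * (v (x + t *\<^sub>R \<omega>) - v x)))"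
      by (intro Bochner_Integration.integral_cong) (auto simp: algebra_simps)
    then show ?thesis by (simp add: transport_def)
  qed
  then have eq: "transport \<omega> u v = (\<lambda>t. - ((1 / t) * (LINT x|lborel. u x * (v (x + t *\<^sub>R \<omega>) - v x))))"
    by (rule ext)
  show "(transport \<omega> u v \<longlongrightarrow> - (\<Sum>K\<in>T. LINT x|lebesgue_on K. u x * (\<omega> \<bullet> grad v x))) (at_right 0)"
    unfolding eq by (rule tendsto_minus[OF difference_quotient_limit[OF u v]])
qed simp

text \<open>Translation invariance moves the difference from \<open>v\<close> to \<open>u\<close>,
  with the direction reversed; the two changes of sign cancel.\<close>

lemma cell_form_continuous_trial:
  assumes u: "u \<in> piecewise_C1 T" "continuous_zero u" and v: "v \<in> piecewise_C1 T"
  shows "(\<Sum>K\<in>T. cell_form D \<omega> K u v) = (\<Sum>K\<in>T. LINT x|lebesgue_on K. v x * (\<omega> \<bullet> grad u x))"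
proof (rule tendsto_unique[OF _ transport_limit[OF u(1) v cells_subset]])
  note [measurable] = piecewise_C1_borel[OF u(1)] piecewise_C1_borel[OF v]
  have "transport \<omega> u v t = - ((1 / t) * (LINT x|lborel. v x * (u (x + t *\<^sub>R (- \<omega>)) - u x)))" for t
  proof -
    let ?s = "t *\<^sub>R \<omega>"
    note int = integrable_mult_shift[OF u(1) v]
    have "(LINT x|lborel. u x * (v x - v (x + ?s))) = (LINT x|lborel. u x * v x) - (LINT x|lborel. u x * v (x + ?s))"
      using int[of 0 0] int[of 0 ?s] by (simp add: right_diff_distrib)
    also have "(LINT x|lborel. u x * v (x + ?s)) = (LINT x|lborel. u (x + ?s + - ?s) * v (x + ?s))"
      by simp
    also have "\<dots> = (LINT x|lborel. u (x + - ?s) * v x)"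
      by (rule integral_lborel_translate[of "\<lambda>x. u (x + - ?s) * v x"]) measurable
    also have "(LINT x|lborel. u x * v x) - \<dots> = (LINT x|lborel. u x * v x - u (x + - ?s) * v x)"
      using int[of 0 0] int[of "- ?s" 0] by (intro Bochner_Integration.integral_diff[symmetric]) simp_all
    also have "\<dots> = (LINT x|lborel. - (v x * (u (x + t *\<^sub>R (- \<omega>)) - u x)))"
      by (intro Bochner_Integration.integral_cong) (auto simp: algebra_simps)
    finally show ?thesis by (simp add: transport_def)
  qed
  then have eq: "transport \<omega> u v = (\<lambda>t. - ((1 / t) * (LINT x|lborel. v x * (u (x + t *\<^sub>R (- \<omega>)) - u x))))"
    by (rule ext)
  have neg: "- (\<Sum>K\<in>T. LINT x|lebesgue_on K. v x * (- \<omega> \<bullet> grad u x)) = (\<Sum>K\<in>T. LINT x|lebesgue_on K. v x * (\<omega> \<bullet> grad u x))"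
    by (simp add: sum_negf)
  show "(transport \<omega> u v \<longlongrightarrow> (\<Sum>K\<in>T. LINT x|lebesgue_on K. v x * (\<omega> \<bullet> grad u x))) (at_right 0)"
    unfolding eq neg[symmetric] by (rule tendsto_minus[OF difference_quotient_limit[OF v u]])
qed simp

text \<open>Linearity is inherited from the difference quotients, which are linear for every
  \<open>t\<close>, so no calculus of traces is involved.\<close>

lemma cell_form_linear_trial:
  assumes "finite E" "\<And>e. e \<in> E \<Longrightarrow> f e \<in> piecewise_C1 T" and v: "v \<in> piecewise_C1 T"
  shows "(\<Sum>K\<in>T. cell_form D \<omega> K (\<lambda>x. \<Sum>e\<in>E. c e * f e x) v) = (\<Sum>e\<in>E. c e * (\<Sum>K\<in>T. cell_form D \<omega> K (f e) v))"
proof (rule tendsto_unique[OF _ transport_limit[OF _ v cells_subset]])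
  show "(\<lambda>x. \<Sum>e\<in>E. c e * f e x) \<in> piecewise_C1 T"
    using assms by (intro piecewise_C1_sum piecewise_C1_cmult)
  have int: "integrable lborel (\<lambda>x. f e x * (v x - v (x + s)))" if "e \<in> E" for e s
    using integrable_mult_shift[OF assms(2)[OF that] v, of 0 0] integrable_mult_shift[OF assms(2)[OF that] v, of 0 s]
    by (simp add: right_diff_distrib)
  have "transport \<omega> (\<lambda>x. \<Sum>e\<in>E. c e * f e x) v t = (\<Sum>e\<in>E. c e * transport \<omega> (f e) v t)" for t
  proof -
    have "(LINT x|lborel. (\<Sum>e\<in>E. c e * f e x) * (v x - v (x + t *\<^sub>R \<omega>)))
        = (LINT x|lborel. (\<Sum>e\<in>E. c e * (f e x * (v x - v (x + t *\<^sub>R \<omega>)))))"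
      by (simp add: sum_distrib_right mult.assoc)
    also have "\<dots> = (\<Sum>e\<in>E. c e * (LINT x|lborel. f e x * (v x - v (x + t *\<^sub>R \<omega>))))"
      using int by (subst Bochner_Integration.integral_sum) auto
    finally show ?thesis
      by (simp add: transport_def sum_distrib_left mult_ac)
  qed
  then have eq: "transport \<omega> (\<lambda>x. \<Sum>e\<in>E. c e * f e x) v = (\<lambda>t. \<Sum>e\<in>E. c e * transport \<omega> (f e) v t)"
    by (rule ext)
  have "((\<lambda>t. \<Sum>e\<in>E. c e * transport \<omega> (f e) v t) \<longlongrightarrow> (\<Sum>e\<in>E. c e * (\<Sum>K\<in>T. cell_form D \<omega> K (f e) v))) (at_right 0)"
    by (intro tendsto_sum tendsto_mult tendsto_const transport_limit assms(2) v cells_subset)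
  then show "(transport \<omega> (\<lambda>x. \<Sum>e\<in>E. c e * f e x) v \<longlongrightarrow> (\<Sum>e\<in>E. c e * (\<Sum>K\<in>T. cell_form D \<omega> K (f e) v))) (at_right 0)"
    unfolding eq .
qed simp

text \<open>Zero energy in direction \<open>\<Omega> j\<close> controls the mean differences along
  it. The spanning identity writes a shift \<open>h\<close> as a sum of such steps with coefficients
  linear in \<open>h\<close>, so the bounds add up to a multiple of \<open>norm h\<close>.\<close>

lemma zero_energy_imp_continuous:
  fixes \<Omega> :: "'m::finite \<Rightarrow> real^'d"
  assumes u: "u \<in> piecewise_C1 T"
    and zero: "\<And>j. (\<Sum>K\<in>T. cell_form D (\<Omega> j) K u u) = 0"
    and span: "\<And>h. h = (\<Sum>j\<in>UNIV. (c j * (\<Omega> j \<bullet> h)) *\<^sub>R \<Omega> j)"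
  shows "continuous_zero u"
proof -
  have "\<exists>M\<ge>0. \<forall>s. mean_difference_bound u (s *\<^sub>R \<Omega> j) (M * \<bar>s\<bar>)" for j
  proof -
    obtain M where M: "M \<ge> 0" "\<forall>s\<ge>0. \<forall>A\<in>sets borel. bounded A \<longrightarrow>
        (LINT x|lborel. indicator A x * \<bar>u (x + s *\<^sub>R \<Omega> j) - u x\<bar>) \<le> M * s * measure lborel A"
      using difference_integral_bound[OF u cells_subset zero] by blast
    have nonneg: "mean_difference_bound u (s *\<^sub>R \<Omega> j) (M * s)" if "s \<ge> 0" for s
      using M(2) that by (simp add: mean_difference_bound_def)
    have "mean_difference_bound u (s *\<^sub>R \<Omega> j) (M * \<bar>s\<bar>)" for s
    proof (cases "s \<ge> 0")
      case True
      then show ?thesis using nonneg by simp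
    next
      case False
      then show ?thesis
        using mean_difference_bound_minus[OF u nonneg[of "- s"]] by simp
    qed
    then show ?thesis using M(1) by blast
  qed
  then have "\<forall>j. \<exists>M. M \<ge> 0 \<and> (\<forall>s. mean_difference_bound u (s *\<^sub>R \<Omega> j) (M * \<bar>s\<bar>))"
    by blast
  then obtain M where "\<forall>j. M j \<ge> 0 \<and> (\<forall>s. mean_difference_bound u (s *\<^sub>R \<Omega> j) (M j * \<bar>s\<bar>))"
    by (rule choice[THEN exE])
  then have M: "\<And>j. M j \<ge> 0" "\<And>j s. mean_difference_bound u (s *\<^sub>R \<Omega> j) (M j * \<bar>s\<bar>)"
    by blast+
  define R where "R = (\<Sum>j\<in>UNIV. M j * (\<bar>c j\<bar> * norm (\<Omega> j)))"
  have R: "R \<ge> 0"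
    unfolding R_def using M(1) by (intro sum_nonneg) auto
  have "mean_difference_bound u h (R * norm h)" for h
  proof -
    have "mean_difference_bound u (\<Sum>j\<in>UNIV. (c j * (\<Omega> j \<bullet> h)) *\<^sub>R \<Omega> j) (\<Sum>j\<in>UNIV. M j * \<bar>c j * (\<Omega> j \<bullet> h)\<bar>)"
      by (intro mean_difference_bound_sum u M(2)) auto
    moreover have "(\<Sum>j\<in>UNIV. M j * \<bar>c j * (\<Omega> j \<bullet> h)\<bar>) \<le> R * norm h"
      unfolding R_def sum_distrib_right
    proof (rule sum_mono)
      fix j
      have "\<bar>c j\<bar> * \<bar>\<Omega> j \<bullet> h\<bar> \<le> \<bar>c j\<bar> * (norm (\<Omega> j) * norm h)"
        by (intro mult_left_mono Cauchy_Schwarz_ineq2) simp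
      then show "M j * \<bar>c j * (\<Omega> j \<bullet> h)\<bar> \<le> M j * (\<bar>c j\<bar> * norm (\<Omega> j)) * norm h"
        using mult_left_mono[OF _ M(1)[of j]] by (simp add: abs_mult mult.assoc)
    qed
    ultimately show ?thesis
      unfolding span[of h, symmetric] by (rule mean_difference_bound_mono)
  qed
  from continuous_extension[OF u this R] show ?thesis
    by (simp add: continuous_zero_def)
qed

end

section \<open>Finite-dimensional spaces of functions\<close>

text \<open>The axioms are relative to \<open>W\<close> because an integral form on arbitrary
  functions is neither additive nor definite.\<close>

locale inner_subspace = vector_space scale for scale :: "real \<Rightarrow> 'b::ab_group_add \<Rightarrow> 'b" +
  fixes W :: "'b set" and ip :: "'b \<Rightarrow> 'b \<Rightarrow> real"
  assumes subspace_W: "subspace W"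
    and ip_add: "u \<in> W \<Longrightarrow> v \<in> W \<Longrightarrow> z \<in> W \<Longrightarrow> ip (u + v) z = ip u z + ip v z"
    and ip_scale: "u \<in> W \<Longrightarrow> z \<in> W \<Longrightarrow> ip (scale c u) z = c * ip u z"
    and ip_commute: "u \<in> W \<Longrightarrow> v \<in> W \<Longrightarrow> ip u v = ip v u"
    and ip_nonneg: "u \<in> W \<Longrightarrow> ip u u \<ge> 0"
    and ip_eq_0: "u \<in> W \<Longrightarrow> ip u u = 0 \<Longrightarrow> u = 0"
begin

definition orthonormal :: "'b set \<Rightarrow> bool" where
  "orthonormal E \<longleftrightarrow> E \<subseteq> W \<and> finite E \<and> (\<forall>e\<in>E. \<forall>f\<in>E. ip e f = (if e = f then 1 else 0))"

lemma ip_zero: "z \<in> W \<Longrightarrow> ip 0 z = 0"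
  using ip_scale[of 0 z 0] subspace_0[OF subspace_W] by simp

lemma sum_in_W: "E \<subseteq> W \<Longrightarrow> (\<Sum>e\<in>E. scale (a e) e) \<in> W"
  by (intro subspace_sum[OF subspace_W] subspace_scale[OF subspace_W]) auto

lemma ip_sum:
  assumes "finite E" "E \<subseteq> W" "z \<in> W"
  shows "ip (\<Sum>e\<in>E. scale (a e) e) z = (\<Sum>e\<in>E. a e * ip e z)"
  using assms
proof (induction E rule: finite_induct)
  case (insert e E)
  then have "scale (a e) e \<in> W" "(\<Sum>e\<in>E. scale (a e) e) \<in> W"
    using subspace_scale[OF subspace_W] sum_in_W by auto
  then show ?case
    using insert by (simp add: ip_add ip_scale)
qed (simp add: ip_zero)

lemma ip_expansion:
  assumes "orthonormal E" "f \<in> E"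
  shows "ip (\<Sum>e\<in>E. scale (a e) e) f = a f"
proof -
  have "ip (\<Sum>e\<in>E. scale (a e) e) f = (\<Sum>e\<in>E. a e * ip e f)"
    using assms by (intro ip_sum) (auto simp: orthonormal_def)
  also have "\<dots> = (\<Sum>e\<in>E. if e = f then a f else 0)"
    using assms by (intro sum.cong) (auto simp: orthonormal_def)
  also have "\<dots> = a f"
    using assms by (simp add: orthonormal_def)
  finally show ?thesis .
qed

lemma span_orthonormal:
  assumes "orthonormal E" "v \<in> span E"
  shows "v = (\<Sum>e\<in>E. scale (ip v e) e)"
proof -
  obtain a where a: "v = (\<Sum>e\<in>E. scale (a e) e)"
    using assms span_finite[of E] by (auto simp: orthonormal_def)
  have "ip v e = a e" if "e \<in> E" for e
    unfolding a by (rule ip_expansion[OF assms(1) that])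
  then show ?thesis
    using a by simp
qed

lemma gram_schmidt:
  assumes "finite C" "C \<subseteq> W"
  shows "\<exists>E. orthonormal E \<and> C \<subseteq> span E"
  using assms
proof (induction C rule: finite_induct)
  case empty
  then show ?case by (intro exI[of _ "{}"]) (simp add: orthonormal_def)
next
  case (insert c C)
  then obtain E where E: "orthonormal E" "C \<subseteq> span E" by auto
  have EW: "E \<subseteq> W" and fE: "finite E" and cW: "c \<in> W"
    using E insert by (auto simp: orthonormal_def)
  define p where "p = (\<Sum>e\<in>E. scale (ip c e) e)"
  define f where "f = c - p"
  have p: "p \<in> W" "p \<in> span E"
    unfolding p_def by (rule sum_in_W[OF EW]) (intro span_sum span_scale span_base)
  have f: "f \<in> W"
    unfolding f_def by (rule subspace_diff[OF subspace_W cW p(1)])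
  have c: "c = f + p" by (simp add: f_def)
  have ort: "ip f e = 0" if e: "e \<in> E" for e
  proof -
    have "ip c e = ip f e + ip p e"
      unfolding c using f p e EW by (intro ip_add) auto
    moreover have "ip p e = ip c e"
      unfolding p_def by (rule ip_expansion[OF E(1) e])
    ultimately show ?thesis by simp
  qed
  show ?case
  proof (cases "f = 0")
    case True
    then show ?thesis using E p c by (intro exI[of _ E]) auto
  next
    case False
    define r where "r = sqrt (ip f f)"
    have "ip f f > 0" using False ip_eq_0 ip_nonneg f by (metis antisym_conv2)
    then have r: "r > 0" "r * r = ip f f" by (auto simp: r_def)
    define g where "g = scale (1 / r) f"
    have g: "g \<in> W" unfolding g_def by (rule subspace_scale[OF subspace_W f])
    have ge: "ip g e = 0" if "e \<in> E" for e
      unfolding g_def using ip_scale[OF f, of e] ort[OF that] that EW by auto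
    have "ip g g = 1 / r * ip f g"
      using ip_scale[OF f g, of "1 / r"] by (simp add: g_def)
    also have "ip f g = 1 / r * ip f f"
      using ip_commute[OF f g] ip_scale[OF f f, of "1 / r"] by (simp add: g_def)
    finally have gg: "ip g g = 1"
      using r(1) by (simp flip: r(2))
    have "orthonormal (insert g E)"
      unfolding orthonormal_def
    proof (intro conjI ballI)
      fix a b assume "a \<in> insert g E" "b \<in> insert g E"
      then show "ip a b = (if a = b then 1 else 0)"
        using gg ge E(1) ip_commute[OF g, of b] ip_commute[OF _ g, of a] EW by (auto simp: orthonormal_def)
    qed (use g EW fE in auto)
    moreover have "f = scale r g"
      using r by (simp add: g_def)
    then have "c \<in> span (insert g E)"
      unfolding c using p(2) span_mono[of E "insert g E"]
      by (intro span_add) (auto intro: span_scale span_base)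
    moreover have "C \<subseteq> span (insert g E)"
      using E(2) span_mono[of E "insert g E"] by auto
    ultimately show ?thesis by (intro exI[of _ "insert g E"]) auto
  qed
qed

lemma orthonormal_basis:
  assumes "finite B" "W \<subseteq> span B"
  obtains E where "orthonormal E" "\<And>v. v \<in> W \<Longrightarrow> v = (\<Sum>e\<in>E. scale (ip v e) e)"
proof -
  obtain C where C: "C \<subseteq> W" "independent C" "W \<subseteq> span C"
    using basis_exists by metis
  then have "finite C"
    using independent_span_bound[OF assms(1) C(2)] assms(2) by auto
  then obtain E where E: "orthonormal E" "C \<subseteq> span E"
    using gram_schmidt C(1) by blast
  then have "W \<subseteq> span E"
    using C(3) span_minimal[OF E(2) subspace_span] by auto
  then show ?thesis
    using that E(1) span_orthonormal by blast
qed

text \<open>The Bessel inequality for one vector, from the nonnegative square of \<open>v\<close>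
  minus its projection to \<open>e\<close>. It turns norm bounds into bounds for
  coordinates.\<close>

lemma ip_coefficient_bound:
  assumes "orthonormal E" "e \<in> E" "v \<in> W"
  shows "(ip v e)\<^sup>2 \<le> ip v v"
proof -
  have e: "e \<in> W" "ip e e = 1" using assms by (auto simp: orthonormal_def)
  define k where "k = ip v e"
  have s: "scale (- k) e \<in> W" by (rule subspace_scale[OF subspace_W e(1)])
  then have d: "v + scale (- k) e \<in> W" using subspace_add[OF subspace_W assms(3)] by blast
  have ve: "ip e v = k" using ip_commute[OF e(1) assms(3)] by (simp add: k_def)
  have "ip (v + scale (- k) e) (v + scale (- k) e) = ip v (v + scale (- k) e) - k * ip e (v + scale (- k) e)"
    using ip_add[OF assms(3) s d] ip_scale[OF e(1) d, of "- k"] by simp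
  also have "ip v (v + scale (- k) e) = ip v v - k * k"
    using ip_commute[OF assms(3) d] ip_add[OF assms(3) s assms(3)] ip_scale[OF e(1) assms(3), of "- k"] ve by simp
  also have "ip e (v + scale (- k) e) = k - k"
    using ip_commute[OF e(1) d] ip_add[OF assms(3) s e(1)] ip_scale[OF e(1) e(1), of "- k"] e(2) by (simp add: k_def)
  finally show ?thesis
    using ip_nonneg[OF d] by (simp add: k_def power2_eq_square)
qed

end

interpretation function_space: vector_space "\<lambda>c (v :: 'm \<Rightarrow> 'x \<Rightarrow> real). (\<lambda>j x. c * v j x)"
  by unfold_locales (auto simp: fun_eq_iff algebra_simps)

lemma sum_fun_apply2: "(\<Sum>a\<in>A. f a) j x = (\<Sum>a\<in>A. f a j x)" for f :: "'a \<Rightarrow> 'm \<Rightarrow> 'x \<Rightarrow> real"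
  by (induction A rule: infinite_finite_induct) auto

text \<open>Affine functions are multilinear with coefficients on index sets of at most one element,
  so one finite family of monomials serves both mesh types.\<close>

lemma Z1_multilinear:
  fixes p :: "real^'d \<Rightarrow> real"
  assumes "p \<in> Z1 mt"
  shows "\<exists>c :: 'd set \<Rightarrow> real. \<forall>x. p x = (\<Sum>I\<in>UNIV. c I * (\<Prod>i\<in>I. x $ i))"
proof (cases mt)
  case Cartesian
  then show ?thesis using assms by (simp add: Z1_def)
next
  case Simplicial
  then obtain a b where p: "\<And>x. p x = a + b \<bullet> x"
    using assms by (auto simp: Z1_def)
  \<comment> \<open>The inner sum has exactly one term if \<open>I\<close> is a singleton, and it is
    empty, hence 0, for larger sets.\<close>
  define c where "c I = (if I = {} then a else \<Sum>i | I = {i}. b $ i)" for I :: "'d set"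
  have c0: "c {} = a" and c1: "c {i} = b $ i" for i
    by (auto simp: c_def)
  have "p x = (\<Sum>I\<in>UNIV. c I * (\<Prod>i\<in>I. x $ i))" for x
  proof -
    have "(\<Sum>I\<in>UNIV. c I * (\<Prod>i\<in>I. x $ i)) = (\<Sum>I\<in>insert {} (range (\<lambda>i. {i})). c I * (\<Prod>i\<in>I. x $ i))"
    proof (rule sum.mono_neutral_right)
      show "\<forall>I\<in>UNIV - insert {} (range (\<lambda>i. {i})). c I * (\<Prod>i\<in>I. x $ i) = 0"
        by (auto simp: c_def intro!: sum.neutral)
    qed auto
    also have "\<dots> = c {} + (\<Sum>I\<in>range (\<lambda>i. {i}). c I * (\<Prod>i\<in>I. x $ i))"
      by (subst sum.insert) auto
    also have "(\<Sum>I\<in>range (\<lambda>i. {i}). c I * (\<Prod>i\<in>I. x $ i)) = (\<Sum>i\<in>UNIV. c {i} * x $ i)"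
      by (subst sum.reindex) (auto simp: inj_on_def)
    finally show ?thesis
      by (simp add: p c0 c1 inner_vec_def)
  qed
  then show ?thesis by blast
qed

text \<open>The spanning set consists of monomials restricted to one cell and placed in one
  component. The value 0 off the cells makes the expansion valid at every point.\<close>

lemma (in polytopal_mesh) VV_h_finite_span:
  "\<exists>B :: ('m::finite \<Rightarrow> real^'d \<Rightarrow> real) set. finite B \<and> VV_h mt T \<subseteq> function_space.span B"
proof -
  define b where "b = (\<lambda>(j0 :: 'm, K :: (real^'d) set, I :: 'd set) j x.
      (if j = j0 then 1 else 0) * (indicator K x * (\<Prod>i\<in>I. x $ i)) :: real)"
  define B where "B = b ` (UNIV \<times> T \<times> UNIV)"
  have "v \<in> function_space.span B" if v: "v \<in> VV_h mt T" for v
  proof -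
    have "\<exists>c. \<forall>x\<in>K. v j x = (\<Sum>I\<in>UNIV. c I * (\<Prod>i\<in>I. x $ i))" if K: "K \<in> T" for j K
    proof -
      obtain p where p: "p \<in> Z1 mt" "\<forall>x\<in>K. v j x = p x"
        using v K unfolding VV_h_def V_h_def by blast
      show ?thesis using Z1_multilinear[OF p(1)] p(2) by auto
    qed
    then have "\<forall>j. \<forall>K\<in>T. \<exists>c. \<forall>x\<in>K. v j x = (\<Sum>I\<in>UNIV. c I * (\<Prod>i\<in>I. x $ i))"
      by blast
    then have "\<forall>j. \<exists>c. \<forall>K\<in>T. \<forall>x\<in>K. v j x = (\<Sum>I\<in>UNIV. c K I * (\<Prod>i\<in>I. x $ i))"
      by (intro allI bchoice) blast
    then obtain c where c: "\<forall>j. \<forall>K\<in>T. \<forall>x\<in>K. v j x = (\<Sum>I\<in>UNIV. c j K I * (\<Prod>i\<in>I. x $ i))"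
      by (rule choice[THEN exE])
    have "v j x = (\<Sum>j0\<in>UNIV. \<Sum>K\<in>T. \<Sum>I\<in>UNIV. c j0 K I * b (j0, K, I) j x)" for j x
    proof -
      have "(\<Sum>K\<in>T. \<Sum>I\<in>UNIV. c j0 K I * b (j0, K, I) j x)
          = (if j = j0 then (\<Sum>K\<in>T. indicator K x * (\<Sum>I\<in>UNIV. c j0 K I * (\<Prod>i\<in>I. x $ i))) else 0)" for j0
        by (simp add: b_def sum_distrib_left mult.left_commute)
      moreover have "(\<Sum>K\<in>T. indicator K x * (\<Sum>I\<in>UNIV. c j K I * (\<Prod>i\<in>I. x $ i))) = v j x"
      proof (cases "x \<in> \<Union>T")
        case True
        then obtain K where K: "K \<in> T" "x \<in> K" by blast
        then show ?thesis
          using sum_indicator_cells[of K x "\<lambda>K. \<Sum>I\<in>UNIV. c j K I * (\<Prod>i\<in>I. x $ i)"] c by simp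
      next
        case False
        then have "v j x = 0" using v by (auto simp: VV_h_def V_h_def)
        then show ?thesis
          using sum_indicator_cells_zero[OF False] by simp
      qed
      ultimately show ?thesis by simp
    qed
    then have eq: "v = (\<Sum>j0\<in>UNIV. \<Sum>K\<in>T. \<Sum>I\<in>UNIV. (\<lambda>j x. c j0 K I * b (j0, K, I) j x))"
      by (simp add: fun_eq_iff sum_fun_apply2)
    show ?thesis
      unfolding eq by (intro function_space.span_sum function_space.span_scale function_space.span_base)
        (auto simp: B_def)
  qed
  moreover have "finite B"
    unfolding B_def using finite_T by auto
  ultimately show ?thesis by blast
qed

text \<open>If convergence failed, some sequence would keep a positive distance from
  \<open>L e\<close>. Boundedness gives a subsequence along which all coordinates converge, and its
  limit must be \<open>L\<close>.\<close>

lemma tendsto_of_unique_cluster_points: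
  fixes f :: "'e \<Rightarrow> real \<Rightarrow> real"
  assumes "finite E" and bound: "\<And>e t. e \<in> E \<Longrightarrow> t > 0 \<Longrightarrow> \<bar>f e t\<bar> \<le> C"
    and uniq: "\<And>X l. (\<And>n. X n > 0) \<Longrightarrow> X \<longlonglongrightarrow> 0 \<Longrightarrow> (\<And>e. e \<in> E \<Longrightarrow> (\<lambda>n. f e (X n)) \<longlonglongrightarrow> l e) \<Longrightarrow>
      (\<forall>e\<in>E. l e = L e)"
    and e: "e \<in> E"
  shows "(f e \<longlongrightarrow> L e) (at_right 0)"
  unfolding tendsto_at_iff_sequentially
proof (intro allI impI)
  fix X :: "nat \<Rightarrow> real"
  assume X: "\<forall>i. X i \<in> {0<..} - {0}" "X \<longlonglongrightarrow> 0"
  show "(f e \<circ> X) \<longlonglongrightarrow> L e"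
  proof (rule ccontr)
    assume "\<not> (f e \<circ> X) \<longlonglongrightarrow> L e"
    then obtain \<delta> where \<delta>: "\<delta> > 0" "\<not> (\<forall>\<^sub>F n in sequentially. dist ((f e \<circ> X) n) (L e) < \<delta>)"
      unfolding tendsto_iff by blast
    from not_eventually_sequentiallyD[OF \<delta>(2)] obtain r :: "nat \<Rightarrow> nat"
      where r: "strict_mono r" "\<And>n. \<not> dist (f e (X (r n))) (L e) < \<delta>"
      by auto
    \<comment> \<open>Bolzano-Weierstrass in the finitely many coordinates in \<open>E\<close>; a
      function on \<open>E\<close> is its own coordinate vector, so \<open>proj\<close> and
      \<open>unproj\<close> are trivial.\<close>
    have "\<forall>\<delta>'\<subseteq>E. \<exists>l r'. strict_mono r' \<and> (\<forall>\<eta>>0. \<forall>\<^sub>F n in sequentially. \<forall>i\<in>\<delta>'. dist (f i (X (r (r' n)))) (l i) < \<eta>)"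
      by (rule compact_lemma_general[where proj = "\<lambda>v i. v i" and unproj = "\<lambda>v. v" and f = "\<lambda>n i. f i (X (r n))"])
        (use assms(1) bound X in \<open>auto simp: bounded_iff intro!: exI[of _ C]\<close>)
    then obtain l and r' :: "nat \<Rightarrow> nat" where r': "strict_mono r'"
      "\<And>\<eta>. \<eta> > 0 \<Longrightarrow> \<forall>\<^sub>F n in sequentially. \<forall>i\<in>E. dist (f i (X (r (r' n)))) (l i) < \<eta>"
      by blast
    have lim: "(\<lambda>n. f i (X (r (r' n)))) \<longlonglongrightarrow> l i" if "i \<in> E" for i
      using that by (intro tendstoI eventually_mono[OF r'(2)]) auto
    have "(X \<circ> (r \<circ> r')) \<longlonglongrightarrow> 0"
      using r(1) r'(1) X(2) by (intro LIMSEQ_subseq_LIMSEQ strict_mono_o)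
    then have "(\<lambda>n. X (r (r' n))) \<longlonglongrightarrow> 0"
      by (simp add: o_def)
    with lim X(1) uniq[of "\<lambda>n. X (r (r' n))" l] have "l e = L e"
      using e by auto
    with lim[OF e] have "\<forall>\<^sub>F n in sequentially. dist (f e (X (r (r' n)))) (L e) < \<delta>"
      using \<delta>(1) by (simp add: tendsto_iff)
    then show False
      using r(2) by (auto simp: eventually_sequentially)
  qed
qed

text \<open>Existence of one cluster point, by Bolzano-Weierstrass along the sequence
  \<open>1 / (n + 1)\<close>.\<close>

lemma convergent_coefficients:
  fixes f :: "'e \<Rightarrow> real \<Rightarrow> real"
  assumes "finite E" "\<And>e t. e \<in> E \<Longrightarrow> t > 0 \<Longrightarrow> \<bar>f e t\<bar> \<le> C"
  obtains X l where "\<And>n. X n > 0" "X \<longlonglongrightarrow> 0" "\<And>e. e \<in> E \<Longrightarrow> (\<lambda>n. f e (X n)) \<longlonglongrightarrow> l e"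
proof -
  define Y where "Y = (\<lambda>n. inverse (real (Suc n)))"
  have Y: "Y n > 0" for n by (simp add: Y_def)
  have "\<forall>\<delta>\<subseteq>E. \<exists>l r. strict_mono r \<and> (\<forall>\<eta>>0. \<forall>\<^sub>F n in sequentially. \<forall>i\<in>\<delta>. dist (f i (Y (r n))) (l i) < \<eta>)"
    by (rule compact_lemma_general[where proj = "\<lambda>v i. v i" and unproj = "\<lambda>v. v" and f = "\<lambda>n i. f i (Y n)"])
      (use assms Y in \<open>auto simp: bounded_iff intro!: exI[of _ C]\<close>)
  then obtain l and r :: "nat \<Rightarrow> nat" where r: "strict_mono r"
    "\<And>\<eta>. \<eta> > 0 \<Longrightarrow> \<forall>\<^sub>F n in sequentially. \<forall>i\<in>E. dist (f i (Y (r n))) (l i) < \<eta>"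
    by blast
  have "(Y \<circ> r) \<longlonglongrightarrow> 0"
    unfolding Y_def by (rule LIMSEQ_subseq_LIMSEQ[OF LIMSEQ_inverse_real_of_nat r(1)])
  moreover have "(\<lambda>n. f e ((Y \<circ> r) n)) \<longlonglongrightarrow> l e" if "e \<in> E" for e
    using that by (intro tendstoI eventually_mono[OF r(2)]) auto
  ultimately show ?thesis
    using that[of "Y \<circ> r" l] Y by simp
qed

section \<open>The transport problem in terms of integrals over the domain\<close>

context domain_mesh
begin

lemma D_lebesgue: "D \<in> sets lebesgue" "D \<in> lmeasurable" "D \<in> sets borel"
  using open_D bounded_D by (auto intro: lmeasurable_open)

lemma cell_subset: "K \<in> T \<Longrightarrow> K \<subseteq> D"
  using cells_subset by blast

lemma integrable_D_bounded:
  fixes f :: "real^'d \<Rightarrow> real"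
  assumes "f \<in> borel_measurable (lebesgue_on D)" "\<And>x. x \<in> D \<Longrightarrow> \<bar>f x\<bar> \<le> C"
  shows "integrable (lebesgue_on D) f"
proof -
  interpret finite_measure "lebesgue_on D"
    using D_lebesgue(2) by (rule finite_measure_lebesgue_on)
  show ?thesis
    using assms by (intro integrable_const_bound[where B = C] AE_I2) auto
qed

lemma borel_measurable_D: "f \<in> borel_measurable borel \<Longrightarrow> f \<in> borel_measurable (lebesgue_on D)"
  by (intro measurable_restrict_space1 measurable_completion) simp

lemma piecewise_C1_measurable_D: "u \<in> piecewise_C1 T \<Longrightarrow> u \<in> borel_measurable (lebesgue_on D)"
  by (rule borel_measurable_D[OF piecewise_C1_borel])

lemma cell_integrable:
  fixes f :: "real^'d \<Rightarrow> real"
  assumes "integrable (lebesgue_on D) f" "K \<in> T"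
  shows "integrable (lebesgue_on K) f" "integrable lebesgue (\<lambda>x. indicator K x * f x)"
proof -
  have K: "K \<in> sets lebesgue" using borel_cell[OF assms(2)] by simp
  have "integrable lebesgue (\<lambda>x. indicator D x *\<^sub>R f x)"
    using assms(1) D_lebesgue(1) by (simp add: integrable_restrict_space)
  then have "integrable lebesgue (\<lambda>x. indicator K x *\<^sub>R (indicator D x *\<^sub>R f x))"
    using K by (rule integrable_mult_indicator[rotated])
  moreover have "(\<lambda>x. indicator K x *\<^sub>R (indicator D x *\<^sub>R f x)) = (\<lambda>x. indicator K x * f x)"
    using cell_subset[OF assms(2)] by (auto simp: indicator_def fun_eq_iff)
  ultimately show *: "integrable lebesgue (\<lambda>x. indicator K x * f x)" by (simp only:)
  then show "integrable (lebesgue_on K) f"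
    using K by (simp add: integrable_restrict_space)
qed

text \<open>The disjoint cells fill \<open>D\<close> up to the skeleton, which is a null
  set.\<close>

lemma sum_cells_integral:
  fixes f :: "real^'d \<Rightarrow> real"
  assumes f: "integrable (lebesgue_on D) f"
  shows "(\<Sum>K\<in>T. LINT x|lebesgue_on K. f x) = (LINT x|lebesgue_on D. f x)"
proof -
  have "(LINT x|lebesgue_on K. f x) = (LINT x|lebesgue. indicator K x * f x)" if "K \<in> T" for K
    using borel_cell[OF that] by (subst integral_restrict_space) auto
  then have "(\<Sum>K\<in>T. LINT x|lebesgue_on K. f x) = (\<Sum>K\<in>T. LINT x|lebesgue. indicator K x * f x)"
    by (rule sum.cong[OF refl])
  also have "\<dots> = (LINT x|lebesgue. (\<Sum>K\<in>T. indicator K x * f x))"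
    by (intro Bochner_Integration.integral_sum[symmetric] cell_integrable[OF f])
  also have "\<dots> = (LINT x|lebesgue. indicator D x * f x)"
  proof (rule integral_cong_AE)
    show "(\<lambda>x. \<Sum>K\<in>T. indicator K x * f x) \<in> borel_measurable lebesgue"
      by (intro borel_measurable_sum borel_measurable_integrable cell_integrable[OF f])
    show "(\<lambda>x. indicator D x * f x) \<in> borel_measurable lebesgue"
      using borel_measurable_integrable[OF f] D_lebesgue(1)
      by (simp add: borel_measurable_restrict_space_iff)
    have "AE x in lebesgue. x \<in> D \<longrightarrow> x \<in> \<Union>T"
      by (rule AE_completion[OF AE_in_cells])
    then show "AE x in lebesgue. (\<Sum>K\<in>T. indicator K x * f x) = indicator D x * f x"
    proof eventually_elim
      case (elim x)
      show ?case
      proof (cases "x \<in> \<Union>T")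
        case True
        then obtain K where "K \<in> T" "x \<in> K" by blast
        then show ?thesis
          using sum_indicator_cells[of K x "\<lambda>_. f x"] cells_subset by auto
      next
        case False
        then show ?thesis
          using sum_indicator_cells_zero[of x "\<lambda>_. f x"] elim by auto
      qed
    qed
  qed
  also have "\<dots> = (LINT x|lebesgue_on D. f x)"
    using D_lebesgue(1) by (subst integral_restrict_space) auto
  finally show ?thesis .
qed

lemma integral_D_piecewise:
  assumes "u \<in> piecewise_C1 T"
  shows "(LINT x|lebesgue_on D. u x) = integral\<^sup>L lborel u"
proof -
  have "(LINT x|lebesgue_on D. u x) = (LINT x|lborel. indicator D x * u x)"
    by (rule LINT_lebesgue_on_borel[OF D_lebesgue(3) piecewise_C1_borel[OF assms]])
  also have "(\<lambda>x. indicator D x * u x) = u"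
    using piecewise_C1_zero[OF assms] cells_subset by (auto simp: fun_eq_iff indicator_def)
  finally show ?thesis .
qed

text \<open>The conclusion holds at every point and not just almost everywhere, because
  \<open>u\<close> is continuous on the open cells and fixed to be 0 elsewhere. This makes the
  integral form definite on \<open>W\<close> and lets solutions be unique as functions.\<close>

lemma piecewise_C1_eq_zero:
  assumes u: "u \<in> piecewise_C1 T" and z: "(LINT x|lborel. u x * u x) \<le> 0"
  shows "u x = 0"
proof (rule ccontr)
  assume nz: "u x \<noteq> 0"
  then obtain K where K: "K \<in> T" "x \<in> K"
    using piecewise_C1_zero[OF u, of x] by blast
  define F where "F = (\<lambda>y. u y * u y)"
  define c where "c = F x / 2"
  have c: "c > 0" "c < F x"
    using nz by (auto simp: c_def F_def zero_less_mult_iff)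
  have "isCont F x"
    unfolding F_def using isCont_cell[OF u K] by (intro continuous_mult)
  then have "\<forall>\<^sub>F y in nhds x. c < F y"
    using order_tendstoD(1)[of F "F x" "nhds x" c] c(2)
    by (simp add: isCont_def tendsto_at_iff_tendsto_nhds)
  then obtain r where r: "r > 0" "\<And>y. dist y x < r \<Longrightarrow> c < F y"
    by (auto simp: eventually_nhds_metric)
  have "0 < c * measure lborel (ball x r)"
    using r(1) c by (simp add: content_ball_pos)
  also have "\<dots> = (LINT y|lborel. indicator (ball x r) y * c)"
    by simp
  also have "\<dots> \<le> (LINT y|lborel. F y)"
  proof (rule integral_mono)
    show "integrable lborel (\<lambda>y. indicator (ball x r) y * c)"
      by (intro integrable_lborel_bounded[where B = "ball x r" and M = "\<bar>c\<bar>"]) (auto simp: indicator_def)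
    show "integrable lborel F"
      unfolding F_def by (intro piecewise_C1_integrable piecewise_C1_mult u)
    show "indicator (ball x r) y * c \<le> F y" for y
      using r(2)[of y] by (auto simp: indicator_def dist_commute F_def)
  qed
  finally show False
    using z by (simp add: F_def)
qed

text \<open>The volume term that remains of the transport form when one argument is continuous and
  zero on the boundary.\<close>

definition grad_form :: "real^'d \<Rightarrow> (real^'d \<Rightarrow> real) \<Rightarrow> (real^'d \<Rightarrow> real) \<Rightarrow> real" where
  "grad_form \<omega> u v = (\<Sum>K\<in>T. LINT x|lebesgue_on K. u x * (\<omega> \<bullet> grad v x))"

lemma grad_integrable:
  assumes u: "u \<in> piecewise_C1 T" and v: "v \<in> piecewise_C1 T" and K: "K \<in> T"
  shows "integrable (lebesgue_on K) (\<lambda>x. u x * (\<omega> \<bullet> grad v x))"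
proof -
  obtain G where G: "continuous_on UNIV G" "\<And>x. x \<in> K \<Longrightarrow> grad v x = G x"
    by (rule piecewise_C1_derivative[OF v K]) blast
  obtain N where N: "\<And>x. \<bar>u x\<bar> \<le> N" "N \<ge> 0"
    by (rule piecewise_C1_bounded[OF u]) blast
  have [measurable]: "G \<in> borel_measurable borel"
    by (rule borel_measurable_continuous_onI[OF G(1)])
  note [measurable] = borel_cell[OF K] piecewise_C1_borel[OF u]
  have "compact (G ` closure K)"
    using G(1) bounded_cell[OF K] by (intro compact_continuous_image) (auto intro: continuous_on_subset)
  then obtain R where R: "\<And>x. x \<in> closure K \<Longrightarrow> norm (G x) \<le> R"
    using compact_imp_bounded by (force simp: bounded_iff)
  have "integrable lborel (\<lambda>x. indicator K x * (u x * (\<omega> \<bullet> G x)))"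
  proof (rule integrable_lborel_bounded[where B = K and M = "N * (norm \<omega> * \<bar>R\<bar>)"])
    show "\<bar>indicator K x * (u x * (\<omega> \<bullet> G x))\<bar> \<le> N * (norm \<omega> * \<bar>R\<bar>)" for x
    proof (cases "x \<in> K")
      case True
      have "\<bar>\<omega> \<bullet> G x\<bar> \<le> norm \<omega> * norm (G x)"
        by (rule Cauchy_Schwarz_ineq2)
      also have "\<dots> \<le> norm \<omega> * \<bar>R\<bar>"
        using R[of x] True closure_subset by (intro mult_left_mono) (auto intro: order_trans[OF _ abs_ge_self])
      finally have "\<bar>u x\<bar> * \<bar>\<omega> \<bullet> G x\<bar> \<le> N * (norm \<omega> * \<bar>R\<bar>)"
        using N by (intro mult_mono) auto
      then show ?thesis using True by (simp add: abs_mult)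
    qed (use N in simp)
  qed (use bounded_cell[OF K] in auto)
  then have "integrable lebesgue (\<lambda>x. indicator K x * (u x * (\<omega> \<bullet> G x)))"
    by (subst integrable_completion) auto
  then have "integrable (lebesgue_on K) (\<lambda>x. u x * (\<omega> \<bullet> G x))"
    by (subst integrable_restrict_space) auto
  then show ?thesis
    by (rule Bochner_Integration.integrable_cong[THEN iffD1, rotated 2]) (auto simp: G(2))
qed

lemma grad_form_sum:
  assumes "finite E" "\<And>e. e \<in> E \<Longrightarrow> f e \<in> piecewise_C1 T" "v \<in> piecewise_C1 T"
  shows "grad_form \<omega> (\<lambda>x. \<Sum>e\<in>E. c e * f e x) v = (\<Sum>e\<in>E. c e * grad_form \<omega> (f e) v)"
proof -
  have "(LINT x|lebesgue_on K. (\<Sum>e\<in>E. c e * f e x) * (\<omega> \<bullet> grad v x))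
      = (\<Sum>e\<in>E. c e * (LINT x|lebesgue_on K. f e x * (\<omega> \<bullet> grad v x)))" if K: "K \<in> T" for K
  proof -
    have "(LINT x|lebesgue_on K. (\<Sum>e\<in>E. c e * f e x) * (\<omega> \<bullet> grad v x))
        = (LINT x|lebesgue_on K. (\<Sum>e\<in>E. c e * (f e x * (\<omega> \<bullet> grad v x))))"
      by (simp add: sum_distrib_right mult.assoc)
    also have "\<dots> = (\<Sum>e\<in>E. c e * (LINT x|lebesgue_on K. f e x * (\<omega> \<bullet> grad v x)))"
      using grad_integrable[OF assms(2,3) K] by (subst Bochner_Integration.integral_sum) auto
    finally show ?thesis .
  qed
  then have "grad_form \<omega> (\<lambda>x. \<Sum>e\<in>E. c e * f e x) v
      = (\<Sum>K\<in>T. \<Sum>e\<in>E. c e * (LINT x|lebesgue_on K. f e x * (\<omega> \<bullet> grad v x)))"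
    by (simp add: grad_form_def)
  also have "\<dots> = (\<Sum>e\<in>E. c e * grad_form \<omega> (f e) v)"
    by (subst sum.swap) (simp add: grad_form_def sum_distrib_left)
  finally show ?thesis .
qed

lemma grad_form_diff_right:
  assumes "u \<in> piecewise_C1 T" "v \<in> piecewise_C1 T" "z \<in> piecewise_C1 T"
  shows "grad_form \<omega> u (\<lambda>x. v x - z x) = grad_form \<omega> u v - grad_form \<omega> u z"
proof -
  have "(LINT x|lebesgue_on K. u x * (\<omega> \<bullet> grad (\<lambda>x. v x - z x) x))
      = (LINT x|lebesgue_on K. u x * (\<omega> \<bullet> grad v x)) - (LINT x|lebesgue_on K. u x * (\<omega> \<bullet> grad z x))"
    if K: "K \<in> T" for K
  proof -
    obtain G where G: "\<And>x. x \<in> K \<Longrightarrow> grad v x = G x" "\<And>x. x \<in> K \<Longrightarrow> (v has_derivative (\<lambda>h. G x \<bullet> h)) (at x)"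
      by (rule piecewise_C1_derivative[OF assms(2) K]) blast
    obtain H where H: "\<And>x. x \<in> K \<Longrightarrow> grad z x = H x" "\<And>x. x \<in> K \<Longrightarrow> (z has_derivative (\<lambda>h. H x \<bullet> h)) (at x)"
      by (rule piecewise_C1_derivative[OF assms(3) K]) blast
    have gd: "grad (\<lambda>x. v x - z x) x = grad v x - grad z x" if x: "x \<in> K" for x
    proof -
      have "((\<lambda>x. v x - z x) has_derivative (\<lambda>h. G x \<bullet> h - H x \<bullet> h)) (at x)"
        by (rule has_derivative_diff[OF G(2)[OF x] H(2)[OF x]])
      then have "frechet_derivative (\<lambda>x. v x - z x) (at x) = (\<lambda>h. G x \<bullet> h - H x \<bullet> h)"
        using frechet_derivative_at by metis
      then show ?thesis
        by (simp add: grad_def[of "\<lambda>x. v x - z x"] G(1)[OF x] H(1)[OF x] vec_eq_iff inner_axis)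
    qed
    have "(LINT x|lebesgue_on K. u x * (\<omega> \<bullet> grad (\<lambda>x. v x - z x) x))
        = (LINT x|lebesgue_on K. u x * (\<omega> \<bullet> grad v x) - u x * (\<omega> \<bullet> grad z x))"
      by (intro Bochner_Integration.integral_cong refl) (simp add: gd inner_diff_right right_diff_distrib)
    also have "\<dots> = (LINT x|lebesgue_on K. u x * (\<omega> \<bullet> grad v x)) - (LINT x|lebesgue_on K. u x * (\<omega> \<bullet> grad z x))"
      by (intro Bochner_Integration.integral_diff grad_integrable assms K)
    finally show ?thesis .
  qed
  then show ?thesis
    by (simp add: grad_form_def sum_subtractf)
qed

end

text \<open>The second moment appears in vector form, as it acts on fluxes and shifts.
  \<open>C\<sigma>\<close> is a common bound for both coefficients.\<close>

locale transport_problem = domain_mesh T D for T :: "(real^'d) set set" and D +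
  fixes mt :: mesh_type and w :: "'m::finite \<Rightarrow> real" and \<Omega> :: "'m \<Rightarrow> real^'d"
    and \<sigma>s \<sigma>a q :: "real^'d \<Rightarrow> real" and \<delta>s \<delta>a C\<sigma> :: real
    and W :: "('m \<Rightarrow> real^'d \<Rightarrow> real) set"
  assumes w_pos: "w j > 0" and w_sum: "(\<Sum>j\<in>UNIV. w j) = 1"
    and first_moment: "(\<Sum>j\<in>UNIV. w j *\<^sub>R \<Omega> j) = 0"
    and second_moment: "(\<Sum>j\<in>UNIV. (w j * (\<Omega> j \<bullet> a)) *\<^sub>R \<Omega> j) = (1/3) *\<^sub>R a"
    and \<sigma>_measurable: "\<sigma>s \<in> borel_measurable (lebesgue_on D)" "\<sigma>a \<in> borel_measurable (lebesgue_on D)"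
    and \<sigma>_bound: "\<And>x. x \<in> D \<Longrightarrow> \<bar>\<sigma>s x\<bar> \<le> C\<sigma>" "\<And>x. x \<in> D \<Longrightarrow> \<bar>\<sigma>a x\<bar> \<le> C\<sigma>"
    and \<sigma>_lower: "\<And>x. x \<in> D \<Longrightarrow> \<delta>s \<le> \<sigma>s x" "\<And>x. x \<in> D \<Longrightarrow> \<delta>a \<le> \<sigma>a x"
    and \<delta>_pos: "\<delta>s > 0" "\<delta>a > 0"
    and q_measurable: "q \<in> borel_measurable (lebesgue_on D)"
    and q_square: "integrable (lebesgue_on D) (\<lambda>x. (q x)\<^sup>2)"
    and W_subspace: "linear_subspace_of (VV_h mt T) W"
    and W_flux: "dot_flux_space w \<Omega> W \<subseteq> W"
begin

lemma W_piecewise: "v \<in> W \<Longrightarrow> v j \<in> piecewise_C1 T"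
  using W_subspace V_h_subset_piecewise_C1[of mt T] by (auto simp: linear_subspace_of_def VV_h_def)

lemma avg_piecewise: "(\<And>j. v j \<in> piecewise_C1 T) \<Longrightarrow> avg w v \<in> piecewise_C1 T"
  unfolding avg_def by (intro piecewise_C1_sum piecewise_C1_cmult)

lemma W_avg: "v \<in> W \<Longrightarrow> avg w v \<in> piecewise_C1 T"
  by (rule avg_piecewise[OF W_piecewise])

lemma W_add: "u \<in> W \<Longrightarrow> v \<in> W \<Longrightarrow> (\<lambda>j x. u j x + v j x) \<in> W"
  and W_cmult: "u \<in> W \<Longrightarrow> (\<lambda>j x. c * u j x) \<in> W"
  and W_zero: "(\<lambda>j x. 0) \<in> W"
  using W_subspace by (auto simp: linear_subspace_of_def)

lemma W_diff: "u \<in> W \<Longrightarrow> v \<in> W \<Longrightarrow> (\<lambda>j x. u j x - v j x) \<in> W"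
  using W_add[OF _ W_cmult[of v "-1"], of u] by simp

lemma W_dot_flux: "y \<in> W \<Longrightarrow> (\<lambda>j x. \<Omega> j \<bullet> flux w \<Omega> y x) \<in> W"
  using W_flux by (auto simp: dot_flux_space_def flux_space_def)

text \<open>Up to the factor \<open>1/3\<close>, the product with \<Omega> is a right inverse of
  \<open>flux\<close>; this is how a flux is represented by an element of \<open>W\<close>.\<close>

lemma flux_dot: "flux w \<Omega> (\<lambda>j x. \<Omega> j \<bullet> \<zeta> x) = (\<lambda>x. (1/3) *\<^sub>R \<zeta> x)"
  by (simp add: flux_def second_moment)

lemma avg_dot: "avg w (\<lambda>j x. \<Omega> j \<bullet> \<zeta> x) x = 0"
proof -
  have "avg w (\<lambda>j x. \<Omega> j \<bullet> \<zeta> x) x = (\<Sum>j\<in>UNIV. w j *\<^sub>R \<Omega> j) \<bullet> \<zeta> x"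
    by (simp add: avg_def inner_sum_left)
  then show ?thesis by (simp add: first_moment)
qed

lemma inner_flux: "a \<bullet> flux w \<Omega> v x = (\<Sum>j\<in>UNIV. w j * (v j x * (\<Omega> j \<bullet> a)))"
  by (simp add: flux_def inner_sum_right inner_commute mult.assoc)

lemma flux_const: "flux w \<Omega> (\<lambda>j x. g x) = (\<lambda>x. 0)"
proof
  fix x
  have "flux w \<Omega> (\<lambda>j x. g x) x = g x *\<^sub>R (\<Sum>j\<in>UNIV. w j *\<^sub>R \<Omega> j)"
    by (simp add: flux_def scaleR_sum_right mult.commute)
  then show "flux w \<Omega> (\<lambda>j x. g x) x = 0" by (simp add: first_moment)
qed

lemma flux_cmult: "flux w \<Omega> (\<lambda>j x. c * v j x) x = c *\<^sub>R flux w \<Omega> v x"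
  by (simp add: flux_def scaleR_sum_right mult.left_commute)

lemma flux_diff: "flux w \<Omega> (\<lambda>j x. u j x - v j x) x = flux w \<Omega> u x - flux w \<Omega> v x"
  by (simp add: flux_def sum_subtractf algebra_simps)

lemma avg_diff: "avg w (\<lambda>j x. u j x - v j x) x = avg w u x - avg w v x"
  by (simp add: avg_def sum_subtractf algebra_simps)

lemma weighted_integrable:
  assumes "h \<in> borel_measurable (lebesgue_on D)" "\<And>x. x \<in> D \<Longrightarrow> \<bar>h x\<bar> \<le> C" "u \<in> piecewise_C1 T"
  shows "integrable (lebesgue_on D) (\<lambda>x. h x * u x)"
proof -
  obtain N where N: "\<And>x. \<bar>u x\<bar> \<le> N" "N \<ge> 0"
    by (rule piecewise_C1_bounded[OF assms(3)]) blast
  show ?thesis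
  proof (rule integrable_D_bounded)
    show "(\<lambda>x. h x * u x) \<in> borel_measurable (lebesgue_on D)"
      using assms(1) piecewise_C1_measurable_D[OF assms(3)] by (rule borel_measurable_times)
    show "\<bar>h x * u x\<bar> \<le> C * N" if "x \<in> D" for x
      unfolding abs_mult using assms(2)[OF that] N order_trans[OF abs_ge_zero assms(2)[OF that]]
      by (intro mult_mono) auto
  qed
qed

lemmas \<sigma>s_integrable = weighted_integrable[OF \<sigma>_measurable(1) \<sigma>_bound(1)]
lemmas \<sigma>a_integrable = weighted_integrable[OF \<sigma>_measurable(2) \<sigma>_bound(2)]

text \<open>The estimate \<open>\<bar>q\<bar> \<le> 1 + q^2\<close> reduces the claim to square
  integrability of \<open>q\<close> on the bounded set \<open>D\<close>.\<close>

lemma q_integrable: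
  assumes "u \<in> piecewise_C1 T"
  shows "integrable (lebesgue_on D) (\<lambda>x. q x * u x)"
proof -
  obtain N where N: "\<And>x. \<bar>u x\<bar> \<le> N" "N \<ge> 0"
    by (rule piecewise_C1_bounded[OF assms]) blast
  have "integrable (lebesgue_on D) (\<lambda>x. 1 :: real)"
    by (rule integrable_D_bounded[where C = 1]) auto
  then have int: "integrable (lebesgue_on D) (\<lambda>x. (1 + (q x)\<^sup>2) * N)"
    using q_square by (intro integrable_mult_left Bochner_Integration.integrable_add)
  show ?thesis
  proof (rule Bochner_Integration.integrable_bound[OF int])
    show "(\<lambda>x. q x * u x) \<in> borel_measurable (lebesgue_on D)"
      using q_measurable piecewise_C1_measurable_D[OF assms] by (rule borel_measurable_times)
    show "AE x in lebesgue_on D. norm (q x * u x) \<le> norm ((1 + (q x)\<^sup>2) * N)"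
    proof (rule AE_I2)
      fix x
      have "\<bar>q x\<bar> \<le> 1 + (q x)\<^sup>2"
      proof (cases "\<bar>q x\<bar> \<le> 1")
        case False
        then have "\<bar>q x\<bar> * 1 \<le> \<bar>q x\<bar> * \<bar>q x\<bar>" by (intro mult_left_mono) auto
        then show ?thesis by (simp add: power2_eq_square flip: abs_mult)
      qed (simp add: add_increasing2)
      then have "\<bar>q x\<bar> * \<bar>u x\<bar> \<le> (1 + (q x)\<^sup>2) * N"
        using N by (intro mult_mono) auto
      then show "norm (q x * u x) \<le> norm ((1 + (q x)\<^sup>2) * N)"
        using N(2) by (simp add: abs_mult)
    qed
  qed
qed

definition transport_sum :: "('m \<Rightarrow> real^'d \<Rightarrow> real) \<Rightarrow> ('m \<Rightarrow> real^'d \<Rightarrow> real) \<Rightarrow> real" where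
  "transport_sum u v = (\<Sum>j\<in>UNIV. w j * (\<Sum>K\<in>T. cell_form D (\<Omega> j) K (u j) (v j)))"

definition scattering :: "('m \<Rightarrow> real^'d \<Rightarrow> real) \<Rightarrow> ('m \<Rightarrow> real^'d \<Rightarrow> real) \<Rightarrow> real" where
  "scattering u v = (LINT x|lebesgue_on D. \<sigma>s x * (\<Sum>j\<in>UNIV. w j * ((u j x - avg w u x) * v j x)))"

definition absorption :: "('m \<Rightarrow> real^'d \<Rightarrow> real) \<Rightarrow> ('m \<Rightarrow> real^'d \<Rightarrow> real) \<Rightarrow> real" where
  "absorption u v = (LINT x|lebesgue_on D. \<sigma>a x * (\<Sum>j\<in>UNIV. w j * (u j x * v j x)))"

text \<open>Separates the powers of \<epsilon>. The two terms with \<open>\<sigma>s\<close> merge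
  into one that depends on \<open>u\<close> only through its deviation from the average.\<close>

lemma B_form_eq:
  assumes u: "\<And>j. u j \<in> piecewise_C1 T" and v: "\<And>j. v j \<in> piecewise_C1 T"
  shows "B_form D T w \<Omega> \<sigma>s \<sigma>a \<epsilon> u v = transport_sum u v + (1 / \<epsilon>) * scattering u v + \<epsilon> * absorption u v"
proof -
  let ?P = "\<lambda>j x. (\<sigma>s x / \<epsilon> + \<epsilon> * \<sigma>a x) * u j x * v j x"
  let ?R = "\<lambda>j x. \<sigma>s x / \<epsilon> * avg w u x * v j x"
  have uv: "(\<lambda>x. u j x * v j x) \<in> piecewise_C1 T" "(\<lambda>x. avg w u x * v j x) \<in> piecewise_C1 T" for j
    by (intro piecewise_C1_mult u v avg_piecewise)+
  have P: "integrable (lebesgue_on D) (?P j)" for j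
  proof -
    have "?P j = (\<lambda>x. (1 / \<epsilon>) * (\<sigma>s x * (u j x * v j x)) + \<epsilon> * (\<sigma>a x * (u j x * v j x)))"
      by (simp add: fun_eq_iff algebra_simps)
    then show ?thesis
      using \<sigma>s_integrable[OF _ uv(1)] \<sigma>a_integrable[OF _ uv(1)] by simp
  qed
  have R: "integrable (lebesgue_on D) (?R j)" for j
  proof -
    have "?R j = (\<lambda>x. (1 / \<epsilon>) * (\<sigma>s x * (avg w u x * v j x)))"
      by (simp add: fun_eq_iff algebra_simps)
    then show ?thesis
      using \<sigma>s_integrable[OF _ uv(2)] by simp
  qed
  have "B_form D T w \<Omega> \<sigma>s \<sigma>a \<epsilon> u v
      = (\<Sum>K\<in>T. \<Sum>j\<in>UNIV. w j * (cell_form D (\<Omega> j) K (u j) (v j)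
          + (LINT x|lebesgue_on K. ?P j x) - (LINT x|lebesgue_on K. ?R j x)))"
    unfolding B_form_def cell_form_def ..
  also have "\<dots> = (\<Sum>j\<in>UNIV. w j * (\<Sum>K\<in>T. cell_form D (\<Omega> j) K (u j) (v j)
          + (LINT x|lebesgue_on K. ?P j x) - (LINT x|lebesgue_on K. ?R j x)))"
    by (subst sum.swap) (simp add: sum_distrib_left)
  also have "\<dots> = (\<Sum>j\<in>UNIV. w j * ((\<Sum>K\<in>T. cell_form D (\<Omega> j) K (u j) (v j))
          + (LINT x|lebesgue_on D. ?P j x) - (LINT x|lebesgue_on D. ?R j x)))"
    by (simp only: sum.distrib sum_subtractf sum_cells_integral[OF P] sum_cells_integral[OF R])
  also have "\<dots> = transport_sum u v + (\<Sum>j\<in>UNIV. LINT x|lebesgue_on D. w j * (?P j x - ?R j x))"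
  proof -
    have "w j * (c + (LINT x|lebesgue_on D. ?P j x) - (LINT x|lebesgue_on D. ?R j x))
        = w j * c + (LINT x|lebesgue_on D. w j * (?P j x - ?R j x))" for j c
      unfolding integral_mult_right_zero Bochner_Integration.integral_diff[OF P R] by (simp only: add_diff_eq[symmetric] distrib_left)
    then show ?thesis
      by (simp only: transport_sum_def sum.distrib)
  qed
  also have "(\<Sum>j\<in>UNIV. LINT x|lebesgue_on D. w j * (?P j x - ?R j x))
      = (LINT x|lebesgue_on D. (\<Sum>j\<in>UNIV. w j * (?P j x - ?R j x)))"
    using P R by (intro Bochner_Integration.integral_sum[symmetric]) auto
  also have "\<dots> = (LINT x|lebesgue_on D. (1 / \<epsilon>) * (\<sigma>s x * (\<Sum>j\<in>UNIV. w j * ((u j x - avg w u x) * v j x)))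
      + \<epsilon> * (\<sigma>a x * (\<Sum>j\<in>UNIV. w j * (u j x * v j x))))"
    by (intro Bochner_Integration.integral_cong refl)
      (simp add: sum_distrib_left algebra_simps flip: sum.distrib sum_subtractf)
  also have "\<dots> = (1 / \<epsilon>) * scattering u v + \<epsilon> * absorption u v"
  proof -
    have "(\<lambda>x. \<Sum>j\<in>UNIV. w j * ((u j x - avg w u x) * v j x)) \<in> piecewise_C1 T"
    proof (intro piecewise_C1_sum piecewise_C1_cmult piecewise_C1_mult v)
      show "(\<lambda>x. u j x - avg w u x) \<in> piecewise_C1 T" for j
        using piecewise_C1_add[OF u[of j] piecewise_C1_cmult[OF avg_piecewise[of u, OF u], of "-1"]] by simp
    qed
    moreover have "(\<lambda>x. \<Sum>j\<in>UNIV. w j * (u j x * v j x)) \<in> piecewise_C1 T"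
      by (intro piecewise_C1_sum piecewise_C1_cmult piecewise_C1_mult u v)
    ultimately show ?thesis
      unfolding scattering_def absorption_def
      using \<sigma>s_integrable \<sigma>a_integrable by (subst Bochner_Integration.integral_add) auto
  qed
  finally show ?thesis by simp
qed

lemma Q_form_eq:
  assumes v: "\<And>j. v j \<in> piecewise_C1 T"
  shows "Q_form T w q \<epsilon> v = \<epsilon> * (LINT x|lebesgue_on D. q x * avg w v x)"
proof -
  have int: "integrable (lebesgue_on D) (\<lambda>x. \<epsilon> * q x * v j x)" for j
    using q_integrable[OF v[of j]] by (simp add: mult.assoc)
  have "Q_form T w q \<epsilon> v = (\<Sum>j\<in>UNIV. w j * (\<Sum>K\<in>T. LINT x|lebesgue_on K. \<epsilon> * q x * v j x))"
    unfolding Q_form_def by (subst sum.swap) (simp add: sum_distrib_left)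
  also have "\<dots> = (\<Sum>j\<in>UNIV. LINT x|lebesgue_on D. w j * (\<epsilon> * q x * v j x))"
    by (simp only: sum_cells_integral[OF int] integral_mult_right_zero)
  also have "\<dots> = (LINT x|lebesgue_on D. (\<Sum>j\<in>UNIV. w j * (\<epsilon> * q x * v j x)))"
    using int by (intro Bochner_Integration.integral_sum[symmetric]) auto
  also have "\<dots> = (LINT x|lebesgue_on D. \<epsilon> * (q x * avg w v x))"
    by (intro Bochner_Integration.integral_cong refl) (simp add: avg_def sum_distrib_left mult_ac)
  finally show ?thesis by simp
qed

lemma flux_grad_form:
  assumes z: "\<And>j. z j \<in> piecewise_C1 T" and \<phi>: "\<phi> \<in> piecewise_C1 T"
  shows "(\<Sum>K\<in>T. LINT x|lebesgue_on K. flux w \<Omega> z x \<bullet> grad \<phi> x) = (\<Sum>j\<in>UNIV. w j * grad_form (\<Omega> j) (z j) \<phi>)"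
    and "K \<in> T \<Longrightarrow> integrable (lebesgue_on K) (\<lambda>x. flux w \<Omega> z x \<bullet> grad \<phi> x)"
proof -
  have eq: "(\<lambda>x. flux w \<Omega> z x \<bullet> grad \<phi> x) = (\<lambda>x. \<Sum>j\<in>UNIV. w j * (z j x * (\<Omega> j \<bullet> grad \<phi> x)))"
    by (simp add: fun_eq_iff inner_commute[of "flux w \<Omega> z _"] inner_flux)
  show "integrable (lebesgue_on K) (\<lambda>x. flux w \<Omega> z x \<bullet> grad \<phi> x)" if "K \<in> T"
    unfolding eq using grad_integrable[OF z \<phi> that] by (intro Bochner_Integration.integrable_sum) auto
  have "(LINT x|lebesgue_on K. flux w \<Omega> z x \<bullet> grad \<phi> x) = (\<Sum>j\<in>UNIV. w j * (LINT x|lebesgue_on K. z j x * (\<Omega> j \<bullet> grad \<phi> x)))"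
    if "K \<in> T" for K
    unfolding eq using grad_integrable[OF z \<phi> that] by (subst Bochner_Integration.integral_sum) auto
  then have "(\<Sum>K\<in>T. LINT x|lebesgue_on K. flux w \<Omega> z x \<bullet> grad \<phi> x)
      = (\<Sum>K\<in>T. \<Sum>j\<in>UNIV. w j * (LINT x|lebesgue_on K. z j x * (\<Omega> j \<bullet> grad \<phi> x)))"
    by (rule sum.cong[OF refl])
  also have "\<dots> = (\<Sum>j\<in>UNIV. w j * grad_form (\<Omega> j) (z j) \<phi>)"
    by (subst sum.swap) (simp add: grad_form_def sum_distrib_left)
  finally show "(\<Sum>K\<in>T. LINT x|lebesgue_on K. flux w \<Omega> z x \<bullet> grad \<phi> x) = (\<Sum>j\<in>UNIV. w j * grad_form (\<Omega> j) (z j) \<phi>)" .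
qed

lemma flux_inner_piecewise:
  assumes "\<And>j. z j \<in> piecewise_C1 T" "\<And>j. y j \<in> piecewise_C1 T"
  shows "(\<lambda>x. flux w \<Omega> z x \<bullet> flux w \<Omega> y x) \<in> piecewise_C1 T"
proof -
  have "(\<lambda>x. flux w \<Omega> z x \<bullet> flux w \<Omega> y x)
      = (\<lambda>x. \<Sum>j\<in>UNIV. w j * (y j x * (\<Sum>i\<in>UNIV. (w i * (\<Omega> i \<bullet> \<Omega> j)) * z i x)))"
    unfolding inner_flux by (simp add: flux_def inner_sum_right inner_commute mult_ac)
  also have "\<dots> \<in> piecewise_C1 T"
    by (intro piecewise_C1_sum piecewise_C1_cmult piecewise_C1_mult assms)
  finally show ?thesis .
qed

text \<open>Here and in the second equation the flux is given as \<open>flux w \<Omega> z\<close>,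
  so that both equations become linear in elements of \<open>W\<close> and pass to limits of
  coordinates.\<close>

lemma first_mixed_form:
  assumes z: "\<And>j. z j \<in> piecewise_C1 T" and u: "u \<in> piecewise_C1 T" and \<phi>: "\<phi> \<in> piecewise_C1 T"
  shows "(\<Sum>K\<in>T. LINT x|lebesgue_on K. - (flux w \<Omega> z x \<bullet> grad \<phi> x) + \<sigma>a x * u x * \<phi> x)
    = - (\<Sum>j\<in>UNIV. w j * grad_form (\<Omega> j) (z j) \<phi>) + (LINT x|lebesgue_on D. \<sigma>a x * (u x * \<phi> x))"
proof -
  have int: "integrable (lebesgue_on D) (\<lambda>x. \<sigma>a x * (u x * \<phi> x))"
    using \<sigma>a_integrable[OF _ piecewise_C1_mult[OF u \<phi>]] by simp
  have "(LINT x|lebesgue_on K. - (flux w \<Omega> z x \<bullet> grad \<phi> x) + \<sigma>a x * u x * \<phi> x)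
      = - (LINT x|lebesgue_on K. flux w \<Omega> z x \<bullet> grad \<phi> x) + (LINT x|lebesgue_on K. \<sigma>a x * (u x * \<phi> x))" if K: "K \<in> T" for K
    using flux_grad_form(2)[OF z \<phi> K] cell_integrable(1)[OF int K] by (simp add: mult.assoc)
  then have "(\<Sum>K\<in>T. LINT x|lebesgue_on K. - (flux w \<Omega> z x \<bullet> grad \<phi> x) + \<sigma>a x * u x * \<phi> x)
      = (\<Sum>K\<in>T. - (LINT x|lebesgue_on K. flux w \<Omega> z x \<bullet> grad \<phi> x) + (LINT x|lebesgue_on K. \<sigma>a x * (u x * \<phi> x)))"
    by (rule sum.cong[OF refl])
  also have "\<dots> = - (\<Sum>K\<in>T. LINT x|lebesgue_on K. flux w \<Omega> z x \<bullet> grad \<phi> x) + (\<Sum>K\<in>T. LINT x|lebesgue_on K. \<sigma>a x * (u x * \<phi> x))"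
    by (simp only: sum.distrib sum_negf)
  finally show ?thesis
    by (simp only: flux_grad_form(1)[OF z \<phi>] sum_cells_integral[OF int])
qed

lemma second_mixed_form:
  assumes z: "\<And>j. z j \<in> piecewise_C1 T" and y: "\<And>j. y j \<in> piecewise_C1 T" and u: "u \<in> piecewise_C1 T"
  shows "(\<Sum>K\<in>T. LINT x|lebesgue_on K. ((1/3) *\<^sub>R grad u x + \<sigma>s x *\<^sub>R flux w \<Omega> z x) \<bullet> flux w \<Omega> y x)
    = (1/3) * (\<Sum>j\<in>UNIV. w j * grad_form (\<Omega> j) (y j) u) + (LINT x|lebesgue_on D. \<sigma>s x * (flux w \<Omega> z x \<bullet> flux w \<Omega> y x))"
proof -
  have int: "integrable (lebesgue_on D) (\<lambda>x. \<sigma>s x * (flux w \<Omega> z x \<bullet> flux w \<Omega> y x))"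
    using \<sigma>s_integrable[OF _ flux_inner_piecewise[OF z y]] by simp
  have "(LINT x|lebesgue_on K. ((1/3) *\<^sub>R grad u x + \<sigma>s x *\<^sub>R flux w \<Omega> z x) \<bullet> flux w \<Omega> y x)
      = (1/3) * (LINT x|lebesgue_on K. flux w \<Omega> y x \<bullet> grad u x) + (LINT x|lebesgue_on K. \<sigma>s x * (flux w \<Omega> z x \<bullet> flux w \<Omega> y x))"
    if K: "K \<in> T" for K
  proof -
    have "(LINT x|lebesgue_on K. ((1/3) *\<^sub>R grad u x + \<sigma>s x *\<^sub>R flux w \<Omega> z x) \<bullet> flux w \<Omega> y x)
        = (LINT x|lebesgue_on K. (1/3) * (flux w \<Omega> y x \<bullet> grad u x) + \<sigma>s x * (flux w \<Omega> z x \<bullet> flux w \<Omega> y x))"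
      by (intro Bochner_Integration.integral_cong refl) (simp add: inner_add_left inner_add_right inner_commute)
    also have "\<dots> = (LINT x|lebesgue_on K. (1/3) * (flux w \<Omega> y x \<bullet> grad u x)) + (LINT x|lebesgue_on K. \<sigma>s x * (flux w \<Omega> z x \<bullet> flux w \<Omega> y x))"
      using flux_grad_form(2)[where z = y, OF y u K] cell_integrable(1)[OF int K]
      by (intro Bochner_Integration.integral_add integrable_mult_right)
    finally show ?thesis by (simp only: integral_mult_right_zero)
  qed
  then have "(\<Sum>K\<in>T. LINT x|lebesgue_on K. ((1/3) *\<^sub>R grad u x + \<sigma>s x *\<^sub>R flux w \<Omega> z x) \<bullet> flux w \<Omega> y x)
      = (\<Sum>K\<in>T. (1/3) * (LINT x|lebesgue_on K. flux w \<Omega> y x \<bullet> grad u x) + (LINT x|lebesgue_on K. \<sigma>s x * (flux w \<Omega> z x \<bullet> flux w \<Omega> y x)))"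
    by (rule sum.cong[OF refl])
  also have "\<dots> = (1/3) * (\<Sum>K\<in>T. LINT x|lebesgue_on K. flux w \<Omega> y x \<bullet> grad u x) + (\<Sum>K\<in>T. LINT x|lebesgue_on K. \<sigma>s x * (flux w \<Omega> z x \<bullet> flux w \<Omega> y x))"
    by (simp only: sum.distrib sum_distrib_left)
  finally show ?thesis
    by (simp only: flux_grad_form(1)[OF y u] sum_cells_integral[OF int])
qed

end

section \<open>The diffusion limit\<close>

definition comb :: "('m \<Rightarrow> 'x \<Rightarrow> real) set \<Rightarrow> (('m \<Rightarrow> 'x \<Rightarrow> real) \<Rightarrow> real) \<Rightarrow> 'm \<Rightarrow> 'x \<Rightarrow> real" where
  "comb E c = (\<lambda>j x. \<Sum>e\<in>E. c e * e j x)"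

text \<open>With finitely many bounded functions, the distance of two combinations is bounded,
  uniformly in \<open>x\<close>, by the distances of their coefficients.\<close>

lemma uniform_limit_comb:
  fixes g :: "'e \<Rightarrow> 'x \<Rightarrow> 'b::real_normed_vector"
  assumes "finite E" and bound: "\<And>e. e \<in> E \<Longrightarrow> \<exists>M. \<forall>x\<in>S. norm (g e x) \<le> M"
    and lim: "\<And>e. e \<in> E \<Longrightarrow> (a e \<longlongrightarrow> l e) F"
  shows "uniform_limit S (\<lambda>t x. \<Sum>e\<in>E. a e t *\<^sub>R g e x) (\<lambda>x. \<Sum>e\<in>E. l e *\<^sub>R g e x) F"
proof (rule uniform_limitI)
  fix \<eta> :: real assume \<eta>: "\<eta> > 0"
  obtain M where M: "\<forall>e\<in>E. \<forall>x\<in>S. norm (g e x) \<le> M e"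
    using bchoice[of E "\<lambda>e M. \<forall>x\<in>S. norm (g e x) \<le> M"] bound by blast
  have "((\<lambda>t. \<Sum>e\<in>E. \<bar>a e t - l e\<bar> * \<bar>M e\<bar>) \<longlongrightarrow> (\<Sum>e\<in>E. \<bar>l e - l e\<bar> * \<bar>M e\<bar>)) F"
    by (intro tendsto_sum tendsto_mult tendsto_rabs tendsto_diff lim tendsto_const)
  then have "\<forall>\<^sub>F t in F. (\<Sum>e\<in>E. \<bar>a e t - l e\<bar> * \<bar>M e\<bar>) < \<eta>"
    using \<eta> by (intro order_tendstoD(2)) auto
  then show "\<forall>\<^sub>F t in F. \<forall>x\<in>S. dist (\<Sum>e\<in>E. a e t *\<^sub>R g e x) (\<Sum>e\<in>E. l e *\<^sub>R g e x) < \<eta>"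
  proof eventually_elim
    case (elim t)
    show ?case
    proof
      fix x assume x: "x \<in> S"
      have "dist (\<Sum>e\<in>E. a e t *\<^sub>R g e x) (\<Sum>e\<in>E. l e *\<^sub>R g e x) = norm (\<Sum>e\<in>E. (a e t - l e) *\<^sub>R g e x)"
        by (simp add: dist_norm sum_subtractf scaleR_diff_left)
      also have "\<dots> \<le> (\<Sum>e\<in>E. \<bar>a e t - l e\<bar> * \<bar>M e\<bar>)"
      proof (rule sum_norm_le)
        fix e assume "e \<in> E"
        then have "norm (g e x) \<le> \<bar>M e\<bar>"
          using M x by (meson abs_ge_self order_trans)
        then show "norm ((a e t - l e) *\<^sub>R g e x) \<le> \<bar>a e t - l e\<bar> * \<bar>M e\<bar>"
          by (simp add: mult_left_mono)
      qed
      finally show "dist (\<Sum>e\<in>E. a e t *\<^sub>R g e x) (\<Sum>e\<in>E. l e *\<^sub>R g e x) < \<eta>"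
        using elim by simp
    qed
  qed
qed

context transport_problem
begin

lemma comb_in_W: "finite E \<Longrightarrow> E \<subseteq> W \<Longrightarrow> comb E c \<in> W"
proof (induction E rule: finite_induct)
  case empty
  then show ?case by (simp add: comb_def W_zero)
next
  case (insert e E)
  then have "(\<lambda>j x. c e * e j x + comb E c j x) \<in> W"
    using W_cmult by (intro W_add) auto
  moreover have "comb (insert e E) c = (\<lambda>j x. c e * e j x + comb E c j x)"
    using insert by (simp add: comb_def)
  ultimately show ?case by simp
qed

lemma avg_comb: "avg w (comb E c) x = (\<Sum>e\<in>E. c e * avg w e x)"
  unfolding avg_def comb_def sum_distrib_left by (subst sum.swap) (simp add: mult.left_commute)

lemma flux_comb: "flux w \<Omega> (comb E c) x = (\<Sum>e\<in>E. c e *\<^sub>R flux w \<Omega> e x)"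
proof -
  have "flux w \<Omega> (comb E c) x = (\<Sum>j\<in>UNIV. \<Sum>e\<in>E. (w j * (c e * e j x)) *\<^sub>R \<Omega> j)"
    by (simp add: flux_def comb_def sum_distrib_left scaleR_sum_left)
  also have "\<dots> = (\<Sum>e\<in>E. \<Sum>j\<in>UNIV. (w j * (c e * e j x)) *\<^sub>R \<Omega> j)"
    by (rule sum.swap)
  also have "\<dots> = (\<Sum>e\<in>E. c e *\<^sub>R flux w \<Omega> e x)"
    by (simp add: flux_def scaleR_sum_right mult.left_commute)
  finally show ?thesis .
qed

lemma weighted_sum_integral:
  assumes "h \<in> borel_measurable (lebesgue_on D)" "\<And>x. x \<in> D \<Longrightarrow> \<bar>h x\<bar> \<le> C"
    and "\<And>e. e \<in> E \<Longrightarrow> f e \<in> piecewise_C1 T"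
  shows "(LINT x|lebesgue_on D. h x * (\<Sum>e\<in>E. c e * f e x)) = (\<Sum>e\<in>E. c e * (LINT x|lebesgue_on D. h x * f e x))"
proof -
  have "(LINT x|lebesgue_on D. h x * (\<Sum>e\<in>E. c e * f e x)) = (LINT x|lebesgue_on D. (\<Sum>e\<in>E. c e * (h x * f e x)))"
    by (simp add: sum_distrib_left mult.left_commute)
  also have "\<dots> = (\<Sum>e\<in>E. LINT x|lebesgue_on D. c e * (h x * f e x))"
    by (intro Bochner_Integration.integral_sum integrable_mult_right weighted_integrable[OF assms(1,2) assms(3)])
  finally show ?thesis by simp
qed

lemma scattering_comb:
  assumes "E \<subseteq> W" "v \<in> W"
  shows "scattering (comb E c) v = (\<Sum>e\<in>E. c e * scattering e v)"
proof -
  have "(\<Sum>j\<in>UNIV. w j * ((comb E c j x - avg w (comb E c) x) * v j x))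
      = (\<Sum>e\<in>E. c e * (\<Sum>j\<in>UNIV. w j * ((e j x - avg w e x) * v j x)))" for x
  proof -
    have "(\<Sum>j\<in>UNIV. w j * ((comb E c j x - avg w (comb E c) x) * v j x))
        = (\<Sum>j\<in>UNIV. \<Sum>e\<in>E. c e * (w j * ((e j x - avg w e x) * v j x)))"
      unfolding avg_comb by (simp add: comb_def flip: sum_subtractf)
        (simp add: sum_distrib_left sum_distrib_right algebra_simps)
    also have "\<dots> = (\<Sum>e\<in>E. c e * (\<Sum>j\<in>UNIV. w j * ((e j x - avg w e x) * v j x)))"
      by (subst sum.swap) (simp add: sum_distrib_left)
    finally show ?thesis .
  qed
  then have "scattering (comb E c) v
      = (LINT x|lebesgue_on D. \<sigma>s x * (\<Sum>e\<in>E. c e * (\<Sum>j\<in>UNIV. w j * ((e j x - avg w e x) * v j x))))"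
    by (simp add: scattering_def)
  also have "\<dots> = (\<Sum>e\<in>E. c e * scattering e v)"
    unfolding scattering_def
  proof (rule weighted_sum_integral[OF \<sigma>_measurable(1) \<sigma>_bound(1)])
    fix e assume e: "e \<in> E"
    have "(\<lambda>x. e j x - avg w e x) \<in> piecewise_C1 T" for j
      using piecewise_C1_add[OF W_piecewise[of e j] piecewise_C1_cmult[OF W_avg[of e], of "-1"]] e assms by auto
    then show "(\<lambda>x. \<Sum>j\<in>UNIV. w j * ((e j x - avg w e x) * v j x)) \<in> piecewise_C1 T"
      by (intro piecewise_C1_sum piecewise_C1_cmult piecewise_C1_mult W_piecewise[OF assms(2)])
  qed
  finally show ?thesis .
qed

lemma absorption_comb:
  assumes "E \<subseteq> W" "v \<in> W"
  shows "absorption (comb E c) v = (\<Sum>e\<in>E. c e * absorption e v)"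
proof -
  have "(\<Sum>j\<in>UNIV. w j * (comb E c j x * v j x)) = (\<Sum>e\<in>E. c e * (\<Sum>j\<in>UNIV. w j * (e j x * v j x)))" for x
  proof -
    have "(\<Sum>j\<in>UNIV. w j * (comb E c j x * v j x)) = (\<Sum>j\<in>UNIV. \<Sum>e\<in>E. c e * (w j * (e j x * v j x)))"
      by (simp add: comb_def sum_distrib_left sum_distrib_right algebra_simps)
    also have "\<dots> = (\<Sum>e\<in>E. c e * (\<Sum>j\<in>UNIV. w j * (e j x * v j x)))"
      by (subst sum.swap) (simp add: sum_distrib_left)
    finally show ?thesis .
  qed
  then have "absorption (comb E c) v
      = (LINT x|lebesgue_on D. \<sigma>a x * (\<Sum>e\<in>E. c e * (\<Sum>j\<in>UNIV. w j * (e j x * v j x))))"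
    by (simp add: absorption_def)
  also have "\<dots> = (\<Sum>e\<in>E. c e * absorption e v)"
    unfolding absorption_def
  proof (rule weighted_sum_integral[OF \<sigma>_measurable(2) \<sigma>_bound(2)])
    fix e assume "e \<in> E"
    then show "(\<lambda>x. \<Sum>j\<in>UNIV. w j * (e j x * v j x)) \<in> piecewise_C1 T"
      using assms by (intro piecewise_C1_sum piecewise_C1_cmult piecewise_C1_mult W_piecewise) auto
  qed
  finally show ?thesis .
qed

lemma flux_integral_comb:
  assumes "E \<subseteq> W" "y \<in> W"
  shows "(LINT x|lebesgue_on D. \<sigma>s x * (flux w \<Omega> (comb E c) x \<bullet> flux w \<Omega> y x))
    = (\<Sum>e\<in>E. c e * (LINT x|lebesgue_on D. \<sigma>s x * (flux w \<Omega> e x \<bullet> flux w \<Omega> y x)))"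
proof -
  have "(LINT x|lebesgue_on D. \<sigma>s x * (flux w \<Omega> (comb E c) x \<bullet> flux w \<Omega> y x))
      = (LINT x|lebesgue_on D. \<sigma>s x * (\<Sum>e\<in>E. c e * (flux w \<Omega> e x \<bullet> flux w \<Omega> y x)))"
    by (simp add: flux_comb inner_sum_left)
  also have "\<dots> = (\<Sum>e\<in>E. c e * (LINT x|lebesgue_on D. \<sigma>s x * (flux w \<Omega> e x \<bullet> flux w \<Omega> y x)))"
    using assms
    by (intro weighted_sum_integral[OF \<sigma>_measurable(1) \<sigma>_bound(1)] flux_inner_piecewise W_piecewise) auto
  finally show ?thesis .
qed

lemma transport_sum_comb:
  assumes "finite E" "E \<subseteq> W" "v \<in> W"
  shows "transport_sum (comb E c) v = (\<Sum>e\<in>E. c e * transport_sum e v)"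
proof -
  have "transport_sum (comb E c) v = (\<Sum>j\<in>UNIV. w j * (\<Sum>e\<in>E. c e * (\<Sum>K\<in>T. cell_form D (\<Omega> j) K (e j) (v j))))"
    unfolding transport_sum_def comb_def
    using assms by (intro sum.cong refl arg_cong[where f = "(*) _"] cell_form_linear_trial W_piecewise) auto
  also have "\<dots> = (\<Sum>j\<in>UNIV. \<Sum>e\<in>E. c e * (w j * (\<Sum>K\<in>T. cell_form D (\<Omega> j) K (e j) (v j))))"
    by (simp add: sum_distrib_left[of "w _"] mult.left_commute)
  also have "\<dots> = (\<Sum>e\<in>E. c e * transport_sum e v)"
    by (subst sum.swap) (simp add: transport_sum_def sum_distrib_left)
  finally show ?thesis .
qed

lemma grad_form_comb:
  assumes "finite E" "E \<subseteq> W" "\<phi> \<in> piecewise_C1 T"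
  shows "(\<Sum>j\<in>UNIV. w j * grad_form (\<Omega> j) (comb E c j) \<phi>) = (\<Sum>e\<in>E. c e * (\<Sum>j\<in>UNIV. w j * grad_form (\<Omega> j) (e j) \<phi>))"
proof -
  have "grad_form (\<Omega> j) (comb E c j) \<phi> = (\<Sum>e\<in>E. c e * grad_form (\<Omega> j) (e j) \<phi>)" for j
    unfolding comb_def using assms(2) by (intro grad_form_sum assms(1,3) W_piecewise[of e j for e]) auto
  then have "(\<Sum>j\<in>UNIV. w j * grad_form (\<Omega> j) (comb E c j) \<phi>) = (\<Sum>j\<in>UNIV. w j * (\<Sum>e\<in>E. c e * grad_form (\<Omega> j) (e j) \<phi>))"
    by simp
  also have "\<dots> = (\<Sum>j\<in>UNIV. \<Sum>e\<in>E. c e * (w j * grad_form (\<Omega> j) (e j) \<phi>))"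
    by (simp add: sum_distrib_left[of "w _"] mult.left_commute)
  also have "\<dots> = (\<Sum>e\<in>E. c e * (\<Sum>j\<in>UNIV. w j * grad_form (\<Omega> j) (e j) \<phi>))"
    by (subst sum.swap) (simp add: sum_distrib_left)
  finally show ?thesis .
qed

definition ip :: "('m \<Rightarrow> real^'d \<Rightarrow> real) \<Rightarrow> ('m \<Rightarrow> real^'d \<Rightarrow> real) \<Rightarrow> real" where
  "ip u v = (LINT x|lborel. (\<Sum>j\<in>UNIV. w j * (u j x * v j x)))"

text \<open>The variance at the point \<open>x\<close> of the angular values \<open>u j x\<close>
  with respect to the weights.\<close>

definition deviation :: "('m \<Rightarrow> real^'d \<Rightarrow> real) \<Rightarrow> real^'d \<Rightarrow> real" where
  "deviation u x = (\<Sum>j\<in>UNIV. w j * ((u j x - avg w u x) * (u j x - avg w u x)))"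

lemma weighted_nonneg: "(\<And>j. f j \<ge> 0) \<Longrightarrow> (\<Sum>j\<in>UNIV. w j * f j) \<ge> 0"
  using less_imp_le[OF w_pos] by (intro sum_nonneg mult_nonneg_nonneg) auto

lemma avg_apply: "avg w v x = (\<Sum>j\<in>UNIV. w j * v j x)"
  by (simp add: avg_def)

lemma deviation_nonneg: "deviation u x \<ge> 0"
  unfolding deviation_def by (intro weighted_nonneg zero_le_square)

lemma sum_deviation_zero: "(\<Sum>j\<in>UNIV. w j * (u j x - avg w u x)) = 0"
  by (simp add: right_diff_distrib sum_subtractf w_sum avg_def flip: sum_distrib_right)

lemma deviation_eq: "(\<Sum>j\<in>UNIV. w j * ((u j x - avg w u x) * u j x)) = deviation u x"
proof -
  have "(\<Sum>j\<in>UNIV. w j * ((u j x - avg w u x) * u j x))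
      = deviation u x + (\<Sum>j\<in>UNIV. w j * (u j x - avg w u x)) * avg w u x"
    unfolding deviation_def sum_distrib_right sum.distrib[symmetric]
    by (intro sum.cong refl) (simp add: algebra_simps)
  then show ?thesis by (simp add: sum_deviation_zero)
qed

lemma square_decomposition: "(\<Sum>j\<in>UNIV. w j * (u j x * u j x)) = deviation u x + avg w u x * avg w u x"
proof -
  have "(\<Sum>j\<in>UNIV. w j * (u j x * u j x)) = (\<Sum>j\<in>UNIV. w j * ((u j x - avg w u x) * u j x)) + (\<Sum>j\<in>UNIV. w j * u j x) * avg w u x"
    unfolding sum_distrib_right sum.distrib[symmetric]
    by (intro sum.cong refl) (simp add: algebra_simps)
  then show ?thesis by (simp only: deviation_eq avg_apply[symmetric])
qed

lemma second_moment_inner: "(\<Sum>j\<in>UNIV. w j * ((\<Omega> j \<bullet> a) * (\<Omega> j \<bullet> b))) = (a \<bullet> b) / 3"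
proof -
  have "(\<Sum>j\<in>UNIV. (w j * (\<Omega> j \<bullet> a)) *\<^sub>R \<Omega> j) \<bullet> b = ((1/3) *\<^sub>R a) \<bullet> b"
    by (simp only: second_moment)
  then show ?thesis by (simp add: inner_sum_left mult.assoc)
qed

text \<open>A Bessel inequality for the angular functions
  \<open>\<Omega> j \<bullet> \<zeta>\<close>, whose second moment is \<open>1/3\<close>. The
  average has no flux, so the deviation alone counts; its best approximation by such functions
  carries the factor 3, and the weighted square of the remainder is nonnegative.\<close>

lemma flux_square_le: "flux w \<Omega> u x \<bullet> flux w \<Omega> u x \<le> deviation u x / 3"
proof -
  define \<zeta> where "\<zeta> = flux w \<Omega> u x"
  have \<zeta>2: "(\<Sum>j\<in>UNIV. w j * ((u j x - avg w u x) * (\<Omega> j \<bullet> \<zeta>))) = \<zeta> \<bullet> \<zeta>"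
  proof -
    have "\<zeta> = flux w \<Omega> (\<lambda>j x. u j x - avg w u x) x"
      using flux_diff[of u "\<lambda>j. avg w u" x] by (simp add: \<zeta>_def flux_const)
    then show ?thesis
      using inner_flux[of \<zeta> "\<lambda>j x. u j x - avg w u x" x] by simp
  qed
  have "0 \<le> (\<Sum>j\<in>UNIV. w j * ((u j x - avg w u x) - 3 * (\<Omega> j \<bullet> \<zeta>))\<^sup>2)"
    by (intro weighted_nonneg zero_le_power2)
  also have "\<dots> = deviation u x - 6 * (\<Sum>j\<in>UNIV. w j * ((u j x - avg w u x) * (\<Omega> j \<bullet> \<zeta>))) + 9 * (\<Sum>j\<in>UNIV. w j * ((\<Omega> j \<bullet> \<zeta>) * (\<Omega> j \<bullet> \<zeta>)))"
    unfolding deviation_def sum_distrib_left sum_subtractf[symmetric] sum.distrib[symmetric]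
    by (intro sum.cong refl) (simp add: power2_eq_square algebra_simps)
  also have "\<dots> = deviation u x - 3 * (\<zeta> \<bullet> \<zeta>)"
    unfolding \<zeta>2 second_moment_inner by simp
  finally show ?thesis by (simp add: \<zeta>_def)
qed

lemma deviation_piecewise:
  assumes "\<And>j. u j \<in> piecewise_C1 T"
  shows "deviation u \<in> piecewise_C1 T" "(\<lambda>x. u j x - avg w u x) \<in> piecewise_C1 T"
proof -
  show *: "(\<lambda>x. u j x - avg w u x) \<in> piecewise_C1 T" for j
    using piecewise_C1_add[OF assms piecewise_C1_cmult[OF avg_piecewise[of u, OF assms], of "-1"]] by simp
  show "deviation u \<in> piecewise_C1 T"
    unfolding deviation_def[abs_def] by (intro piecewise_C1_sum piecewise_C1_cmult piecewise_C1_mult *)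
qed

lemma square_sum_piecewise:
  assumes "\<And>j. u j \<in> piecewise_C1 T" "\<And>j. v j \<in> piecewise_C1 T"
  shows "(\<lambda>x. \<Sum>j\<in>UNIV. w j * (u j x * v j x)) \<in> piecewise_C1 T"
  by (intro piecewise_C1_sum piecewise_C1_cmult piecewise_C1_mult assms)

lemma square_sum_zero:
  assumes u: "\<And>j. u j \<in> piecewise_C1 T" and z: "(LINT x|lborel. (\<Sum>j\<in>UNIV. w j * (u j x * u j x))) \<le> 0"
  shows "u j x = 0"
proof (rule piecewise_C1_eq_zero[OF u])
  have int: "integrable lborel (\<lambda>x. w i * (u i x * u i x))" for i
    by (intro integrable_mult_right piecewise_C1_integrable piecewise_C1_mult u)
  have "w j * (LINT x|lborel. u j x * u j x) = (LINT x|lborel. w j * (u j x * u j x))"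
    by simp
  also have "\<dots> \<le> (LINT x|lborel. (\<Sum>j\<in>UNIV. w j * (u j x * u j x)))"
  proof (rule integral_mono)
    show "w j * (u j x * u j x) \<le> (\<Sum>j\<in>UNIV. w j * (u j x * u j x))" for x
      using less_imp_le[OF w_pos] by (intro member_le_sum mult_nonneg_nonneg zero_le_square) auto
  qed (intro Bochner_Integration.integrable_sum int)+
  finally show "(LINT x|lborel. u j x * u j x) \<le> 0"
    using z w_pos[of j] by (smt (verit) mult_pos_pos)
qed

lemma weighted_lower_bound:
  assumes "h \<in> borel_measurable (lebesgue_on D)" "\<And>x. x \<in> D \<Longrightarrow> \<bar>h x\<bar> \<le> C" "\<And>x. x \<in> D \<Longrightarrow> \<delta> \<le> h x"
    and u: "u \<in> piecewise_C1 T" "\<And>x. u x \<ge> 0"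
  shows "\<delta> * (LINT x|lborel. u x) \<le> (LINT x|lebesgue_on D. h x * u x)"
proof -
  have "\<delta> * (LINT x|lborel. u x) = (LINT x|lebesgue_on D. \<delta> * u x)"
    using integral_D_piecewise[OF u(1)] by simp
  also have "\<dots> \<le> (LINT x|lebesgue_on D. h x * u x)"
  proof (rule integral_mono)
    show "integrable (lebesgue_on D) (\<lambda>x. \<delta> * u x)"
      by (rule weighted_integrable[where C = "\<bar>\<delta>\<bar>"]) (use u in auto)
    show "integrable (lebesgue_on D) (\<lambda>x. h x * u x)"
      by (rule weighted_integrable[OF assms(1,2) u(1)])
    show "\<delta> * u x \<le> h x * u x" if "x \<in> space (lebesgue_on D)" for x
      using that assms(3)[of x] u(2)[of x] by (intro mult_right_mono) auto
  qed
  finally show ?thesis .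
qed

text \<open>Definiteness holds because the weights are positive and an element of \<open>W\<close>
  with vanishing norm is 0 at every point.\<close>

lemma inner_subspace_W: "inner_subspace (\<lambda>c (v :: 'm \<Rightarrow> real^'d \<Rightarrow> real). (\<lambda>j x. c * v j x)) W ip"
proof unfold_locales
  have int: "integrable lborel (\<lambda>x. \<Sum>j\<in>UNIV. w j * (u j x * v j x))" if "u \<in> W" "v \<in> W" for u v
    using that by (intro piecewise_C1_integrable square_sum_piecewise W_piecewise)
  show "function_space.subspace W"
    unfolding function_space.subspace_def using W_zero W_add W_cmult
    by (auto simp: zero_fun_def plus_fun_def)
  show "ip (u + v) z = ip u z + ip v z" if "u \<in> W" "v \<in> W" "z \<in> W" for u v z
    unfolding ip_def Bochner_Integration.integral_add[OF int[OF that(1,3)] int[OF that(2,3)], symmetric]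
    by (simp add: sum.distrib algebra_simps)
  show "ip (\<lambda>j x. c * u j x) z = c * ip u z" for c u z
    unfolding ip_def integral_mult_right_zero[symmetric] by (simp add: sum_distrib_left mult_ac)
  show "ip u v = ip v u" for u v
    by (simp add: ip_def mult.commute)
  show "ip u u \<ge> 0" for u
    unfolding ip_def by (intro integral_nonneg_AE AE_I2 weighted_nonneg zero_le_square)
  show "u = 0" if "u \<in> W" "ip u u = 0" for u
  proof -
    have "u j x = 0" for j x
      by (rule square_sum_zero[OF W_piecewise[OF that(1)]]) (use that(2) in \<open>simp add: ip_def\<close>)
    then show ?thesis by (intro ext) simp
  qed
qed

lemma transport_sum_nonneg:
  assumes "\<And>j. u j \<in> piecewise_C1 T"
  shows "transport_sum u u \<ge> 0"
  unfolding transport_sum_def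
  by (intro weighted_nonneg transport_energy_nonneg assms cells_subset)

lemma scattering_self:
  assumes "\<And>j. u j \<in> piecewise_C1 T"
  shows "\<delta>s * (LINT x|lborel. deviation u x) \<le> scattering u u"
  unfolding scattering_def deviation_eq
  by (rule weighted_lower_bound[OF \<sigma>_measurable(1) \<sigma>_bound(1) \<sigma>_lower(1) deviation_piecewise(1)[of u, OF assms] deviation_nonneg])

lemma scattering_isotropic:
  assumes "\<And>j. v j = \<phi>"
  shows "scattering u v = 0"
proof -
  have "(\<Sum>j\<in>UNIV. w j * ((u j x - avg w u x) * v j x)) = 0" for x
  proof -
    have "(\<Sum>j\<in>UNIV. w j * ((u j x - avg w u x) * v j x)) = (\<Sum>j\<in>UNIV. w j * (u j x - avg w u x)) * \<phi> x"
      by (simp add: assms sum_distrib_right mult.assoc)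
    then show ?thesis by (simp add: sum_deviation_zero)
  qed
  then show ?thesis by (simp add: scattering_def)
qed

text \<open>The average has no flux, so this kind of test function extracts the flux of
  \<open>u\<close> from the scattering term.\<close>

lemma scattering_dot: "scattering u (\<lambda>j x. \<Omega> j \<bullet> \<zeta> x) = (LINT x|lebesgue_on D. \<sigma>s x * (flux w \<Omega> u x \<bullet> \<zeta> x))"
proof -
  have "(\<Sum>j\<in>UNIV. w j * ((u j x - avg w u x) * (\<Omega> j \<bullet> \<zeta> x))) = flux w \<Omega> u x \<bullet> \<zeta> x" for x
    using inner_flux[of "\<zeta> x" "\<lambda>j x. u j x - avg w u x" x] flux_diff[of u "\<lambda>j. avg w u" x]
    by (simp add: flux_const inner_commute)
  then show ?thesis by (simp add: scattering_def)
qed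

section \<open>A priori bounds uniform in \<epsilon>\<close>

definition q_norm :: real where
  "q_norm = (LINT x|lebesgue_on D. (q x)\<^sup>2)"

text \<open>With the solution as test function, transport is nonnegative, scattering controls the
  deviation with factor \<open>\<delta>s / \<epsilon>\<close>, and absorption controls the norm with
  factor \<open>\<epsilon> * \<delta>a\<close>. Half of the absorption is used up by the source; the
  rest bounds both quantities.\<close>

lemma solution_bounds:
  assumes \<epsilon>: "\<epsilon> > 0" and u: "u \<in> W" and eq: "B_form D T w \<Omega> \<sigma>s \<sigma>a \<epsilon> u u = Q_form T w q \<epsilon> u"
  shows "ip u u \<le> q_norm / \<delta>a\<^sup>2" "(LINT x|lborel. deviation u x) \<le> \<epsilon>\<^sup>2 * (q_norm / (2 * \<delta>a * \<delta>s))"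
proof -
  note pw = W_piecewise[OF u]
  note sq = square_sum_piecewise[of u u, OF pw pw]
  define d where "d = (LINT x|lborel. deviation u x)"
  have d: "d \<ge> 0"
    unfolding d_def by (intro integral_nonneg_AE AE_I2 deviation_nonneg)
  have ip0: "ip u u \<ge> 0"
    unfolding ip_def by (intro integral_nonneg_AE AE_I2 weighted_nonneg zero_le_square)
  have ab: "\<delta>a * ip u u \<le> absorption u u"
    unfolding absorption_def ip_def
    by (rule weighted_lower_bound[OF \<sigma>_measurable(2) \<sigma>_bound(2) \<sigma>_lower(2) sq])
      (assumption | intro weighted_nonneg zero_le_square)+
  have "(LINT x|lebesgue_on D. q x * avg w u x) \<le> (LINT x|lebesgue_on D. (1 / (2 * \<delta>a)) * (q x)\<^sup>2 + (\<delta>a / 2) * (\<Sum>j\<in>UNIV. w j * (u j x * u j x)))"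
  proof (rule integral_mono)
    show "integrable (lebesgue_on D) (\<lambda>x. q x * avg w u x)"
      by (rule q_integrable[OF W_avg[OF u]])
    have "integrable (lebesgue_on D) (\<lambda>x. (\<delta>a / 2) * (\<Sum>j\<in>UNIV. w j * (u j x * u j x)))"
      by (rule weighted_integrable[where C = "\<bar>\<delta>a / 2\<bar>"]) (use sq in auto)
    then show "integrable (lebesgue_on D) (\<lambda>x. (1 / (2 * \<delta>a)) * (q x)\<^sup>2 + (\<delta>a / 2) * (\<Sum>j\<in>UNIV. w j * (u j x * u j x)))"
      by (rule Bochner_Integration.integrable_add[OF integrable_mult_right[OF q_square]])
    fix x
    have "avg w u x * avg w u x \<le> (\<Sum>j\<in>UNIV. w j * (u j x * u j x))"
      unfolding square_decomposition using deviation_nonneg by simp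
    \<comment> \<open>Young's inequality, balanced so that exactly half of the absorption is
      consumed.\<close>
    moreover have "q x * avg w u x \<le> (1 / (2 * \<delta>a)) * (q x)\<^sup>2 + (\<delta>a / 2) * (avg w u x * avg w u x)"
    proof -
      have "0 \<le> (q x - \<delta>a * avg w u x)\<^sup>2 / (2 * \<delta>a)"
        using \<delta>_pos by simp
      also have "\<dots> = (1 / (2 * \<delta>a)) * (q x)\<^sup>2 + (\<delta>a / 2) * (avg w u x * avg w u x) - q x * avg w u x"
        using \<delta>_pos by (simp add: power2_eq_square field_simps)
      finally show ?thesis by simp
    qed
    ultimately show "q x * avg w u x \<le> (1 / (2 * \<delta>a)) * (q x)\<^sup>2 + (\<delta>a / 2) * (\<Sum>j\<in>UNIV. w j * (u j x * u j x))"
      using \<delta>_pos by (smt (verit) divide_pos_pos mult_left_mono)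
  qed
  also have "\<dots> = q_norm / (2 * \<delta>a) + (\<delta>a / 2) * ip u u"
  proof -
    have "integrable (lebesgue_on D) (\<lambda>x. (\<delta>a / 2) * (\<Sum>j\<in>UNIV. w j * (u j x * u j x)))"
      by (rule weighted_integrable[where C = "\<bar>\<delta>a / 2\<bar>"]) (use sq in auto)
    then have "(LINT x|lebesgue_on D. (1 / (2 * \<delta>a)) * (q x)\<^sup>2 + (\<delta>a / 2) * (\<Sum>j\<in>UNIV. w j * (u j x * u j x)))
        = (LINT x|lebesgue_on D. (1 / (2 * \<delta>a)) * (q x)\<^sup>2) + (LINT x|lebesgue_on D. (\<delta>a / 2) * (\<Sum>j\<in>UNIV. w j * (u j x * u j x)))"
      by (rule Bochner_Integration.integral_add[OF integrable_mult_right[OF q_square]])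
    also have "\<dots> = q_norm / (2 * \<delta>a) + (\<delta>a / 2) * ip u u"
      unfolding integral_mult_right_zero integral_D_piecewise[OF sq] by (simp add: q_norm_def ip_def)
    finally show ?thesis .
  qed
  finally have qb: "(LINT x|lebesgue_on D. q x * avg w u x) \<le> q_norm / (2 * \<delta>a) + (\<delta>a / 2) * ip u u" .
  have "transport_sum u u + (1 / \<epsilon>) * scattering u u + \<epsilon> * absorption u u = \<epsilon> * (LINT x|lebesgue_on D. q x * avg w u x)"
    using eq unfolding B_form_eq[of u u, OF pw pw] Q_form_eq[of u, OF pw] .
  moreover have "(1 / \<epsilon>) * (\<delta>s * d) \<le> (1 / \<epsilon>) * scattering u u"
    using scattering_self[of u, OF pw] \<epsilon> by (intro mult_left_mono) (auto simp: d_def)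
  moreover have "\<epsilon> * (\<delta>a * ip u u) \<le> \<epsilon> * absorption u u"
    using ab \<epsilon> by (intro mult_left_mono) auto
  moreover have "\<epsilon> * (LINT x|lebesgue_on D. q x * avg w u x) \<le> \<epsilon> * (q_norm / (2 * \<delta>a) + (\<delta>a / 2) * ip u u)"
    using qb \<epsilon> by (intro mult_left_mono) auto
  ultimately have "(1 / \<epsilon>) * (\<delta>s * d) + \<epsilon> * (\<delta>a * ip u u) \<le> \<epsilon> * (q_norm / (2 * \<delta>a) + (\<delta>a / 2) * ip u u)"
    using transport_sum_nonneg[of u, OF pw] by linarith
  then have main: "(1 / \<epsilon>) * (\<delta>s * d) + \<epsilon> * ((\<delta>a / 2) * ip u u) \<le> \<epsilon> * (q_norm / (2 * \<delta>a))"
    by (simp add: algebra_simps)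
  have "\<epsilon> * ((\<delta>a / 2) * ip u u) \<le> \<epsilon> * (q_norm / (2 * \<delta>a))"
    using main d \<delta>_pos \<epsilon> by (smt (verit) divide_pos_pos mult_nonneg_nonneg)
  then have "(\<delta>a / 2) * ip u u \<le> q_norm / (2 * \<delta>a)"
    using \<epsilon> by (simp only: mult_le_cancel_left_pos)
  then show "ip u u \<le> q_norm / \<delta>a\<^sup>2"
    using \<delta>_pos by (simp add: field_simps power2_eq_square)
  have "(1 / \<epsilon>) * (\<delta>s * d) \<le> \<epsilon> * (q_norm / (2 * \<delta>a))"
    using main ip0 \<delta>_pos \<epsilon> by (smt (verit) divide_pos_pos mult_nonneg_nonneg)
  then show "d \<le> \<epsilon>\<^sup>2 * (q_norm / (2 * \<delta>a * \<delta>s))"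
    using \<delta>_pos \<epsilon> by (simp add: field_simps power2_eq_square)
qed

text \<open>The 9 combines the second moment \<open>1/3\<close> with the factor \<open>1/3\<close>
  of the flux estimate. As the integrated deviation is of order \<open>\<epsilon>^2\<close>, the
  right-hand side stays bounded for solutions.\<close>

lemma scaled_flux_bound:
  assumes "\<epsilon> > 0" "u \<in> W"
  shows "ip (\<lambda>j x. (1 / \<epsilon>) * (\<Omega> j \<bullet> flux w \<Omega> u x)) (\<lambda>j x. (1 / \<epsilon>) * (\<Omega> j \<bullet> flux w \<Omega> u x))
    \<le> (1 / \<epsilon>\<^sup>2) * ((LINT x|lborel. deviation u x) / 9)"
proof -
  note pw = W_piecewise[OF assms(2)]
  have pt: "(\<Sum>j\<in>UNIV. w j * ((1 / \<epsilon>) * (\<Omega> j \<bullet> flux w \<Omega> u x) * ((1 / \<epsilon>) * (\<Omega> j \<bullet> flux w \<Omega> u x))))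
      = (1 / \<epsilon>\<^sup>2) * ((flux w \<Omega> u x \<bullet> flux w \<Omega> u x) / 3)" for x
    unfolding second_moment_inner[symmetric] sum_distrib_left
    by (intro sum.cong refl) (simp add: power2_eq_square)
  have "ip (\<lambda>j x. (1 / \<epsilon>) * (\<Omega> j \<bullet> flux w \<Omega> u x)) (\<lambda>j x. (1 / \<epsilon>) * (\<Omega> j \<bullet> flux w \<Omega> u x))
      = (LINT x|lborel. (1 / \<epsilon>\<^sup>2) * ((flux w \<Omega> u x \<bullet> flux w \<Omega> u x) / 3))"
    by (simp only: ip_def pt)
  also have "\<dots> \<le> (LINT x|lborel. (1 / \<epsilon>\<^sup>2) * (deviation u x / 9))"
  proof (rule integral_mono)
    show "integrable lborel (\<lambda>x. (1 / \<epsilon>\<^sup>2) * ((flux w \<Omega> u x \<bullet> flux w \<Omega> u x) / 3))"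
      using piecewise_C1_integrable[OF flux_inner_piecewise[of u u, OF pw pw]] by simp
    show "integrable lborel (\<lambda>x. (1 / \<epsilon>\<^sup>2) * (deviation u x / 9))"
      using piecewise_C1_integrable[OF deviation_piecewise(1)[of u, OF pw]] by simp
    show "(1 / \<epsilon>\<^sup>2) * ((flux w \<Omega> u x \<bullet> flux w \<Omega> u x) / 3) \<le> (1 / \<epsilon>\<^sup>2) * (deviation u x / 9)" for x
      using flux_square_le[of u x] by (intro mult_left_mono) auto
  qed
  also have "\<dots> = (1 / \<epsilon>\<^sup>2) * ((LINT x|lborel. deviation u x) / 9)"
    by simp
  finally show ?thesis .
qed

section \<open>The mixed problem and uniqueness of its solution\<close>

abbreviation "C0 \<equiv> C_h_zero mt D T w \<inter> W"
abbreviation "Z0 \<equiv> flux_space w \<Omega> W"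

lemma C0_iff: "v \<in> C0 \<longleftrightarrow> v \<in> W \<and> (\<forall>j. v j = avg w v) \<and> continuous_zero (avg w v)"
  using W_subspace by (auto simp: C_h_zero_def isotropic_def continuous_zero_def linear_subspace_of_def)

text \<open>Every test flux is \<open>flux w \<Omega> y\<close> for some \<open>y \<in> W\<close>,
  so the quantifier over fluxes becomes one over \<open>W\<close>.\<close>

lemma mixed_solution_iff:
  assumes z: "z \<in> W"
  shows "mixed_solution D T w \<sigma>s \<sigma>a q C0 Z0 u (flux w \<Omega> z) \<longleftrightarrow> u \<in> C0 \<and>
    (\<forall>\<phi>\<in>C0. - (\<Sum>j\<in>UNIV. w j * grad_form (\<Omega> j) (z j) (avg w \<phi>)) + (LINT x|lebesgue_on D. \<sigma>a x * (avg w u x * avg w \<phi> x))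
      = (LINT x|lebesgue_on D. q x * avg w \<phi> x)) \<and>
    (\<forall>y\<in>W. (1/3) * (\<Sum>j\<in>UNIV. w j * grad_form (\<Omega> j) (y j) (avg w u)) + (LINT x|lebesgue_on D. \<sigma>s x * (flux w \<Omega> z x \<bullet> flux w \<Omega> y x)) = 0)"
proof (cases "u \<in> C0")
  case True
  then have u: "avg w u \<in> piecewise_C1 T" by (simp add: W_avg)
  have 1: "(\<Sum>K\<in>T. LINT x|lebesgue_on K. - (flux w \<Omega> z x \<bullet> grad (avg w \<phi>) x) + \<sigma>a x * avg w u x * avg w \<phi> x)
    = - (\<Sum>j\<in>UNIV. w j * grad_form (\<Omega> j) (z j) (avg w \<phi>)) + (LINT x|lebesgue_on D. \<sigma>a x * (avg w u x * avg w \<phi> x))"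
    if "\<phi> \<in> C0" for \<phi>
    using that by (intro first_mixed_form W_piecewise[OF z] u W_avg) auto
  have 2: "(\<Sum>K\<in>T. LINT x|lebesgue_on K. ((1/3) *\<^sub>R grad (avg w u) x + \<sigma>s x *\<^sub>R flux w \<Omega> z x) \<bullet> flux w \<Omega> y x)
    = (1/3) * (\<Sum>j\<in>UNIV. w j * grad_form (\<Omega> j) (y j) (avg w u)) + (LINT x|lebesgue_on D. \<sigma>s x * (flux w \<Omega> z x \<bullet> flux w \<Omega> y x))"
    if "y \<in> W" for y
    using that by (intro second_mixed_form W_piecewise[OF z] u W_piecewise)
  have "flux w \<Omega> z \<in> Z0" using z by (auto simp: flux_space_def)
  moreover have "(\<forall>\<zeta>\<in>Z0. P \<zeta>) \<longleftrightarrow> (\<forall>y\<in>W. P (flux w \<Omega> y))" for P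
    by (auto simp: flux_space_def)
  ultimately show ?thesis
    unfolding mixed_solution_def using True by (simp only: 1 2 cong: ball_cong) simp
next
  case False
  then show ?thesis by (auto simp: mixed_solution_def)
qed

text \<open>For the difference of two solutions, the first equation is tested with the primal
  difference and the second with the flux difference. Adding three times the second to the first
  cancels the gradient terms and leaves two nonnegative integrals with sum 0.\<close>

lemma mixed_solution_unique:
  assumes "mixed_solution D T w \<sigma>s \<sigma>a q C0 Z0 u1 J1" "mixed_solution D T w \<sigma>s \<sigma>a q C0 Z0 u2 J2"
  shows "u1 = u2 \<and> J1 = J2"
proof -
  obtain z1 z2 where z: "z1 \<in> W" "J1 = flux w \<Omega> z1" "z2 \<in> W" "J2 = flux w \<Omega> z2"
    using assms by (auto simp: mixed_solution_def flux_space_def)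
  note s1 = assms(1)[unfolded z mixed_solution_iff[OF z(1)]]
  note s2 = assms(2)[unfolded z mixed_solution_iff[OF z(3)]]
  have u: "u1 \<in> W" "u2 \<in> W" using s1 s2 by auto
  define \<theta> where "\<theta> = (\<lambda>j x. u1 j x - u2 j x)"
  define y where "y = (\<lambda>j x. z1 j x - z2 j x)"
  have yW: "y \<in> W" unfolding y_def by (rule W_diff[OF z(1,3)])
  have avg\<theta>: "avg w \<theta> = (\<lambda>x. avg w u1 x - avg w u2 x)"
    unfolding \<theta>_def by (rule ext) (rule avg_diff)
  have \<theta>: "\<theta> \<in> C0"
    unfolding C0_iff
  proof (intro conjI allI)
    show "\<theta> \<in> W" unfolding \<theta>_def by (rule W_diff[OF u])
    have e: "u1 j = avg w u1" "u2 j = avg w u2" for j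
      using s1 s2 unfolding C0_iff by blast+
    show "\<theta> j = avg w \<theta>" for j
      unfolding avg\<theta>
      by (simp only: \<theta>_def e)
    obtain g1 g2 where "continuous_on (closure D) g1" "\<forall>x\<in>\<Union>T. avg w u1 x = g1 x" "\<forall>x\<in>frontier D. g1 x = 0"
        "continuous_on (closure D) g2" "\<forall>x\<in>\<Union>T. avg w u2 x = g2 x" "\<forall>x\<in>frontier D. g2 x = 0"
      using s1 s2 unfolding C0_iff continuous_zero_def by blast
    then show "continuous_zero (avg w \<theta>)"
      unfolding continuous_zero_def avg\<theta> by (intro exI[of _ "\<lambda>x. g1 x - g2 x"]) (auto intro!: continuous_on_diff)
  qed
  have fy: "flux w \<Omega> y x = flux w \<Omega> z1 x - flux w \<Omega> z2 x" for x
    unfolding y_def by (rule flux_diff)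
  note p1 = W_avg[OF u(1)] and p2 = W_avg[OF u(2)]
  have p\<theta>: "avg w \<theta> \<in> piecewise_C1 T" using \<theta> by (simp add: W_avg)
  let ?G = "\<lambda>z \<phi>. \<Sum>j\<in>UNIV. w j * grad_form (\<Omega> j) (z j) \<phi>"
  have Gz: "?G y \<phi> = ?G z1 \<phi> - ?G z2 \<phi>" if \<phi>: "\<phi> \<in> piecewise_C1 T" for \<phi>
  proof -
    \<comment> \<open>The difference is written as a sum over the two truth values, with
      coefficients 1 and -1.\<close>
    have "grad_form (\<Omega> j) (y j) \<phi> = grad_form (\<Omega> j) (z1 j) \<phi> - grad_form (\<Omega> j) (z2 j) \<phi>" for j
      using grad_form_sum[of "{True, False}" "\<lambda>b. if b then z1 j else z2 j" \<phi> "\<Omega> j" "\<lambda>b. if b then 1 else -1"]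
        W_piecewise[OF z(1)] W_piecewise[OF z(3)] \<phi> by (simp add: y_def)
    then show ?thesis by (simp add: right_diff_distrib sum_subtractf)
  qed
  have G\<theta>: "?G y (avg w \<theta>) = ?G y (avg w u1) - ?G y (avg w u2)"
    unfolding avg\<theta> using grad_form_diff_right[OF W_piecewise[OF yW] p1 p2]
    by (simp add: right_diff_distrib sum_subtractf)
  have a: "- ?G y (avg w \<theta>) + (LINT x|lebesgue_on D. \<sigma>a x * (avg w \<theta> x * avg w \<theta> x)) = 0"
  proof -
    have "(LINT x|lebesgue_on D. \<sigma>a x * (avg w \<theta> x * avg w \<theta> x))
        = (LINT x|lebesgue_on D. \<sigma>a x * (avg w u1 x * avg w \<theta> x) - \<sigma>a x * (avg w u2 x * avg w \<theta> x))"
      by (intro Bochner_Integration.integral_cong refl) (simp add: avg\<theta> algebra_simps)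
    also have "\<dots> = (LINT x|lebesgue_on D. \<sigma>a x * (avg w u1 x * avg w \<theta> x)) - (LINT x|lebesgue_on D. \<sigma>a x * (avg w u2 x * avg w \<theta> x))"
      by (intro Bochner_Integration.integral_diff \<sigma>a_integrable piecewise_C1_mult p1 p2 p\<theta>)
    finally have "(LINT x|lebesgue_on D. \<sigma>a x * (avg w \<theta> x * avg w \<theta> x))
        = (LINT x|lebesgue_on D. \<sigma>a x * (avg w u1 x * avg w \<theta> x)) - (LINT x|lebesgue_on D. \<sigma>a x * (avg w u2 x * avg w \<theta> x))" .
    moreover have "- ?G z1 (avg w \<theta>) + (LINT x|lebesgue_on D. \<sigma>a x * (avg w u1 x * avg w \<theta> x)) = (LINT x|lebesgue_on D. q x * avg w \<theta> x)"
      "- ?G z2 (avg w \<theta>) + (LINT x|lebesgue_on D. \<sigma>a x * (avg w u2 x * avg w \<theta> x)) = (LINT x|lebesgue_on D. q x * avg w \<theta> x)"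
      using s1 s2 \<theta> by blast+
    ultimately show ?thesis
      using Gz[OF p\<theta>] by linarith
  qed
  have b: "(1/3) * ?G y (avg w \<theta>) + (LINT x|lebesgue_on D. \<sigma>s x * (flux w \<Omega> y x \<bullet> flux w \<Omega> y x)) = 0"
  proof -
    have "(LINT x|lebesgue_on D. \<sigma>s x * (flux w \<Omega> y x \<bullet> flux w \<Omega> y x))
        = (LINT x|lebesgue_on D. \<sigma>s x * (flux w \<Omega> z1 x \<bullet> flux w \<Omega> y x) - \<sigma>s x * (flux w \<Omega> z2 x \<bullet> flux w \<Omega> y x))"
      by (intro Bochner_Integration.integral_cong refl)
        (subst (1) fy, simp add: inner_diff_left right_diff_distrib)
    also have "\<dots> = (LINT x|lebesgue_on D. \<sigma>s x * (flux w \<Omega> z1 x \<bullet> flux w \<Omega> y x)) - (LINT x|lebesgue_on D. \<sigma>s x * (flux w \<Omega> z2 x \<bullet> flux w \<Omega> y x))"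
      by (intro Bochner_Integration.integral_diff \<sigma>s_integrable flux_inner_piecewise W_piecewise z yW)
    finally have "(LINT x|lebesgue_on D. \<sigma>s x * (flux w \<Omega> y x \<bullet> flux w \<Omega> y x))
        = (LINT x|lebesgue_on D. \<sigma>s x * (flux w \<Omega> z1 x \<bullet> flux w \<Omega> y x)) - (LINT x|lebesgue_on D. \<sigma>s x * (flux w \<Omega> z2 x \<bullet> flux w \<Omega> y x))" .
    moreover have "(1/3) * ?G y (avg w u1) + (LINT x|lebesgue_on D. \<sigma>s x * (flux w \<Omega> z1 x \<bullet> flux w \<Omega> y x)) = 0"
      "(1/3) * ?G y (avg w u2) + (LINT x|lebesgue_on D. \<sigma>s x * (flux w \<Omega> z2 x \<bullet> flux w \<Omega> y x)) = 0"
      using s1 s2 yW by blast+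
    ultimately show ?thesis
      unfolding G\<theta> by (simp add: right_diff_distrib)
  qed
  have "\<delta>a * (LINT x|lborel. avg w \<theta> x * avg w \<theta> x) \<le> (LINT x|lebesgue_on D. \<sigma>a x * (avg w \<theta> x * avg w \<theta> x))"
    by (rule weighted_lower_bound[OF \<sigma>_measurable(2) \<sigma>_bound(2) \<sigma>_lower(2) piecewise_C1_mult[OF p\<theta> p\<theta>]]) auto
  moreover have "\<delta>s * (LINT x|lborel. flux w \<Omega> y x \<bullet> flux w \<Omega> y x) \<le> (LINT x|lebesgue_on D. \<sigma>s x * (flux w \<Omega> y x \<bullet> flux w \<Omega> y x))"
    by (rule weighted_lower_bound[OF \<sigma>_measurable(1) \<sigma>_bound(1) \<sigma>_lower(1) flux_inner_piecewise[of y y, OF W_piecewise[OF yW] W_piecewise[OF yW]]]) auto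
  moreover have "(LINT x|lborel. avg w \<theta> x * avg w \<theta> x) \<ge> 0" "(LINT x|lborel. flux w \<Omega> y x \<bullet> flux w \<Omega> y x) \<ge> 0"
    by (auto intro!: integral_nonneg_AE AE_I2)
  moreover from this have "\<delta>a * (LINT x|lborel. avg w \<theta> x * avg w \<theta> x) \<ge> 0" "\<delta>s * (LINT x|lborel. flux w \<Omega> y x \<bullet> flux w \<Omega> y x) \<ge> 0"
    using \<delta>_pos by (auto intro!: mult_nonneg_nonneg)
  ultimately have "\<delta>a * (LINT x|lborel. avg w \<theta> x * avg w \<theta> x) \<le> 0" "\<delta>s * (LINT x|lborel. flux w \<Omega> y x \<bullet> flux w \<Omega> y x) \<le> 0"
    using a b by linarith+
  then have n\<theta>: "(LINT x|lborel. avg w \<theta> x * avg w \<theta> x) \<le> 0" and ny: "(LINT x|lborel. flux w \<Omega> y x \<bullet> flux w \<Omega> y x) \<le> 0"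
    using \<delta>_pos by (auto simp: mult_le_0_iff)
  have "avg w \<theta> x = 0" for x
    by (rule piecewise_C1_eq_zero[OF p\<theta> n\<theta>])
  moreover have "\<theta> j = avg w \<theta>" for j
    using \<theta> unfolding C0_iff by blast
  ultimately have "\<theta> j x = 0" for j x
    by simp
  then have "u1 = u2"
    by (simp add: \<theta>_def fun_eq_iff)
  \<comment> \<open>The products \<open>\<Omega> j \<bullet> flux w \<Omega> y x\<close> form an
    element of \<open>W\<close>, so zero norm makes them vanish at every point; the second moment
    then recovers the flux itself.\<close>
  moreover have "flux w \<Omega> y x = 0" for x
  proof -
    have W': "(\<lambda>j x. \<Omega> j \<bullet> flux w \<Omega> y x) \<in> W" by (rule W_dot_flux[OF yW])
    have "(LINT x|lborel. (\<Sum>j\<in>UNIV. w j * ((\<Omega> j \<bullet> flux w \<Omega> y x) * (\<Omega> j \<bullet> flux w \<Omega> y x)))) \<le> 0"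
      unfolding second_moment_inner using ny by simp
    then have "\<Omega> j \<bullet> flux w \<Omega> y x = 0" for j
      using square_sum_zero[of "\<lambda>j x. \<Omega> j \<bullet> flux w \<Omega> y x", OF W_piecewise[OF W']] by blast
    then show ?thesis
      using second_moment[of "flux w \<Omega> y x"] by simp
  qed
  then have "J1 = J2"
    using fy z by (simp add: fun_eq_iff)
  ultimately show ?thesis by blast
qed

end

section \<open>The family of solutions as \<epsilon> tends to 0\<close>

locale asymptotic_problem = transport_problem T D mt w \<Omega> \<sigma>s \<sigma>a q \<delta>s \<delta>a C\<sigma> W
  for T :: "(real^'d) set set" and D mt and w :: "'m::finite \<Rightarrow> real" and \<Omega> \<sigma>s \<sigma>a q \<delta>s \<delta>a C\<sigma> W +
  fixes \<psi> :: "real \<Rightarrow> 'm \<Rightarrow> real^'d \<Rightarrow> real"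
  assumes solution: "\<epsilon> > 0 \<Longrightarrow> \<psi> \<epsilon> \<in> W \<and> (\<forall>v\<in>W. B_form D T w \<Omega> \<sigma>s \<sigma>a \<epsilon> (\<psi> \<epsilon>) v = Q_form T w q \<epsilon> v)"
begin

text \<open>The flux \<open>J\<close> is represented by \<open>V = \<Omega> \<cdot> J \<in> W\<close>, from which it is recovered as \<open>J = flux (3 V)\<close>;
  unlike \<open>\<psi> / \<epsilon>\<close> this element of \<open>W\<close> stays bounded.\<close>

definition V :: "real \<Rightarrow> 'm \<Rightarrow> real^'d \<Rightarrow> real" where
  "V \<epsilon> = (\<lambda>j x. (1 / \<epsilon>) * (\<Omega> j \<bullet> flux w \<Omega> (\<psi> \<epsilon>) x))"

lemma \<psi>_in_W: "\<epsilon> > 0 \<Longrightarrow> \<psi> \<epsilon> \<in> W"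
  using solution by blast

lemma equation:
  assumes "\<epsilon> > 0" "v \<in> W"
  shows "transport_sum (\<psi> \<epsilon>) v + (1 / \<epsilon>) * scattering (\<psi> \<epsilon>) v + \<epsilon> * absorption (\<psi> \<epsilon>) v
    = \<epsilon> * (LINT x|lebesgue_on D. q x * avg w v x)"
proof -
  note p\<psi> = W_piecewise[OF \<psi>_in_W[OF assms(1)]] and pv = W_piecewise[OF assms(2)]
  have "B_form D T w \<Omega> \<sigma>s \<sigma>a \<epsilon> (\<psi> \<epsilon>) v = Q_form T w q \<epsilon> v"
    using solution[OF assms(1)] assms(2) by blast
  then show ?thesis
    unfolding B_form_eq[of "\<psi> \<epsilon>" v, OF p\<psi> pv] Q_form_eq[of v, OF pv] .
qed

lemma V_in_W: "\<epsilon> > 0 \<Longrightarrow> V \<epsilon> \<in> W"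
  unfolding V_def by (intro W_cmult W_dot_flux \<psi>_in_W)

lemma flux_V: "flux w \<Omega> (V \<epsilon>) x = (1 / (3 * \<epsilon>)) *\<^sub>R flux w \<Omega> (\<psi> \<epsilon>) x"
  unfolding V_def flux_cmult by (simp add: flux_dot)

lemma \<psi>_bound: "\<epsilon> > 0 \<Longrightarrow> ip (\<psi> \<epsilon>) (\<psi> \<epsilon>) \<le> q_norm / \<delta>a\<^sup>2"
  using solution_bounds(1) solution by blast

lemma V_bound: "\<epsilon> > 0 \<Longrightarrow> ip (V \<epsilon>) (V \<epsilon>) \<le> q_norm / (2 * \<delta>a * \<delta>s) / 9"
proof -
  assume \<epsilon>: "\<epsilon> > 0"
  have "ip (V \<epsilon>) (V \<epsilon>) \<le> (1 / \<epsilon>\<^sup>2) * ((LINT x|lborel. deviation (\<psi> \<epsilon>) x) / 9)"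
    unfolding V_def by (rule scaled_flux_bound[OF \<epsilon> \<psi>_in_W[OF \<epsilon>]])
  also have "\<dots> \<le> (1 / \<epsilon>\<^sup>2) * (\<epsilon>\<^sup>2 * (q_norm / (2 * \<delta>a * \<delta>s)) / 9)"
    using solution_bounds(2)[OF \<epsilon> \<psi>_in_W[OF \<epsilon>]] solution[OF \<epsilon>] \<psi>_in_W[OF \<epsilon>]
    by (intro mult_left_mono divide_right_mono) auto
  also have "\<dots> = q_norm / (2 * \<delta>a * \<delta>s) / 9"
    using \<epsilon> by simp
  finally show ?thesis .
qed

lemma transport_sum_test:
  assumes "u \<in> W" "\<phi> \<in> C0"
  shows "transport_sum u \<phi> = - (\<Sum>j\<in>UNIV. w j * grad_form (\<Omega> j) (u j) (avg w \<phi>))"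
proof -
  have \<phi>: "\<phi> j = avg w \<phi>" "continuous_zero (avg w \<phi>)" "avg w \<phi> \<in> piecewise_C1 T" for j
    using assms(2) W_avg unfolding C0_iff by blast+
  have "(\<Sum>K\<in>T. cell_form D (\<Omega> j) K (u j) (\<phi> j)) = - grad_form (\<Omega> j) (u j) (avg w \<phi>)" for j
    unfolding \<phi>(1)[of j] grad_form_def by (rule cell_form_continuous_test[OF W_piecewise[OF assms(1)] \<phi>(3,2)])
  then show ?thesis by (simp add: transport_sum_def sum_negf)
qed

text \<open>For isotropic continuous \<open>u\<close> the transport term is its gradient tested with
  \<Omega> times the flux of \<open>y\<close>. The angular average of the two factors \<Omega> is
  the origin of the \<open>1/3\<close> in the mixed problem.\<close>

lemma transport_sum_trial:
  assumes "u \<in> C0" "y \<in> W"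
  shows "transport_sum u (\<lambda>j x. \<Omega> j \<bullet> flux w \<Omega> y x) = (1/3) * (\<Sum>j\<in>UNIV. w j * grad_form (\<Omega> j) (y j) (avg w u))"
proof -
  let ?v = "\<lambda>j x. \<Omega> j \<bullet> flux w \<Omega> y x"
  have v: "?v \<in> W" by (rule W_dot_flux[OF assms(2)])
  have u: "u j = avg w u" "continuous_zero (avg w u)" "avg w u \<in> piecewise_C1 T" for j
    using assms(1) W_avg unfolding C0_iff by blast+
  have "(\<Sum>K\<in>T. cell_form D (\<Omega> j) K (u j) (?v j)) = grad_form (\<Omega> j) (?v j) (avg w u)" for j
    unfolding u(1)[of j] grad_form_def by (rule cell_form_continuous_trial[OF u(3,2) W_piecewise[OF v]])
  then have "transport_sum u ?v = (\<Sum>j\<in>UNIV. w j * grad_form (\<Omega> j) (?v j) (avg w u))"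
    by (simp add: transport_sum_def)
  also have "\<dots> = (\<Sum>K\<in>T. LINT x|lebesgue_on K. flux w \<Omega> ?v x \<bullet> grad (avg w u) x)"
    by (rule flux_grad_form(1)[symmetric, OF W_piecewise[OF v] u(3)])
  also have "\<dots> = (1/3) * (\<Sum>K\<in>T. LINT x|lebesgue_on K. flux w \<Omega> y x \<bullet> grad (avg w u) x)"
    unfolding flux_dot by (simp add: sum_distrib_left)
  also have "\<dots> = (1/3) * (\<Sum>j\<in>UNIV. w j * grad_form (\<Omega> j) (y j) (avg w u))"
    by (simp only: flux_grad_form(1)[OF W_piecewise[OF assms(2)] u(3)])
  finally show ?thesis .
qed

text \<open>An isotropic test function removes scattering, and a continuous one leaves a gradient
  term that sees only the flux of \<open>\<psi> \<epsilon>\<close>, which is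
  \<open>3 * \<epsilon>\<close> times the flux of \<open>V \<epsilon>\<close>. All terms then
  contain one factor \<epsilon>, which is divided out.\<close>

lemma first_equation:
  assumes \<epsilon>: "\<epsilon> > 0" and \<phi>: "\<phi> \<in> C0"
  shows "- (3 * (\<Sum>j\<in>UNIV. w j * grad_form (\<Omega> j) (V \<epsilon> j) (avg w \<phi>))) + absorption (\<psi> \<epsilon>) \<phi>
    = (LINT x|lebesgue_on D. q x * avg w \<phi> x)"
proof -
  have W: "\<phi> \<in> W" and p\<phi>: "avg w \<phi> \<in> piecewise_C1 T" and iso: "\<phi> j = avg w \<phi>" for j
    using \<phi> W_avg unfolding C0_iff by blast+
  have "(\<Sum>j\<in>UNIV. w j * grad_form (\<Omega> j) (\<psi> \<epsilon> j) (avg w \<phi>))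
      = (\<Sum>K\<in>T. LINT x|lebesgue_on K. flux w \<Omega> (\<psi> \<epsilon>) x \<bullet> grad (avg w \<phi>) x)"
    by (rule flux_grad_form(1)[symmetric, OF W_piecewise[OF \<psi>_in_W[OF \<epsilon>]] p\<phi>])
  also have "\<dots> = (\<Sum>K\<in>T. LINT x|lebesgue_on K. (3 * \<epsilon>) * (flux w \<Omega> (V \<epsilon>) x \<bullet> grad (avg w \<phi>) x))"
    using \<epsilon> by (simp add: flux_V)
  also have "\<dots> = (3 * \<epsilon>) * (\<Sum>K\<in>T. LINT x|lebesgue_on K. flux w \<Omega> (V \<epsilon>) x \<bullet> grad (avg w \<phi>) x)"
    by (simp only: integral_mult_right_zero sum_distrib_left)
  also have "\<dots> = \<epsilon> * (3 * (\<Sum>j\<in>UNIV. w j * grad_form (\<Omega> j) (V \<epsilon> j) (avg w \<phi>)))"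
    by (simp only: flux_grad_form(1)[OF W_piecewise[OF V_in_W[OF \<epsilon>]] p\<phi>] mult_ac)
  finally have "transport_sum (\<psi> \<epsilon>) \<phi> = - (\<epsilon> * (3 * (\<Sum>j\<in>UNIV. w j * grad_form (\<Omega> j) (V \<epsilon> j) (avg w \<phi>))))"
    using transport_sum_test[OF \<psi>_in_W[OF \<epsilon>] \<phi>] by simp
  then have "\<epsilon> * (- (3 * (\<Sum>j\<in>UNIV. w j * grad_form (\<Omega> j) (V \<epsilon> j) (avg w \<phi>))) + absorption (\<psi> \<epsilon>) \<phi>)
      = \<epsilon> * (LINT x|lebesgue_on D. q x * avg w \<phi> x)"
    using equation[OF \<epsilon> W] unfolding scattering_isotropic[of \<phi>, OF iso]
    by (simp only: distrib_left mult_minus_right mult_zero_right add_0_right)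
  then show ?thesis using \<epsilon> by simp
qed

text \<open>The test function has zero average, so the source disappears, and the factor
  \<open>1 / \<epsilon>\<close> of scattering is absorbed into \<open>V \<epsilon>\<close>. The
  transport term is left as it is, since \<open>\<psi> \<epsilon>\<close> may be discontinuous for
  positive \<epsilon>.\<close>

lemma second_equation:
  assumes \<epsilon>: "\<epsilon> > 0" and y: "y \<in> W"
  shows "transport_sum (\<psi> \<epsilon>) (\<lambda>j x. \<Omega> j \<bullet> flux w \<Omega> y x)
    + 3 * (LINT x|lebesgue_on D. \<sigma>s x * (flux w \<Omega> (V \<epsilon>) x \<bullet> flux w \<Omega> y x))
    + \<epsilon> * absorption (\<psi> \<epsilon>) (\<lambda>j x. \<Omega> j \<bullet> flux w \<Omega> y x) = 0"
proof -
  have "(1 / \<epsilon>) * scattering (\<psi> \<epsilon>) (\<lambda>j x. \<Omega> j \<bullet> flux w \<Omega> y x)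
      = 3 * (LINT x|lebesgue_on D. \<sigma>s x * (flux w \<Omega> (V \<epsilon>) x \<bullet> flux w \<Omega> y x))"
    unfolding scattering_dot using \<epsilon>
    by (simp add: flux_V flip: integral_mult_right_zero integral_divide_zero)
  then show ?thesis
    using equation[OF \<epsilon> W_dot_flux[OF y]] by (simp add: avg_dot)
qed

lemma absorption_isotropic:
  assumes "\<And>j. u j = avg w u" "\<And>j. \<phi> j = avg w \<phi>"
  shows "absorption u \<phi> = (LINT x|lebesgue_on D. \<sigma>a x * (avg w u x * avg w \<phi> x))"
proof -
  have "(\<Sum>j\<in>UNIV. w j * (u j x * \<phi> j x)) = avg w u x * avg w \<phi> x" for x
  proof -
    have "(\<Sum>j\<in>UNIV. w j * (u j x * \<phi> j x)) = (\<Sum>j\<in>UNIV. w j * (avg w u x * avg w \<phi> x))"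
      using assms by (intro sum.cong refl) (metis (no_types))
    then show ?thesis by (simp add: w_sum flip: sum_distrib_right)
  qed
  then show ?thesis by (simp add: absorption_def)
qed

text \<open>All terms are linear in finitely many coordinates and pass to the limit. Once the limit
  is isotropic it may test the equation itself: scattering then drops out for every \<epsilon>, and
  the remaining terms show that its transport energy is 0. The second conclusion says that the limit
  of \<open>V\<close> is determined by the flux, which makes the limits of its coordinates
  unique.\<close>

lemma limit_is_mixed_solution:
  assumes E: "finite E" "E \<subseteq> W" "\<And>v j x. v \<in> W \<Longrightarrow> v j x = (\<Sum>e\<in>E. ip v e * e j x)"
    and X: "\<And>n. X n > 0" "X \<longlonglongrightarrow> 0"
    and c: "\<And>e. e \<in> E \<Longrightarrow> (\<lambda>n. ip (\<psi> (X n)) e) \<longlonglongrightarrow> c e"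
    and d: "\<And>e. e \<in> E \<Longrightarrow> (\<lambda>n. ip (V (X n)) e) \<longlonglongrightarrow> d e"
  shows "mixed_solution D T w \<sigma>s \<sigma>a q C0 Z0 (comb E c) (flux w \<Omega> (\<lambda>j x. 3 * comb E d j x))"
    and "comb E d = (\<lambda>j x. \<Omega> j \<bullet> flux w \<Omega> (\<lambda>j x. 3 * comb E d j x) x)"
proof -
  have \<psi>: "\<psi> (X n) = comb E (ip (\<psi> (X n)))" for n
    using E(3)[OF \<psi>_in_W[OF X(1)]] by (simp add: comb_def fun_eq_iff)
  have V: "V (X n) = comb E (ip (V (X n)))" for n
    using E(3)[OF V_in_W[OF X(1)]] by (simp add: comb_def fun_eq_iff)
  have limc: "(\<lambda>n. \<Sum>e\<in>E. ip (\<psi> (X n)) e * L e) \<longlonglongrightarrow> (\<Sum>e\<in>E. c e * L e)" for L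
    by (intro tendsto_sum tendsto_mult tendsto_const c)
  have limd: "(\<lambda>n. \<Sum>e\<in>E. ip (V (X n)) e * L e) \<longlonglongrightarrow> (\<Sum>e\<in>E. d e * L e)" for L
    by (intro tendsto_sum tendsto_mult tendsto_const d)
  have tr: "(\<lambda>n. transport_sum (\<psi> (X n)) v) \<longlonglongrightarrow> transport_sum (comb E c) v" if "v \<in> W" for v
    by (subst \<psi>) (simp only: transport_sum_comb[OF E(1,2) that] limc)
  have sc: "(\<lambda>n. scattering (\<psi> (X n)) v) \<longlonglongrightarrow> scattering (comb E c) v" if "v \<in> W" for v
    by (subst \<psi>) (simp only: scattering_comb[OF E(2) that] limc)
  have ab: "(\<lambda>n. absorption (\<psi> (X n)) v) \<longlonglongrightarrow> absorption (comb E c) v" if "v \<in> W" for v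
    by (subst \<psi>) (simp only: absorption_comb[OF E(2) that] limc)
  have gr: "(\<lambda>n. \<Sum>j\<in>UNIV. w j * grad_form (\<Omega> j) (V (X n) j) \<phi>) \<longlonglongrightarrow> (\<Sum>j\<in>UNIV. w j * grad_form (\<Omega> j) (comb E d j) \<phi>)"
    if "\<phi> \<in> piecewise_C1 T" for \<phi>
    by (subst V) (simp only: grad_form_comb[OF E(1,2) that] limd)
  have fl: "(\<lambda>n. LINT x|lebesgue_on D. \<sigma>s x * (flux w \<Omega> (V (X n)) x \<bullet> flux w \<Omega> y x))
      \<longlonglongrightarrow> (LINT x|lebesgue_on D. \<sigma>s x * (flux w \<Omega> (comb E d) x \<bullet> flux w \<Omega> y x))" if "y \<in> W" for y
    by (subst V) (simp only: flux_integral_comb[OF E(2) that] limd)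
  let ?\<psi>0 = "comb E c"
  have \<psi>0: "?\<psi>0 \<in> W" and V0: "comb E d \<in> W"
    by (rule comb_in_W[OF E(1,2)])+
  note p\<psi>0 = W_piecewise[OF \<psi>0]
  \<comment> \<open>The equation is multiplied by \<open>X n\<close>: transport and absorption
    converge, so in the limit scattering alone survives.\<close>
  have "scattering ?\<psi>0 v = 0" if v: "v \<in> W" for v
  proof -
    have eq: "scattering (\<psi> (X n)) v = X n * (X n * (LINT x|lebesgue_on D. q x * avg w v x)
        - transport_sum (\<psi> (X n)) v - X n * absorption (\<psi> (X n)) v)" for n
      using equation[OF X(1) v, of n] X(1)[of n] by (simp add: field_simps)
    have "(\<lambda>n. scattering (\<psi> (X n)) v) \<longlonglongrightarrow> 0 * (0 * (LINT x|lebesgue_on D. q x * avg w v x)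
        - transport_sum ?\<psi>0 v - 0 * absorption ?\<psi>0 v)"
      unfolding eq by (intro tendsto_intros X(2) tr ab v)
    then show ?thesis
      using sc[OF v] LIMSEQ_unique by fastforce
  qed
  then have "\<delta>s * (LINT x|lborel. deviation ?\<psi>0 x) \<le> 0"
    using scattering_self[of "comb E c", OF p\<psi>0] \<psi>0 by simp
  then have "(LINT x|lborel. deviation ?\<psi>0 x) \<le> 0"
    using \<delta>_pos by (simp add: mult_le_0_iff)
  then have "?\<psi>0 j x - avg w ?\<psi>0 x = 0" for j x
    unfolding deviation_def[abs_def]
    by (rule square_sum_zero[of "\<lambda>j x. ?\<psi>0 j x - avg w ?\<psi>0 x", OF deviation_piecewise(2)[OF p\<psi>0]])
  then have iso: "?\<psi>0 j = avg w ?\<psi>0" for j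
    by (intro ext) simp
  have "transport_sum ?\<psi>0 ?\<psi>0 = 0"
  proof -
    have "transport_sum (\<psi> (X n)) ?\<psi>0 = X n * (LINT x|lebesgue_on D. q x * avg w ?\<psi>0 x) - X n * absorption (\<psi> (X n)) ?\<psi>0" for n
      using equation[OF X(1) \<psi>0, of n] scattering_isotropic[of ?\<psi>0, OF iso] by simp
    moreover have "(\<lambda>n. X n * (LINT x|lebesgue_on D. q x * avg w ?\<psi>0 x) - X n * absorption (\<psi> (X n)) ?\<psi>0)
        \<longlonglongrightarrow> 0 * (LINT x|lebesgue_on D. q x * avg w ?\<psi>0 x) - 0 * absorption ?\<psi>0 ?\<psi>0"
      by (intro tendsto_intros X(2) ab \<psi>0)
    ultimately show ?thesis
      using tr[OF \<psi>0] LIMSEQ_unique by fastforce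
  qed
  \<comment> \<open>The weighted energies are nonnegative, so a vanishing sum forces each direction
    to have zero energy.\<close>
  then have no_energy: "\<forall>j\<in>UNIV. w j * (\<Sum>K\<in>T. cell_form D (\<Omega> j) K (?\<psi>0 j) (?\<psi>0 j)) = 0"
    unfolding transport_sum_def
    by (subst (asm) sum_nonneg_eq_0_iff)
      (auto intro!: mult_nonneg_nonneg less_imp_le[OF w_pos] transport_energy_nonneg[OF p\<psi>0 cells_subset])
  have energy: "(\<Sum>K\<in>T. cell_form D (\<Omega> j) K (avg w ?\<psi>0) (avg w ?\<psi>0)) = 0" for j
  proof -
    have "(\<Sum>K\<in>T. cell_form D (\<Omega> j) K (?\<psi>0 j) (?\<psi>0 j)) = 0"
      using bspec[OF no_energy, of j] w_pos[of j] by simp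
    then show ?thesis
      unfolding iso[of j] .
  qed
  have "continuous_zero (avg w ?\<psi>0)"
  proof (rule zero_energy_imp_continuous[OF W_avg[OF \<psi>0] energy])
    \<comment> \<open>The spanning identity is the second moment multiplied by 3.\<close>
    show "h = (\<Sum>j\<in>UNIV. ((3 * w j) * (\<Omega> j \<bullet> h)) *\<^sub>R \<Omega> j)" for h
      using arg_cong[OF second_moment[of h], of "scaleR 3"] by (simp add: scaleR_sum_right mult.assoc)
  qed
  with \<psi>0 iso have C0: "?\<psi>0 \<in> C0"
    unfolding C0_iff by blast
  have z: "(\<lambda>j x. 3 * comb E d j x) \<in> W"
    by (rule W_cmult[OF V0])
  have z_comb: "(\<lambda>j x. 3 * comb E d j x) = comb E (\<lambda>e. 3 * d e)"
    by (simp add: comb_def sum_distrib_left mult.assoc)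
  show "mixed_solution D T w \<sigma>s \<sigma>a q C0 Z0 ?\<psi>0 (flux w \<Omega> (\<lambda>j x. 3 * comb E d j x))"
    unfolding mixed_solution_iff[OF z]
  proof (intro conjI ballI C0)
    fix \<phi> assume \<phi>: "\<phi> \<in> C0"
    then have W: "\<phi> \<in> W" and p\<phi>: "avg w \<phi> \<in> piecewise_C1 T" and iso\<phi>: "\<phi> j = avg w \<phi>" for j
      using W_avg unfolding C0_iff by blast+
    have "(\<lambda>n. - (3 * (\<Sum>j\<in>UNIV. w j * grad_form (\<Omega> j) (V (X n) j) (avg w \<phi>))) + absorption (\<psi> (X n)) \<phi>)
        \<longlonglongrightarrow> - (3 * (\<Sum>j\<in>UNIV. w j * grad_form (\<Omega> j) (comb E d j) (avg w \<phi>))) + absorption ?\<psi>0 \<phi>"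
      by (intro tendsto_intros gr ab p\<phi> W)
    then have "(LINT x|lebesgue_on D. q x * avg w \<phi> x)
        = - (3 * (\<Sum>j\<in>UNIV. w j * grad_form (\<Omega> j) (comb E d j) (avg w \<phi>))) + absorption ?\<psi>0 \<phi>"
      unfolding first_equation[OF X(1) \<phi>] by (rule LIMSEQ_unique[OF tendsto_const])
    moreover have "(\<Sum>j\<in>UNIV. w j * grad_form (\<Omega> j) (\<lambda>x. 3 * comb E d j x) (avg w \<phi>))
        = 3 * (\<Sum>j\<in>UNIV. w j * grad_form (\<Omega> j) (comb E d j) (avg w \<phi>))"
      using grad_form_comb[OF E(1,2) p\<phi>, of "\<lambda>e. 3 * d e"] grad_form_comb[OF E(1,2) p\<phi>, of d]
      by (simp add: fun_cong[OF z_comb] sum_distrib_left mult.assoc)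
    ultimately show "- (\<Sum>j\<in>UNIV. w j * grad_form (\<Omega> j) (\<lambda>x. 3 * comb E d j x) (avg w \<phi>))
        + (LINT x|lebesgue_on D. \<sigma>a x * (avg w ?\<psi>0 x * avg w \<phi> x)) = (LINT x|lebesgue_on D. q x * avg w \<phi> x)"
      using absorption_isotropic[of ?\<psi>0 \<phi>, OF iso iso\<phi>] by simp
  next
    fix y assume y: "y \<in> W"
    let ?v = "\<lambda>j x. \<Omega> j \<bullet> flux w \<Omega> y x"
    have v: "?v \<in> W" by (rule W_dot_flux[OF y])
    have "(\<lambda>n. transport_sum (\<psi> (X n)) ?v + 3 * (LINT x|lebesgue_on D. \<sigma>s x * (flux w \<Omega> (V (X n)) x \<bullet> flux w \<Omega> y x))
        + X n * absorption (\<psi> (X n)) ?v)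
      \<longlonglongrightarrow> transport_sum ?\<psi>0 ?v + 3 * (LINT x|lebesgue_on D. \<sigma>s x * (flux w \<Omega> (comb E d) x \<bullet> flux w \<Omega> y x))
        + 0 * absorption ?\<psi>0 ?v"
      by (intro tendsto_intros tr fl ab v y X(2))
    then have lim0: "0 = transport_sum ?\<psi>0 ?v + 3 * (LINT x|lebesgue_on D. \<sigma>s x * (flux w \<Omega> (comb E d) x \<bullet> flux w \<Omega> y x))
        + 0 * absorption ?\<psi>0 ?v"
      unfolding second_equation[OF X(1) y] by (rule LIMSEQ_unique[OF tendsto_const])
    show "(1/3) * (\<Sum>j\<in>UNIV. w j * grad_form (\<Omega> j) (y j) (avg w ?\<psi>0))
        + (LINT x|lebesgue_on D. \<sigma>s x * (flux w \<Omega> (\<lambda>j x. 3 * comb E d j x) x \<bullet> flux w \<Omega> y x)) = 0"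
    proof -
      have "(LINT x|lebesgue_on D. \<sigma>s x * (flux w \<Omega> (\<lambda>j x. 3 * comb E d j x) x \<bullet> flux w \<Omega> y x))
          = (LINT x|lebesgue_on D. 3 * (\<sigma>s x * (flux w \<Omega> (comb E d) x \<bullet> flux w \<Omega> y x)))"
        by (intro Bochner_Integration.integral_cong refl) (simp add: flux_cmult)
      also have "\<dots> = 3 * (LINT x|lebesgue_on D. \<sigma>s x * (flux w \<Omega> (comb E d) x \<bullet> flux w \<Omega> y x))"
        by (rule integral_mult_right_zero)
      finally show ?thesis
        using lim0 unfolding transport_sum_trial[OF C0 y] by simp
    qed
  qed
  \<comment> \<open>Each \<open>V (X n)\<close> equals \<Omega> times its own flux multiplied by 3.
    The identity is linear in the coordinates, so it is preserved in the limit.\<close>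
  show "comb E d = (\<lambda>j x. \<Omega> j \<bullet> flux w \<Omega> (\<lambda>j x. 3 * comb E d j x) x)"
  proof (intro ext)
    fix j x
    have "V (X n) j x = (\<Sum>e\<in>E. ip (V (X n)) e * (\<Omega> j \<bullet> (3 *\<^sub>R flux w \<Omega> e x)))" for n
    proof -
      have "V (X n) j x = \<Omega> j \<bullet> (3 *\<^sub>R flux w \<Omega> (V (X n)) x)"
        unfolding flux_V using X(1)[of n] by (simp add: V_def)
      also have "\<dots> = \<Omega> j \<bullet> (3 *\<^sub>R flux w \<Omega> (comb E (ip (V (X n)))) x)"
        using V[of n] by simp
      finally show ?thesis
        by (simp add: flux_comb inner_sum_right sum_distrib_left mult.left_commute)
    qed
    then have "(\<lambda>n. V (X n) j x) \<longlonglongrightarrow> (\<Sum>e\<in>E. d e * (\<Omega> j \<bullet> (3 *\<^sub>R flux w \<Omega> e x)))"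
      using limd by simp
    moreover have "(\<lambda>n. V (X n) j x) \<longlonglongrightarrow> comb E d j x"
      unfolding E(3)[OF V_in_W[OF X(1)], of _ j x] comb_def by (rule limd)
    ultimately have "comb E d j x = (\<Sum>e\<in>E. d e * (\<Omega> j \<bullet> (3 *\<^sub>R flux w \<Omega> e x)))"
      using LIMSEQ_unique by blast
    then show "comb E d j x = \<Omega> j \<bullet> flux w \<Omega> (\<lambda>j x. 3 * comb E d j x) x"
      by (simp add: flux_cmult flux_comb inner_sum_right sum_distrib_left mult.left_commute)
  qed
qed

lemma W_basis:
  obtains E where "finite E" "E \<subseteq> W" "\<And>v j x. v \<in> W \<Longrightarrow> v j x = (\<Sum>e\<in>E. ip v e * e j x)"
    "\<And>v e. v \<in> W \<Longrightarrow> e \<in> E \<Longrightarrow> (ip v e)\<^sup>2 \<le> ip v v" "\<And>c e. e \<in> E \<Longrightarrow> ip (comb E c) e = c e"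
proof -
  interpret S: inner_subspace "\<lambda>c (v :: 'm \<Rightarrow> real^'d \<Rightarrow> real). (\<lambda>j x. c * v j x)" W ip
    by (rule inner_subspace_W)
  obtain B :: "('m \<Rightarrow> real^'d \<Rightarrow> real) set" where "finite B" "VV_h mt T \<subseteq> function_space.span B"
    using VV_h_finite_span by blast
  then have "finite B" "W \<subseteq> function_space.span B"
    using W_subspace by (auto simp: linear_subspace_of_def)
  then obtain E where E: "S.orthonormal E" "\<And>v. v \<in> W \<Longrightarrow> v = (\<Sum>e\<in>E. (\<lambda>j x. ip v e * e j x))"
    by (rule S.orthonormal_basis) blast
  have comb: "comb E c = (\<Sum>e\<in>E. (\<lambda>j x. c e * e j x))" for c
    by (simp add: comb_def fun_eq_iff sum_fun_apply2)
  show ?thesis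
  proof (rule that)
    show "finite E" "E \<subseteq> W" using E(1) by (auto simp: S.orthonormal_def)
    show "v j x = (\<Sum>e\<in>E. ip v e * e j x)" if "v \<in> W" for v j x
      using fun_cong[OF fun_cong[OF E(2)[OF that]], of j x] by (simp add: sum_fun_apply2)
    show "(ip v e)\<^sup>2 \<le> ip v v" if "v \<in> W" "e \<in> E" for v e
      by (rule S.ip_coefficient_bound[OF E(1) that(2,1)])
    show "ip (comb E c) e = c e" if "e \<in> E" for c e
      unfolding comb by (rule S.ip_expansion[OF E(1) that])
  qed
qed

theorem diffusion_limit:
  "\<exists>\<psi>0 J0. \<psi>0 \<in> C0 \<and> J0 \<in> Z0 \<and>
     (\<forall>j. uniform_limit D (\<lambda>\<epsilon>. \<psi> \<epsilon> j) (\<psi>0 j) (at_right 0)) \<and>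
     uniform_limit D (\<lambda>\<epsilon> x. (1 / \<epsilon>) *\<^sub>R flux w \<Omega> (\<psi> \<epsilon>) x) J0 (at_right 0) \<and>
     (\<forall>\<psi>' J'. mixed_solution D T w \<sigma>s \<sigma>a q C0 Z0 \<psi>' J' \<longleftrightarrow> \<psi>' = \<psi>0 \<and> J' = J0)"
proof -
  obtain E where E: "finite E" "E \<subseteq> W" "\<And>v j x. v \<in> W \<Longrightarrow> v j x = (\<Sum>e\<in>E. ip v e * e j x)"
    and bound: "\<And>v e. v \<in> W \<Longrightarrow> e \<in> E \<Longrightarrow> (ip v e)\<^sup>2 \<le> ip v v" and coef: "\<And>c e. e \<in> E \<Longrightarrow> ip (comb E c) e = c e"
    by (rule W_basis) blast
  \<comment> \<open>The coordinates of both families are indexed together, \<open>True\<close> for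
    \<psi> and \<open>False\<close> for \<open>V\<close>, so that one subsequence serves
    both.\<close>
  define f where "f = (\<lambda>(e, b) \<epsilon>. if b then ip (\<psi> \<epsilon>) e else ip (V \<epsilon>) e)"
  define R where "R = sqrt (max (q_norm / \<delta>a\<^sup>2) (q_norm / (2 * \<delta>a * \<delta>s) / 9))"
  have f_bound: "\<bar>f i t\<bar> \<le> R" if i_in: "i \<in> E \<times> UNIV" and t: "t > 0" for i t
  proof -
    obtain e b where i: "i = (e, b)" "e \<in> E" using i_in by (cases i) auto
    have "(f i t)\<^sup>2 \<le> max (q_norm / \<delta>a\<^sup>2) (q_norm / (2 * \<delta>a * \<delta>s) / 9)"
      using bound[OF \<psi>_in_W[OF t] i(2)] \<psi>_bound[OF t] bound[OF V_in_W[OF t] i(2)] V_bound[OF t]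
      by (auto simp: f_def i(1) le_max_iff_disj)
    then show ?thesis
      unfolding R_def by (metis real_sqrt_abs real_sqrt_le_iff)
  qed
  have fin: "finite (E \<times> (UNIV :: bool set))" using E(1) by simp
  obtain X l where X: "\<And>n. X n > 0" "X \<longlonglongrightarrow> 0" and l: "\<And>i. i \<in> E \<times> UNIV \<Longrightarrow> (\<lambda>n. f i (X n)) \<longlonglongrightarrow> l i"
    by (rule convergent_coefficients[OF fin, of f R]) (use f_bound in blast)+
  have lim: "mixed_solution D T w \<sigma>s \<sigma>a q C0 Z0 (comb E (\<lambda>e. l (e, True))) (flux w \<Omega> (\<lambda>j x. 3 * comb E (\<lambda>e. l (e, False)) j x))
      \<and> comb E (\<lambda>e. l (e, False)) = (\<lambda>j x. \<Omega> j \<bullet> flux w \<Omega> (\<lambda>j x. 3 * comb E (\<lambda>e. l (e, False)) j x) x)"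
    if "\<And>n. X n > 0" "X \<longlonglongrightarrow> 0" and l: "\<And>i. i \<in> E \<times> UNIV \<Longrightarrow> (\<lambda>n. f i (X n)) \<longlonglongrightarrow> l i" for X l
  proof -
    have "(\<lambda>n. ip (\<psi> (X n)) e) \<longlonglongrightarrow> l (e, True)" "(\<lambda>n. ip (V (X n)) e) \<longlonglongrightarrow> l (e, False)" if "e \<in> E" for e
      using l[of "(e, True)"] l[of "(e, False)"] that by (simp_all add: f_def)
    from limit_is_mixed_solution[OF E that(1,2) this] show ?thesis by blast
  qed
  define c where "c = (\<lambda>e. l (e, True))"
  define d where "d = (\<lambda>e. l (e, False))"
  define \<psi>0 where "\<psi>0 = comb E c"
  define J0 where "J0 = flux w \<Omega> (\<lambda>j x. 3 * comb E d j x)"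
  have sol: "mixed_solution D T w \<sigma>s \<sigma>a q C0 Z0 \<psi>0 J0" and d_eq: "comb E d = (\<lambda>j x. \<Omega> j \<bullet> J0 x)"
    using lim[OF X l] unfolding \<psi>0_def J0_def c_def d_def by blast+
  have uniq: "mixed_solution D T w \<sigma>s \<sigma>a q C0 Z0 \<psi>' J' \<longleftrightarrow> \<psi>' = \<psi>0 \<and> J' = J0" for \<psi>' J'
    using sol mixed_solution_unique by blast
  have conv: "(f i \<longlongrightarrow> l i) (at_right 0)" if i_in: "i \<in> E \<times> UNIV" for i
  proof (rule tendsto_of_unique_cluster_points[OF fin, where f = f and L = l, OF f_bound _ i_in])
    fix Y m assume Y: "\<And>n. Y n > (0::real)" "Y \<longlonglongrightarrow> 0" and m: "\<And>i. i \<in> E \<times> UNIV \<Longrightarrow> (\<lambda>n. f i (Y n)) \<longlonglongrightarrow> m i"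
    note lm = lim[OF Y m]
    then have "comb E (\<lambda>e. m (e, True)) = \<psi>0" and J: "flux w \<Omega> (\<lambda>j x. 3 * comb E (\<lambda>e. m (e, False)) j x) = J0"
      using uniq by blast+
    then have 1: "comb E (\<lambda>e. m (e, True)) = comb E c"
      by (simp add: \<psi>0_def)
    have 2: "comb E (\<lambda>e. m (e, False)) = comb E d"
      using lm unfolding J d_eq by blast
    \<comment> \<open>Equal combinations have equal coordinates. For \<open>V\<close> the
      combinations agree because both are \<Omega> times the same flux \<open>J0\<close>.\<close>
    have "m (e, b) = l (e, b)" if "e \<in> E" for e b
    proof (cases b)
      case True
      then show ?thesis
        using arg_cong[OF 1, of "\<lambda>v. ip v e"] coef[OF that] by (simp add: c_def)
    next
      case False
      then show ?thesis
        using arg_cong[OF 2, of "\<lambda>v. ip v e"] coef[OF that] by (simp add: d_def)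
    qed
    then show "\<forall>i\<in>E \<times> UNIV. m i = l i" by auto
  qed
  have c_lim: "((\<lambda>\<epsilon>. ip (\<psi> \<epsilon>) e) \<longlongrightarrow> c e) (at_right 0)" and d_lim: "((\<lambda>\<epsilon>. 3 * ip (V \<epsilon>) e) \<longlongrightarrow> 3 * d e) (at_right 0)"
    if "e \<in> E" for e
    using conv[of "(e, True)"] tendsto_mult[OF tendsto_const[of "3::real"] conv[of "(e, False)"]] that by (auto simp: f_def c_def d_def)
  have pos: "\<forall>\<^sub>F \<epsilon> in at_right (0::real). \<epsilon> > 0"
    by (rule eventually_at_right_less)
  have e_bound: "\<exists>M. \<forall>x\<in>D. norm (e j x) \<le> M" if "e \<in> E" for e j
  proof -
    have "e j \<in> piecewise_C1 T" using W_piecewise that E(2) by blast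
    then obtain M where "\<And>x. \<bar>e j x\<bar> \<le> M"
      by (rule piecewise_C1_bounded) blast
    then show ?thesis by auto
  qed
  have "uniform_limit D (\<lambda>\<epsilon>. \<psi> \<epsilon> j) (\<psi>0 j) (at_right 0)" for j
  proof -
    have "uniform_limit D (\<lambda>\<epsilon> x. \<Sum>e\<in>E. ip (\<psi> \<epsilon>) e *\<^sub>R e j x) (\<lambda>x. \<Sum>e\<in>E. c e *\<^sub>R e j x) (at_right 0)"
      by (rule uniform_limit_comb[OF E(1) e_bound c_lim])
    moreover have "\<forall>\<^sub>F \<epsilon> in at_right 0. \<forall>x\<in>D. (\<Sum>e\<in>E. ip (\<psi> \<epsilon>) e *\<^sub>R e j x) = \<psi> \<epsilon> j x"
      using pos by eventually_elim (simp add: E(3)[OF \<psi>_in_W, symmetric])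
    ultimately show ?thesis
      by (subst (asm) uniform_limit_cong[where g = "\<lambda>\<epsilon>. \<psi> \<epsilon> j" and i = "\<psi>0 j"]) (auto simp: \<psi>0_def comb_def)
  qed
  moreover have "uniform_limit D (\<lambda>\<epsilon> x. (1 / \<epsilon>) *\<^sub>R flux w \<Omega> (\<psi> \<epsilon>) x) J0 (at_right 0)"
  proof -
    have flux_bound: "\<exists>M. \<forall>x\<in>D. norm (flux w \<Omega> e x) \<le> M" if e: "e \<in> E" for e
    proof -
      obtain M where M: "\<forall>j\<in>UNIV. \<forall>x\<in>D. norm (e j x) \<le> M j"
        using bchoice[of UNIV "\<lambda>j M. \<forall>x\<in>D. norm (e j x) \<le> M"] e_bound[OF e] by blast
      have "norm (flux w \<Omega> e x) \<le> (\<Sum>j\<in>UNIV. w j * M j * norm (\<Omega> j))" if "x \<in> D" for x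
        unfolding flux_def
      proof (rule sum_norm_le)
        fix j
        have "norm (e j x) \<le> M j" using M that by blast
        then show "norm ((w j * e j x) *\<^sub>R \<Omega> j) \<le> w j * M j * norm (\<Omega> j)"
          using w_pos[of j] by (auto simp: abs_mult intro!: mult_right_mono mult_left_mono)
      qed
      then show ?thesis by blast
    qed
    have "uniform_limit D (\<lambda>\<epsilon> x. \<Sum>e\<in>E. (3 * ip (V \<epsilon>) e) *\<^sub>R flux w \<Omega> e x) (\<lambda>x. \<Sum>e\<in>E. (3 * d e) *\<^sub>R flux w \<Omega> e x) (at_right 0)"
      by (rule uniform_limit_comb[OF E(1) flux_bound d_lim])
    moreover have "\<forall>\<^sub>F \<epsilon> in at_right 0. \<forall>x\<in>D. (\<Sum>e\<in>E. (3 * ip (V \<epsilon>) e) *\<^sub>R flux w \<Omega> e x) = (1 / \<epsilon>) *\<^sub>R flux w \<Omega> (\<psi> \<epsilon>) x"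
      using pos
    proof eventually_elim
      case (elim \<epsilon>)
      have "V \<epsilon> = comb E (ip (V \<epsilon>))"
        using E(3)[OF V_in_W[OF elim]] by (simp add: comb_def fun_eq_iff)
      then have "flux w \<Omega> (V \<epsilon>) x = (\<Sum>e\<in>E. ip (V \<epsilon>) e *\<^sub>R flux w \<Omega> e x)" for x
        using flux_comb[of E "ip (V \<epsilon>)" x] by simp
      then have "(\<Sum>e\<in>E. (3 * ip (V \<epsilon>) e) *\<^sub>R flux w \<Omega> e x) = 3 *\<^sub>R flux w \<Omega> (V \<epsilon>) x" for x
        by (simp add: scaleR_sum_right)
      then show ?case
        by (simp add: flux_V)
    qed
    moreover have "J0 x = (\<Sum>e\<in>E. (3 * d e) *\<^sub>R flux w \<Omega> e x)" for x
      by (simp add: J0_def flux_cmult flux_comb scaleR_sum_right)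
    ultimately show ?thesis
      by (subst (asm) uniform_limit_cong[where g = "\<lambda>\<epsilon> x. (1 / \<epsilon>) *\<^sub>R flux w \<Omega> (\<psi> \<epsilon>) x" and i = J0]) auto
  qed
  moreover have "\<psi>0 \<in> C0" "J0 \<in> Z0"
    using sol by (auto simp: mixed_solution_def)
  ultimately show ?thesis
    using uniq by blast
qed

end

section \<open>From the data of the theorem to the abstract setting\<close>

lemma is_cell_open_polytope:
  fixes K :: "(real^'d) set"
  assumes "is_cell mt K"
  shows "open_polytope K"
proof (cases mt)
  case Simplicial
  then obtain S where S: "int CARD('d) simplex S" "K = interior S"
    using assms by (auto simp: is_cell_def)
  have cS: "convex S" and pS: "polytope S"
    using S(1) by (auto intro: convex_simplex simplex_imp_polytope)
  \<comment> \<open>Full affine dimension identifies the interior with the relative interior, which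
    is nonempty for a nonempty convex set.\<close>
  have "aff_dim S = int DIM(real^'d)"
    using aff_dim_simplex[OF S(1)] by simp
  then have "affine hull S = UNIV"
    using aff_dim_eq_full by blast
  then have "interior S = rel_interior S"
    by (rule rel_interior_interior[symmetric])
  moreover have "S \<noteq> {}"
    using aff_dim_simplex[OF S(1)] by auto
  ultimately have ne: "interior S \<noteq> {}"
    using rel_interior_eq_empty[OF cS] by simp
  have "closure K = S"
    using convex_closure_interior[OF cS ne] polytope_imp_closed[OF pS] S(2) by simp
  then show ?thesis
    using S(2) pS ne by unfold_locales auto
next
  case Cartesian
  then obtain a b where K: "K = box a b" "box a b \<noteq> {}"
    using assms by (auto simp: is_cell_def)
  then have "closure K = cbox a b"
    by (simp add: closure_box)
  then show ?thesis
    using K by unfold_locales (auto simp: polytope_interval interior_cbox)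
qed

lemma second_moment_matrix:
  fixes \<Omega> :: "'m::finite \<Rightarrow> real^'d"
  assumes "(\<Sum>j\<in>UNIV. w j *\<^sub>R (\<chi> a b. \<Omega> j $ a * \<Omega> j $ b)) = ((1/3) *\<^sub>R mat 1 :: real^'d^'d)"
  shows "(\<Sum>j\<in>UNIV. (w j * (\<Omega> j \<bullet> h)) *\<^sub>R \<Omega> j) = (1/3) *\<^sub>R h"
proof (rule vec_eq_iff[THEN iffD2], rule allI)
  fix i
  have m: "(\<Sum>j\<in>UNIV. w j * (\<Omega> j $ i * \<Omega> j $ k)) = (if i = k then 1/3 else 0)" for k
    using arg_cong[OF assms, of "\<lambda>A. A $ i $ k"] by (cases "i = k") (simp_all add: mat_def)
  have "(\<Sum>j\<in>UNIV. (w j * (\<Omega> j \<bullet> h)) *\<^sub>R \<Omega> j) $ i = (\<Sum>j\<in>UNIV. \<Sum>k\<in>UNIV. h $ k * (w j * (\<Omega> j $ i * \<Omega> j $ k)))"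
    by (simp add: inner_vec_def sum_distrib_left sum_distrib_right mult_ac)
  also have "\<dots> = (\<Sum>k\<in>UNIV. h $ k * (\<Sum>j\<in>UNIV. w j * (\<Omega> j $ i * \<Omega> j $ k)))"
    by (subst sum.swap) (simp add: sum_distrib_left)
  also have "\<dots> = ((1/3) *\<^sub>R h) $ i"
    unfolding m by (simp add: if_distrib cong: if_cong)
  finally show "(\<Sum>j\<in>UNIV. (w j * (\<Omega> j \<bullet> h)) *\<^sub>R \<Omega> j) $ i = ((1/3) *\<^sub>R h) $ i" .
qed

theorem theorem3p2:
  fixes D :: "(real^'d) set"
    and T :: "(real^'d) set set"
    and mt :: mesh_type
    and w :: "'m::finite \<Rightarrow> real"
    and \<Omega> :: "'m \<Rightarrow> real^'d"
    and \<sigma>s \<sigma>a q :: "real^'d \<Rightarrow> real"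
    and \<delta>s \<delta>a :: real
    and W :: "('m \<Rightarrow> real^'d \<Rightarrow> real) set"
    and \<psi> :: "real \<Rightarrow> 'm \<Rightarrow> real^'d \<Rightarrow> real"
    and J :: "real \<Rightarrow> real^'d \<Rightarrow> real^'d"
  assumes "CARD('d) \<in> {1, 2, 3}"
    and "lipschitz_domain D" and "bounded D"
    and "\<sigma>s \<in> borel_measurable (lebesgue_on D)" and "bounded (\<sigma>s ` D)"
    and "(INF x\<in>D. \<sigma>s x) = \<delta>s" and "\<delta>s > 0"
    and "\<sigma>a \<in> borel_measurable (lebesgue_on D)" and "bounded (\<sigma>a ` D)"
    and "(INF x\<in>D. \<sigma>a x) = \<delta>a" and "\<delta>a > 0"
    and "q \<in> borel_measurable (lebesgue_on D)" and "integrable (lebesgue_on D) (\<lambda>x. (q x)\<^sup>2)"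
    and "angular_quadrature w \<Omega>"
    and "is_mesh mt D T"
    and "linear_subspace_of (VV_h mt T) W"
    and "dot_flux_space w \<Omega> W \<subseteq> W"
    and "\<And>\<epsilon>. \<epsilon> > 0 \<Longrightarrow> \<psi> \<epsilon> \<in> W \<and>
           (\<forall>v\<in>W. B_form D T w \<Omega> \<sigma>s \<sigma>a \<epsilon> (\<psi> \<epsilon>) v = Q_form T w q \<epsilon> v)"
    and "\<And>\<epsilon>. \<epsilon> > 0 \<Longrightarrow> J \<epsilon> = (\<lambda>x. (1 / \<epsilon>) *\<^sub>R flux w \<Omega> (\<psi> \<epsilon>) x)"
  shows "(\<forall>\<epsilon>>0. J \<epsilon> \<in> flux_space w \<Omega> W) \<and>
    (\<exists>\<psi>0 J0.
       \<psi>0 \<in> C_h_zero mt D T w \<inter> W \<and> J0 \<in> flux_space w \<Omega> W \<and>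
       (\<forall>j. uniform_limit D (\<lambda>\<epsilon>. \<psi> \<epsilon> j) (\<psi>0 j) (at_right 0)) \<and>
       uniform_limit D J J0 (at_right 0) \<and>
       (\<forall>\<psi>' J'. mixed_solution D T w \<sigma>s \<sigma>a q (C_h_zero mt D T w \<inter> W) (flux_space w \<Omega> W) \<psi>' J'
                  \<longleftrightarrow> \<psi>' = \<psi>0 \<and> J' = J0))"
proof -
  note lip = assms(2)
  have bdd: "bdd_below (\<sigma>s ` D)" "bdd_below (\<sigma>a ` D)"
    by (rule bounded_imp_bdd_below[OF assms(5)], rule bounded_imp_bdd_below[OF assms(9)])
  have lower: "\<delta>s \<le> \<sigma>s x" "\<delta>a \<le> \<sigma>a x" if "x \<in> D" for x
    using cINF_lower[OF bdd(1) that] cINF_lower[OF bdd(2) that] assms(6,10) by simp_all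
  obtain C1 C2 where C: "\<And>x. x \<in> D \<Longrightarrow> \<bar>\<sigma>s x\<bar> \<le> C1" "\<And>x. x \<in> D \<Longrightarrow> \<bar>\<sigma>a x\<bar> \<le> C2"
    using assms(5,9) by (auto simp: bounded_iff)
  note quad = assms(14)[unfolded angular_quadrature_def]
  note mesh = assms(15)[unfolded is_mesh_def]
  have cell: "open_polytope K" if "K \<in> T" for K
    using mesh that is_cell_open_polytope by blast
  interpret asymptotic_problem T D mt w \<Omega> \<sigma>s \<sigma>a q \<delta>s \<delta>a "max C1 C2" W \<psi>
  proof unfold_locales
    show "polytope (closure K)" "interior (closure K) = K" "K \<noteq> {}" if "K \<in> T" for K
      using cell[OF that] unfolding open_polytope_def by blast+
    show "frontier D \<subseteq> closure (- closure D)"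
      by (rule lipschitz_domain_frontier[OF lip])
    show "open D" using lip by (simp add: lipschitz_domain_def)
    show "(\<Sum>j\<in>UNIV. (w j * (\<Omega> j \<bullet> a)) *\<^sub>R \<Omega> j) = (1/3) *\<^sub>R a" for a
      using quad by (intro second_moment_matrix) blast
    show "\<bar>\<sigma>s x\<bar> \<le> max C1 C2" "\<bar>\<sigma>a x\<bar> \<le> max C1 C2" if "x \<in> D" for x
      using C[OF that] by auto
    show "\<psi> \<epsilon> \<in> W \<and> (\<forall>v\<in>W. B_form D T w \<Omega> \<sigma>s \<sigma>a \<epsilon> (\<psi> \<epsilon>) v = Q_form T w q \<epsilon> v)" if "\<epsilon> > 0" for \<epsilon>
      by (rule assms(18)[OF that])
  qed (use mesh quad assms lower in blast)+
  have J: "J \<epsilon> = (\<lambda>x. (1 / \<epsilon>) *\<^sub>R flux w \<Omega> (\<psi> \<epsilon>) x)" if "\<epsilon> > 0" for \<epsilon>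
    by (rule assms(19)[OF that])
  have "J \<epsilon> \<in> flux_space w \<Omega> W" if "\<epsilon> > 0" for \<epsilon>
  proof -
    have "J \<epsilon> = flux w \<Omega> (\<lambda>j x. (1 / \<epsilon>) * \<psi> \<epsilon> j x)"
      unfolding J[OF that] by (rule ext) (rule flux_cmult[symmetric])
    then show ?thesis
      unfolding flux_space_def by (rule image_eqI[OF _ W_cmult[OF \<psi>_in_W[OF that]]])
  qed
  \<comment> \<open>\<open>J\<close> is prescribed for positive \<epsilon> only, which determines
    the limit from the right.\<close>
  moreover have "\<forall>\<^sub>F \<epsilon> in at_right 0. \<forall>x\<in>D. J \<epsilon> x = (1 / \<epsilon>) *\<^sub>R flux w \<Omega> (\<psi> \<epsilon>) x"
    using eventually_at_right_less by eventually_elim (simp add: J)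
  then have "uniform_limit D J J0 (at_right 0) \<longleftrightarrow> uniform_limit D (\<lambda>\<epsilon> x. (1 / \<epsilon>) *\<^sub>R flux w \<Omega> (\<psi> \<epsilon>) x) J0 (at_right 0)" for J0
    by (intro uniform_limit_cong) auto
  ultimately show ?thesis
    using diffusion_limit by simp
qed

end
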